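(* Let $n\ge2$ and let $(X,w)$ be a Euclidean $4$-design in $\mathbb R^n$ supported by two concentric spheres, $X=X_1\cup X_2$ with $X_i\subset S^{n-1}(r_i)$. Assume $0\notin X$, $w$ is constant on each $X_\lambda$, and $s_{\lambda,\mu}\le 2$ for $\lambda,\mu\in\{1,2\}$. Then $X$ has the structure of a coherent configuration, and: (1) $s_{1,2}=2$; (2) $(X,w)$ is either a tight Euclidean $4$-design, or $(X,w)$ is similar to one of the following Euclidean $4$-designs $(X',w')$ with $X'=X'_1\cup X'_2$, $X'_1\subset S^{n-1}(r_1)$, $X'_2\subset S^{n-1}(r_2)$: (i) $n=2$, $X'_1=\{\pm(\frac1{\sqrt2},\frac1{\sqrt2}),\pm(\frac1{\sqrt2},-\frac1{\sqrt2})\}$, $X'_2=\{(\pm r_2,0),(0,\pm r_2)\}$, $w'(\boldsymbol x)=1$ for $\boldsymbol x\in X'_1$ and $w'(\boldsymbol x)=r_2^{-4}$ for $\boldsymbol x\in X'_2$, where $r_2$ is any positive real number with $r_2\ne1$; (ii) $n=(2k-1)^2-4$ for an integer $k\ge2$, $|X'_1|=2(2k+1)(k-1)^3$, $|X'_2|=2k^3(2k-3)$, $A(X'_1,X'_1)=\{\frac{k-2}{k(2k-3)},-\frac1{2k-3}\}$, $A(X'_2,X'_2)=\{\frac1{2k+1},-\frac{k+1}{(k-1)(2k+1)}\}$, $A(X'_1,X'_2)=\{\frac1{\sqrt n},-\frac1{\sqrt n}\}$, $r_1=1$, $w'(\boldsymbol x)=1$ for $\boldsymbol x\in X'_1$ and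 $w'(\boldsymbol x)=\frac{(2k+1)^2(k-1)^4}{(2k-3)^2k^4}r_2^{-4}$ for $\boldsymbol x\in X'_2$, where $r_2$ is any positive real number with $r_2\ne1$.
   Context: A weighted finite set $(X,w)$ in $\mathbb R^n$: finite $X\subset\mathbb R^n$, $w:X\to\mathbb R_{>0}$. Write $X=X_1\cup\dots\cup X_p$ (disjoint, nonempty) with $X_i\subset S_i=S^{n-1}(r_i)$ (sphere of radius $r_i$ centred at the origin, $r_i$ distinct, $\ge0$). $(X,w)$ is a Euclidean $t$-design if $\sum_i\frac{w(X_i)}{|S_i|}\int_{S_i}f\,d\sigma_i=\sum_{\boldsymbol u\in X}w(\boldsymbol u)f(\boldsymbol u)$ for every polynomial $f$ of degree $\le t$, where $w(X_i)=\sum_{\boldsymbol x\in X_i}w(\boldsymbol x)$, $\sigma_i$ is surface measure on $S_i$, $|S_i|=\sigma_i(S_i)$ (and the average is $f(0)$ if $r_i=0$). For nonzero layers, $A(X_\lambda,X_\mu)=\{\frac{\boldsymbol x\cdot\boldsymbol y}{r_\lambda r_\mu}:\boldsymbol x\in X_\lambda,\boldsymbol y\in X_\mu,\boldsymbol x\ne\boldsymbol y\}$, $s_{\lambda,\mu}=|A(X_\lambda,X_\mu)|$. Let $S=\bigcup_iS_i$ and $\mathcal P_e(S)$ the space of restrictions to $S$ of polynomials of degree $\le e$. A Euclidean $2e$-design supported by $S$ satisfies $|X|\ge\dim\mathcal P_e(S)$; it is a tight Euclidean $2e$-design if $|X|=\dim\mathcal P_e(S)=\binom{n+e}{e}$.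 Two weighted sets $(X,w)$, $(X',w')$ are similar if there are a similarity transformation $\rho$ of $\mathbb R^n$ fixing the origin and $\mu>0$ with $X'=\rho^{-1}(X)$ and $w'(\boldsymbol x')=\mu\,w(\rho(\boldsymbol x'))$. A coherent configuration on a finite set $X$ is a partition of $X\times X$ into nonempty relations $R_0,\dots,R_d$ such that the diagonal is a union of some $R_i$, each transpose $R_i^{T}$ is some $R_{i'}$, and for $(\boldsymbol x,\boldsymbol y)\in R_k$ the number of $\boldsymbol z$ with $(\boldsymbol x,\boldsymbol z)\in R_i,(\boldsymbol z,\boldsymbol y)\in R_j$ depends only on $i,j,k$. "$X$ has the structure of a coherent configuration" means that the partition of $X\times X$ into the diagonals of the $X_\lambda\times X_\lambda$ and the classes $\{(\boldsymbol x,\boldsymbol y)\in X_\lambda\times X_\mu:\boldsymbol x\ne\boldsymbol y,\ \boldsymbol x\cdot\boldsymbol y=r_\lambda r_\mu\alpha\}$, $\alpha\in A(X_\lambda,X_\mu)$, is a coherent configuration. *)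

theory Defs
  imports "HOL-Analysis.Analysis" "HOL-Library.Function_Algebras" "HOL-Library.Disjoint_Sets"
begin

definition poly_funs :: "nat \<Rightarrow> (real^'n \<Rightarrow> real) set" where
  "poly_funs t = {f. \<exists>c. \<forall>x. f x =
     (\<Sum>\<alpha> | (\<Sum>i\<in>UNIV. \<alpha> i) \<le> t. c \<alpha> * (\<Prod>i\<in>UNIV. x $ i ^ \<alpha> i))}"

global_interpretation fun_space: vector_space "\<lambda>(a::real) (f::'a \<Rightarrow> real) x. a * f x"
  by unfold_locales (auto simp: fun_eq_iff algebra_simps)

text \<open>A function on \<open>S\<close> is represented by its extension by zero, so that the restrictions
  form a linear subspace of the functions on the whole space.\<close>

definition poly_funs_on :: "nat \<Rightarrow> (real^'n) set \<Rightarrow> (real^'n \<Rightarrow> real) set" where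
  "poly_funs_on t S = (\<lambda>f x. if x \<in> S then f x else 0) ` poly_funs t"

text \<open>For \<open>r > 0\<close> this is the cone description of surface measure: the area of \<open>A \<subseteq> sphere 0 r\<close>
  is \<open>n / r\<close> times the volume of the cone \<open>{s *\<^sub>R a | s a. 0 < s \<le> 1 \<and> a \<in> A}\<close>,
  which is the preimage of \<open>A\<close> in \<open>cball 0 r\<close> under radial projection.\<close>

definition sphere_measure :: "real \<Rightarrow> (real^'n) measure" where
  "sphere_measure r = scale_measure (ennreal (real CARD('n) / r))
     (distr (restrict_space lborel (cball 0 r)) borel (\<lambda>x. (r / norm x) *\<^sub>R x))"

definition sphere_average :: "real \<Rightarrow> (real^'n \<Rightarrow> real) \<Rightarrow> real" where
  "sphere_average r f = (if r = 0 then f 0 else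
     (LINT x:sphere 0 r|sphere_measure r. f x) / measure (sphere_measure r) (sphere (0::real^'n) r))"

definition weighted_set :: "(real^'n) set \<Rightarrow> (real^'n \<Rightarrow> real) \<Rightarrow> bool" where
  "weighted_set X w \<longleftrightarrow> finite X \<and> (\<forall>x\<in>X. w x > 0)"

text \<open>The radii \<open>r\<^sub>i\<close> are the elements of \<open>norm ` X\<close>, and the layers \<open>X\<^sub>i\<close> are the sets of
  points of \<open>X\<close> of a given norm.\<close>

definition euclidean_design :: "nat \<Rightarrow> (real^'n) set \<Rightarrow> (real^'n \<Rightarrow> real) \<Rightarrow> bool" where
  "euclidean_design t X w \<longleftrightarrow> weighted_set X w \<and>
     (\<forall>f\<in>poly_funs t.
        (\<Sum>r\<in>norm ` X. (\<Sum>x | x \<in> X \<and> norm x = r. w x) * sphere_average r f) = (\<Sum>x\<in>X. w x * f x))"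

definition support_spheres :: "(real^'n) set \<Rightarrow> (real^'n) set" where
  "support_spheres X = (\<Union>r\<in>norm ` X. sphere 0 r)"

text \<open>Tightness of a Euclidean \<open>2e\<close>-design; the first argument is \<open>e\<close>.\<close>

definition tight_euclidean_design :: "nat \<Rightarrow> (real^'n) set \<Rightarrow> (real^'n \<Rightarrow> real) \<Rightarrow> bool" where
  "tight_euclidean_design e X w \<longleftrightarrow> euclidean_design (2 * e) X w \<and>
     card X = fun_space.dim (poly_funs_on e (support_spheres X)) \<and>
     fun_space.dim (poly_funs_on e (support_spheres X)) = (CARD('n) + e) choose e"

definition similarity_fixing_0 :: "(real^'n \<Rightarrow> real^'n) \<Rightarrow> bool" where
  "similarity_fixing_0 \<rho> \<longleftrightarrow> bij \<rho> \<and> \<rho> 0 = 0 \<and> (\<exists>c>0. \<forall>x y. dist (\<rho> x) (\<rho> y) = c * dist x y)"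

definition similar_weighted ::
    "(real^'n) set \<Rightarrow> (real^'n \<Rightarrow> real) \<Rightarrow> (real^'n) set \<Rightarrow> (real^'n \<Rightarrow> real) \<Rightarrow> bool" where
  "similar_weighted X w X' w' \<longleftrightarrow>
     (\<exists>\<rho> \<mu>. similarity_fixing_0 \<rho> \<and> \<mu> > 0 \<and> X' = \<rho> -` X \<and> (\<forall>x'\<in>X'. w' x' = \<mu> * w (\<rho> x')))"

definition inner_values :: "real \<Rightarrow> real \<Rightarrow> (real^'n) set \<Rightarrow> (real^'n) set \<Rightarrow> real set" where
  "inner_values r s Y Z = {(x \<bullet> y) / (r * s) | x y. x \<in> Y \<and> y \<in> Z \<and> x \<noteq> y}"

definition coherent_configuration :: "'a set \<Rightarrow> ('a \<times> 'a) set set \<Rightarrow> bool" where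
  "coherent_configuration X \<R> \<longleftrightarrow> finite X \<and> partition_on (X \<times> X) \<R> \<and>
     (\<exists>\<D>\<subseteq>\<R>. Id_on X = \<Union>\<D>) \<and>
     (\<forall>R\<in>\<R>. R\<inverse> \<in> \<R>) \<and>
     (\<forall>R\<^sub>i\<in>\<R>. \<forall>R\<^sub>j\<in>\<R>. \<forall>R\<^sub>k\<in>\<R>. \<exists>p. \<forall>(x, y)\<in>R\<^sub>k. card {z \<in> X. (x, z) \<in> R\<^sub>i \<and> (z, y) \<in> R\<^sub>j} = p)"

definition layer_relations ::
    "nat set \<Rightarrow> (nat \<Rightarrow> real) \<Rightarrow> (nat \<Rightarrow> (real^'n) set) \<Rightarrow> ((real^'n) \<times> (real^'n)) set set" where
  "layer_relations I r X = {Id_on (X l) | l. l \<in> I} \<union>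
     {{(x, y) \<in> X l \<times> X m. x \<noteq> y \<and> x \<bullet> y = r l * r m * \<alpha>} | l m \<alpha>.
        l \<in> I \<and> m \<in> I \<and> \<alpha> \<in> inner_values (r l) (r m) (X l) (X m)}"

definition plane_vec :: "'n \<Rightarrow> 'n \<Rightarrow> real \<Rightarrow> real \<Rightarrow> real^'n" where
  "plane_vec i j a b = a *\<^sub>R axis i 1 + b *\<^sub>R axis j 1"

text \<open>Two distinct indices \<open>i\<close>, \<open>j\<close> exhaust the index type of size 2 and play the role of
  the first and the second coordinate.\<close>

definition two_squares_design ::
    "real \<Rightarrow> (real^'n) set \<Rightarrow> (real^'n) set \<Rightarrow> (real^'n \<Rightarrow> real) \<Rightarrow> bool" where
  "two_squares_design r\<^sub>2 X\<^sub>1 X\<^sub>2 w \<longleftrightarrow>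
     euclidean_design 4 (X\<^sub>1 \<union> X\<^sub>2) w \<and>
     CARD('n) = 2 \<and>
     (\<exists>i j. i \<noteq> j \<and>
        X\<^sub>1 = {plane_vec i j (1 / sqrt 2) (1 / sqrt 2), - plane_vec i j (1 / sqrt 2) (1 / sqrt 2),
              plane_vec i j (1 / sqrt 2) (- (1 / sqrt 2)), - plane_vec i j (1 / sqrt 2) (- (1 / sqrt 2))} \<and>
        X\<^sub>2 = {plane_vec i j r\<^sub>2 0, plane_vec i j (- r\<^sub>2) 0, plane_vec i j 0 r\<^sub>2, plane_vec i j 0 (- r\<^sub>2)}) \<and>
     (\<forall>x\<in>X\<^sub>1. w x = 1) \<and> (\<forall>x\<in>X\<^sub>2. w x = 1 / r\<^sub>2 ^ 4)"

definition k_family_design ::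
    "nat \<Rightarrow> real \<Rightarrow> (real^'n) set \<Rightarrow> (real^'n) set \<Rightarrow> (real^'n \<Rightarrow> real) \<Rightarrow> bool" where
  "k_family_design k r\<^sub>2 X\<^sub>1 X\<^sub>2 w \<longleftrightarrow>
     euclidean_design 4 (X\<^sub>1 \<union> X\<^sub>2) w \<and>
     X\<^sub>1 \<subseteq> sphere 0 1 \<and> X\<^sub>2 \<subseteq> sphere 0 r\<^sub>2 \<and>
     int CARD('n) = (2 * int k - 1)\<^sup>2 - 4 \<and>
     int (card X\<^sub>1) = 2 * (2 * int k + 1) * (int k - 1) ^ 3 \<and>
     int (card X\<^sub>2) = 2 * int k ^ 3 * (2 * int k - 3) \<and>
     inner_values 1 1 X\<^sub>1 X\<^sub>1 =
       {(real k - 2) / (real k * (2 * real k - 3)), - (1 / (2 * real k - 3))} \<and>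
     inner_values r\<^sub>2 r\<^sub>2 X\<^sub>2 X\<^sub>2 =
       {1 / (2 * real k + 1), - ((real k + 1) / ((real k - 1) * (2 * real k + 1)))} \<and>
     inner_values 1 r\<^sub>2 X\<^sub>1 X\<^sub>2 = {1 / sqrt (real CARD('n)), - (1 / sqrt (real CARD('n)))} \<and>
     (\<forall>x\<in>X\<^sub>1. w x = 1) \<and>
     (\<forall>x\<in>X\<^sub>2. w x = (2 * real k + 1)\<^sup>2 * (real k - 1) ^ 4 / ((2 * real k - 3)\<^sup>2 * real k ^ 4) / r\<^sub>2 ^ 4)"

end

theory Submission
  imports Defs
begin

text \<open>Since \<open>|x|\<^sup>2\<close> takes two different values on \<open>X\<close>, the conditions of degrees 3 and 4 force every
  layer to be a spherical 2-design. With at most two inner products between any two layers, each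
  relation is an affine function of the inner product, up to the diagonal, so the intersection
  numbers are determined by moments of degree at most 2; this gives the coherent configuration.

  Normalise both layers to unit vectors. The two cross values have product \<open>- 1/n\<close>; let \<open>\<sigma>\<close> be
  their sum. The kernel \<open>(x \<bullet> y)\<^sup>2 - 1/n\<close> of the harmonic polynomials of degree 2 lies in the span of
  the all-one functions, the linear functions and their complement in each layer, and the conditions
  of degrees 3 and 4 say that its weighted version is a multiple of a projection. If \<open>\<sigma> \<noteq> 0\<close>,
  comparing traces gives \<open>|X| = (n + 1) (n + 2) / 2\<close>, so the design is tight. If \<open>\<sigma> = 0\<close>, the kernel
  vanishes on linear functions, each layer is a spherical 3-design (so the radii can be changed
  freely), and one parameter besides \<open>n\<close> remains. Counting shows that the inner products in a layer are rational, so the eigenvalues of its strongly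
  regular graph are integers, and this leaves \<open>n = 2\<close> and the family \<open>n = (2 k - 1)\<^sup>2 - 4\<close>.\<close>

text \<open>In block form the kernel kills the constants of each layer, has eigenvalue
  \<open>h1\<close> or \<open>h2\<close> on the linear functions of a layer, where
  \<open>\<sigma>\<close> couples the layers, and \<open>g1\<close> or \<open>g2\<close> on the
  rest. The trace of the weighted kernel is its nonzero eigenvalue \<open>C\<close> times
  \<open>(n - 1) (n + 2) / 2\<close>, the dimension of the harmonic polynomials of degree 2. The two
  counts of points differ only in the linear functions, of dimension \<open>2 n\<close> on both
  layers together: they contribute \<open>n C\<close> to the trace if
  \<open>\<sigma> \<noteq> 0\<close> and nothing if \<open>\<sigma> = 0\<close>. The obstacle is a
  layer that is a regular simplex. There the Gram matrix and the projection off the constants are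
  proportional, so comparing coefficients does not determine the eigenvalue on the complement; but
  that complement is trivial and drops out of the trace. For \<open>\<sigma> = 0\<close>,
  rationality holds because \<open>n (x \<bullet> z) (y \<bullet> z)\<close> is \<open>1\<close> or
  \<open>-1\<close> for \<open>x\<close>, \<open>y\<close> in one layer and \<open>z\<close> in the
  other. Integrality is exploited for the larger layer only, where the inequalities are sharp
  enough; the smaller layer follows from the total number of points.\<close>

section \<open>Averages over spheres\<close>

text \<open>By Vitali, \<open>U\<close> is up to a null set a disjoint union of balls, and \<open>f\<close> preserves their radii.\<close>

lemma emeasure_lborel_orthogonal_image_ge:
  fixes f :: "'a::euclidean_space \<Rightarrow> 'a"
  assumes f: "orthogonal_transformation f" and U: "open U"
  shows "emeasure lborel U \<le> emeasure lborel (f ` U)"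
proof -
  define K where "K = {(a::'a, s::real). 0 < s \<and> ball a s \<subseteq> U}"
  have "\<exists>i. i \<in> K \<and> x \<in> ball (fst i) (snd i) \<and> snd i < d" if "0 < d" "x \<in> U" for x d
  proof -
    obtain e where e: "e > 0" "ball x e \<subseteq> U" using U \<open>x \<in> U\<close> by (meson openE)
    have "ball x (min e (d/2)) \<subseteq> U" using e by auto
    then show ?thesis using e that by (intro exI[of _ "(x, min e (d/2))"]) (auto simp: K_def)
  qed
  then obtain C where C: "countable C" "C \<subseteq> K"
      "pairwise (\<lambda>i j. disjnt (ball (fst i) (snd i)) (ball (fst j) (snd j))) C"
      "negligible (U - (\<Union>i\<in>C. ball (fst i) (snd i)))"
    by (rule Vitali_covering_theorem_balls[of U K fst snd])
  let ?B = "\<lambda>i. ball (fst i) (snd i)"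
  have df: "disjoint_family_on ?B C"
    using C(3) by (auto simp: disjoint_family_on_def pairwise_def disjnt_def)
  have inj: "inj f" using f orthogonal_transformation_inj by blast
  have img: "f ` ball a s = ball (f a) s" for a s
    using f image_orthogonal_transformation_ball by blast
  have df': "disjoint_family_on (\<lambda>i. f ` ?B i) C"
    using df inj unfolding disjoint_family_on_def by (metis image_Int image_empty)
  have sub: "(\<Union>i\<in>C. ?B i) \<subseteq> U" using C(2) by (force simp: K_def)
  have eq: "emeasure lborel (?B i) = emeasure lborel (f ` ?B i)" if "i \<in> C" for i
    using that C(2) by (auto simp: img emeasure_ball K_def)
  have opU: "open (\<Union>i\<in>C. ?B i)" by (intro open_UN ballI open_ball)
  then have "U - (\<Union>i\<in>C. ?B i) \<in> sets lborel" using U by (simp add: borel_open sets.Diff)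
  moreover have "U - (\<Union>i\<in>C. ?B i) \<in> null_sets lebesgue"
    using C(4) by (simp only: negligible_iff_null_sets)
  ultimately have null: "U - (\<Union>i\<in>C. ?B i) \<in> null_sets lborel"
    by (rule null_sets_completion_iff[THEN iffD1])
  have "emeasure lborel U = emeasure lborel (\<Union>i\<in>C. ?B i)"
    using emeasure_Un_null_set[OF _ null, of "\<Union>i\<in>C. ?B i"] opU sub
    by (simp add: Un_absorb1)
  also have "\<dots> = (\<integral>\<^sup>+i. emeasure lborel (?B i) \<partial>count_space C)"
    using C(1) df by (intro emeasure_UN_countable) auto
  also have "\<dots> = (\<integral>\<^sup>+i. emeasure lborel (f ` ?B i) \<partial>count_space C)"
    using eq by (intro nn_integral_cong) auto
  also have "\<dots> = emeasure lborel (\<Union>i\<in>C. f ` ?B i)"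
    using C(1) df' by (intro emeasure_UN_countable[symmetric]) (auto simp: img)
  also have "\<dots> \<le> emeasure lborel (f ` U)"
  proof (rule emeasure_mono)
    show "(\<Union>i\<in>C. f ` ?B i) \<subseteq> f ` U" using sub by blast
    have "open (f ` U)"
      using U f by (metis open_surjective_linear_image orthogonal_transformation_linear orthogonal_transformation_surj)
    then show "f ` U \<in> sets lborel" by simp
  qed
  finally show ?thesis .
qed

text \<open>Boxes determine the measure. The preceding inequality, applied to \<open>f\<close> on
  the preimage of a box and to \<open>inv f\<close> on the box itself, gives both directions
  there.\<close>

lemma distr_lborel_orthogonal:
  fixes f :: "'a::euclidean_space \<Rightarrow> 'a"
  assumes f: "orthogonal_transformation f"
  shows "distr lborel borel f = lborel"
proof (rule lborel_eqI[symmetric])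
  fix l u :: 'a assume lu: "\<And>b. b \<in> Basis \<Longrightarrow> l \<bullet> b \<le> u \<bullet> b"
  have cont: "continuous_on UNIV f"
    using f by (simp add: linear_continuous_on linear_linear orthogonal_transformation_linear)
  then have meas[measurable]: "f \<in> borel_measurable borel"
    by (rule borel_measurable_continuous_onI)
  have op: "open (f -` box l u)"
    using cont by (simp add: open_vimage open_box)
  have inv: "orthogonal_transformation (inv f)" using f orthogonal_transformation_inv by blast
  have b: "bij f" using f orthogonal_transformation_bij by blast
  have 1: "inv f ` box l u = f -` box l u" "f ` (f -` box l u) = box l u"
    using b by (simp_all add: bij_vimage_eq_inv_image bij_is_surj surj_image_vimage_eq flip: bij_vimage_eq_inv_image)
  have "emeasure lborel (f -` box l u) = emeasure lborel (box l u)"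
    using emeasure_lborel_orthogonal_image_ge[OF f op]
      emeasure_lborel_orthogonal_image_ge[OF inv, of "box l u"] 1 open_box[of l u] by (simp add: antisym)
  then show "emeasure (distr lborel borel f) (box l u) = ennreal (\<Prod>b\<in>Basis. (u - l) \<bullet> b)"
    using lu by (simp add: emeasure_distr)
qed simp

section \<open>Surface measure and its invariance\<close>

lemma sets_sphere_measure [simp, measurable_cong]: "sets (sphere_measure r) = sets borel"
  by (simp add: sphere_measure_def)

lemma space_sphere_measure [simp]: "space (sphere_measure r) = UNIV"
  by (simp add: sphere_measure_def space_scale_measure)

lemma radial_measurable [measurable]:
  "(\<lambda>x::'a::euclidean_space. (r / norm x) *\<^sub>R x) \<in> borel_measurable borel"
  by measurable

lemma emeasure_sphere_measure:
  assumes [measurable]: "A \<in> sets borel"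
  shows "emeasure (sphere_measure r :: (real^'n) measure) A = ennreal (real CARD('n) / r) *
    emeasure lborel ((\<lambda>x. (r / norm x) *\<^sub>R x) -` A \<inter> cball 0 r)"
proof -
  have m: "(\<lambda>x::real^'n. (r / norm x) *\<^sub>R x) \<in> restrict_space lborel (cball 0 r) \<rightarrow>\<^sub>M borel"
    by (intro measurable_restrict_space1) measurable
  have "(\<lambda>x::real^'n. (r / norm x) *\<^sub>R x) -` A \<inter> cball 0 r \<in> sets borel"
    by (intro sets.Int measurable_sets_borel[OF radial_measurable]) auto
  then show ?thesis
    by (simp add: sphere_measure_def emeasure_distr[OF m] space_restrict_space emeasure_restrict_space)
qed

lemma sphere_measure_sphere:
  assumes "r > 0"
  shows "emeasure (sphere_measure r) (sphere (0::real^'n) r) < \<infinity>"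
    and "measure (sphere_measure r) (sphere (0::real^'n) r) > 0"
proof -
  let ?P = "(\<lambda>x::real^'n. (r / norm x) *\<^sub>R x) -` sphere 0 r \<inter> cball 0 r"
  \<comment> \<open>Since \<open>r / norm 0\<close> is \<open>0\<close>, the projection leaves the
    centre at \<open>0\<close>, off the sphere; every other point of the ball lands on it.\<close>
  have P: "?P = cball 0 r - {0}" using assms by auto
  have "emeasure lborel (cball (0::real^'n) r - {0}) = emeasure lborel (cball (0::real^'n) r)"
    by (intro emeasure_Diff_null_set) (auto simp: null_sets_def)
  then have *: "emeasure (sphere_measure r) (sphere (0::real^'n) r)
      = ennreal (real CARD('n) / r * measure lborel (cball (0::real^'n) r))"
    using assms emeasure_eq_ennreal_measure[of lborel "cball (0::real^'n) r"]
      emeasure_lborel_cball_finite[of "0::real^'n" r]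
    by (simp add: emeasure_sphere_measure P ennreal_mult'[symmetric] less_top)
  then show "emeasure (sphere_measure r) (sphere (0::real^'n) r) < \<infinity>" by simp
  have "measure lborel (cball (0::real^'n) r) > 0"
    using assms by (simp add: content_cball_pos)
  then show "measure (sphere_measure r) (sphere (0::real^'n) r) > 0"
    using assms unfolding measure_def * by (simp add: zero_less_mult_iff)
qed

text \<open>\<open>f\<close> preserves norms and commutes with the radial projection, so the
  invariance of Lebesgue measure passes to the cones that define surface measure.\<close>

lemma distr_sphere_measure_orthogonal:
  fixes f :: "real^'n \<Rightarrow> real^'n"
  assumes f: "orthogonal_transformation f"
  shows "distr (sphere_measure r) borel f = sphere_measure r"
proof (rule measure_eqI)
  fix A assume "A \<in> sets (distr (sphere_measure r) borel f)"
  then have A[measurable]: "A \<in> sets borel" by simp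
  have cont: "continuous_on UNIV f"
    using f by (simp add: linear_continuous_on linear_linear orthogonal_transformation_linear)
  then have meas[measurable]: "f \<in> borel_measurable borel"
    by (rule borel_measurable_continuous_onI)
  have m: "f \<in> sphere_measure r \<rightarrow>\<^sub>M borel" by measurable
  have fA: "f -` A \<in> sets borel" using measurable_sets_borel[OF meas A] by simp
  let ?p = "\<lambda>x::real^'n. (r / norm x) *\<^sub>R x"
  have B: "?p -` A \<inter> cball 0 r \<in> sets borel"
    by (intro sets.Int measurable_sets_borel[OF radial_measurable]) auto
  have pf: "?p (f x) = f (?p x)" for x
    using f by (simp add: orthogonal_transformation_norm orthogonal_transformation_scaleR)
  have "?p -` (f -` A) \<inter> cball 0 r = f -` (?p -` A \<inter> cball 0 r)"
    using f by (auto simp: orthogonal_transformation_norm orthogonal_transformation_scaleR)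
  then have "emeasure lborel (?p -` (f -` A) \<inter> cball 0 r) = emeasure (distr lborel borel f) (?p -` A \<inter> cball 0 r)"
    using B by (simp add: emeasure_distr)
  then show "emeasure (distr (sphere_measure r) borel f) A = emeasure (sphere_measure r) A"
    using fA by (simp add: emeasure_distr[OF m] emeasure_sphere_measure distr_lborel_orthogonal[OF f])
qed simp

lemma sphere_integrable:
  fixes f :: "real^'n \<Rightarrow> real"
  assumes "r > 0" and "continuous_on UNIV f"
  shows "set_integrable (sphere_measure r) (sphere 0 r) f"
proof -
  have [measurable]: "f \<in> borel_measurable borel" using assms(2) by (rule borel_measurable_continuous_onI)
  have "bounded (f ` sphere 0 r)"
    using assms(2) by (intro compact_imp_bounded compact_continuous_image) (auto intro: continuous_on_subset)
  then obtain B where "\<And>x. x \<in> sphere 0 r \<Longrightarrow> norm (f x) \<le> B" unfolding bounded_iff by blast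
  then show ?thesis unfolding set_integrable_def
    using sphere_measure_sphere(1)[OF assms(1), where 'n='n]
    by (intro integrableI_bounded_set[where A="sphere 0 r" and B="B"])
       (auto simp: indicator_def)
qed

section \<open>Moments of the uniform distribution on a sphere\<close>

lemma sphere_average_add:
  assumes "r > 0" "continuous_on UNIV f" "continuous_on UNIV g"
  shows "sphere_average r (\<lambda>x. f x + g x) = sphere_average r f + sphere_average r g"
  using assms set_integral_add(2)[OF sphere_integrable[OF assms(1,2)] sphere_integrable[OF assms(1,3)]]
  by (simp add: sphere_average_def add_divide_distrib)

lemma sphere_average_cmult:
  assumes "r > 0"
  shows "sphere_average r (\<lambda>x. c * f x) = c * sphere_average r f"
  using assms by (simp add: sphere_average_def)

lemma sphere_average_cong:
  assumes "r > 0" "\<And>x. norm x = r \<Longrightarrow> f x = g x"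
  shows "sphere_average r f = sphere_average r g"
proof -
  have "(LINT x:sphere 0 r|sphere_measure r. f x) = (LINT x:sphere 0 r|sphere_measure r. g x)"
    using assms(2) by (intro set_lebesgue_integral_cong) auto
  then show ?thesis using assms(1) by (simp add: sphere_average_def)
qed

lemma sphere_average_const:
  assumes "r > 0"
  shows "sphere_average r (\<lambda>x::real^'n. c) = c"
  using assms sphere_measure_sphere[OF assms, where 'n='n]
  by (simp add: sphere_average_def set_integral_const)

lemma sphere_average_sum:
  assumes "r > 0" "finite I" "\<And>i. i \<in> I \<Longrightarrow> continuous_on UNIV (f i)"
  shows "sphere_average r (\<lambda>x::real^'n. \<Sum>i\<in>I. f i x) = (\<Sum>i\<in>I. sphere_average r (f i))"
  using assms(2,3)
proof (induction I rule: finite_induct)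
  case empty
  then show ?case using sphere_average_const[OF assms(1), of 0] by simp
next
  case (insert i I)
  then have "continuous_on UNIV (f i)" "continuous_on UNIV (\<lambda>x. \<Sum>i\<in>I. f i x)"
    by (auto intro!: continuous_on_sum)
  then show ?case using insert by (simp add: sphere_average_add[OF assms(1)])
qed

lemma sphere_average_orthogonal:
  fixes f :: "real^'n \<Rightarrow> real"
  assumes "r > 0" "continuous_on UNIV f" and g: "orthogonal_transformation (g :: real^'n \<Rightarrow> real^'n)"
  shows "sphere_average r (\<lambda>x. f (g x)) = sphere_average r f"
proof -
  have [measurable]: "f \<in> borel_measurable borel" using assms(2) by (rule borel_measurable_continuous_onI)
  have "continuous_on UNIV g"
    using g by (simp add: linear_continuous_on linear_linear orthogonal_transformation_linear)
  then have [measurable]: "g \<in> borel_measurable borel"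
    by (rule borel_measurable_continuous_onI)
  have "(LINT x:sphere 0 r|sphere_measure r. f x)
      = (LINT x:sphere 0 r|distr (sphere_measure r) borel g. f x)"
    by (simp add: distr_sphere_measure_orthogonal[OF g])
  also have "\<dots> = (\<integral>x. indicator (sphere 0 r) (g x) *\<^sub>R f (g x) \<partial>sphere_measure r)"
    unfolding set_lebesgue_integral_def
  proof (rule integral_distr)
    show "(\<lambda>x. indicat_real (sphere 0 r) x *\<^sub>R f x) \<in> borel_measurable borel"
      using \<open>f \<in> borel_measurable borel\<close> by (intro borel_measurable_scaleR borel_measurable_indicator) auto
  qed measurable
  also have "\<dots> = (LINT x:sphere 0 r|sphere_measure r. f (g x))"
    unfolding set_lebesgue_integral_def using g
    by (intro Bochner_Integration.integral_cong) (auto simp: indicator_def orthogonal_transformation_norm)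
  finally show ?thesis using assms(1) by (simp add: sphere_average_def)
qed

lemma sphere_average_odd:
  fixes f :: "real^'n \<Rightarrow> real"
  assumes "r > 0" "continuous_on UNIV f" "\<And>x. f (- x) = - f x"
  shows "sphere_average r f = 0"
proof -
  have "sphere_average r (\<lambda>x. f (- x)) = sphere_average r f"
    by (intro sphere_average_orthogonal assms) (simp add: orthogonal_transformation_neg)
  moreover have "sphere_average r (\<lambda>x. f (- x)) = - sphere_average r f"
    using sphere_average_cmult[OF assms(1), of "-1" f] by (simp add: assms(3))
  ultimately show ?thesis by simp
qed

lemma sphere_average_inner:
  assumes "r > 0"
  shows "sphere_average r (\<lambda>x. a \<bullet> x) = 0"
  by (rule sphere_average_odd[OF assms]) (auto intro!: continuous_intros)

lemma sphere_average_inner3: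
  assumes "r > 0"
  shows "sphere_average r (\<lambda>x. (a \<bullet> x) * (b \<bullet> x) * (c \<bullet> x)) = 0"
  by (rule sphere_average_odd[OF assms]) (auto intro!: continuous_intros)

lemma sphere_average_power_norm_eq:
  fixes a b :: "real^'n"
  assumes "r > 0" "norm a = norm b"
  shows "sphere_average r (\<lambda>x. (a \<bullet> x) ^ k) = sphere_average r (\<lambda>x. (b \<bullet> x) ^ k)"
proof -
  obtain f where f: "orthogonal_transformation f" "f a = b"
    using orthogonal_transformation_exists[OF assms(2)] .
  have "sphere_average r (\<lambda>x. (b \<bullet> f x) ^ k) = sphere_average r (\<lambda>x. (b \<bullet> x) ^ k)"
    by (intro sphere_average_orthogonal assms f continuous_intros)
  moreover have "b \<bullet> f x = a \<bullet> x" for x using f by (auto simp: orthogonal_transformation_def)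
  ultimately show ?thesis by simp
qed

lemma sphere_average_power:
  fixes a :: "real^'n"
  assumes "r > 0"
  shows "sphere_average r (\<lambda>x. (a \<bullet> x) ^ k)
    = norm a ^ k * sphere_average r (\<lambda>x::real^'n. (x $ i) ^ k)"
proof -
  have "sphere_average r (\<lambda>x. (a \<bullet> x) ^ k)
      = sphere_average r (\<lambda>x. ((norm a *\<^sub>R axis i 1) \<bullet> x) ^ k)"
    by (intro sphere_average_power_norm_eq assms) simp
  also have "\<dots> = sphere_average r (\<lambda>x. norm a ^ k * (x $ i) ^ k)"
    by (simp add: power_mult_distrib inner_axis' )
  finally show ?thesis by (simp add: sphere_average_cmult[OF assms])
qed

lemma norm_power2_vec: "(norm (x::real^'n))\<^sup>2 = (\<Sum>i\<in>UNIV. (x $ i)\<^sup>2)"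
  by (simp add: norm_vec_def L2_set_def sum_nonneg)

text \<open>The second moments of the coordinates agree by symmetry and add up to
  \<open>r\<^sup>2\<close>.\<close>

lemma sphere_average_square:
  fixes a :: "real^'n"
  assumes r: "r > 0"
  shows "sphere_average r (\<lambda>x. (a \<bullet> x)\<^sup>2) = r\<^sup>2 / real CARD('n) * (a \<bullet> a)"
proof -
  define i :: 'n where "i = undefined"
  let ?m = "sphere_average r (\<lambda>x::real^'n. (x $ i)\<^sup>2)"
  have j: "sphere_average r (\<lambda>x::real^'n. (x $ j)\<^sup>2) = ?m" for j
    using sphere_average_power[OF r, of "axis j 1" 2 i] by (simp add: inner_axis')
  have "real CARD('n) * ?m = (\<Sum>j\<in>(UNIV::'n set). ?m)" by simp
  also have "\<dots> = (\<Sum>j\<in>UNIV. sphere_average r (\<lambda>x::real^'n. (x $ j)\<^sup>2))"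
    by (intro sum.cong refl j[symmetric])
  also have "\<dots> = sphere_average r (\<lambda>x::real^'n. \<Sum>j\<in>UNIV. (x $ j)\<^sup>2)"
    by (intro sphere_average_sum[symmetric] r continuous_intros) auto
  also have "\<dots> = sphere_average r (\<lambda>x::real^'n. r\<^sup>2)"
    by (intro sphere_average_cong r) (simp flip: norm_power2_vec)
  finally have "real CARD('n) * ?m = r\<^sup>2" by (simp add: sphere_average_const[OF r])
  then have "?m = r\<^sup>2 / real CARD('n)" by (simp add: field_simps)
  then show ?thesis using sphere_average_power[OF r, of a 2 i] by (simp add: power2_norm_eq_inner)
qed

lemma sphere_average_inner2:
  fixes a b :: "real^'n"
  assumes r: "r > 0"
  shows "sphere_average r (\<lambda>x. (a \<bullet> x) * (b \<bullet> x)) = r\<^sup>2 / real CARD('n) * (a \<bullet> b)"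
proof -
  have "sphere_average r (\<lambda>x. ((a + b) \<bullet> x)\<^sup>2)
      = sphere_average r (\<lambda>x. (a \<bullet> x)\<^sup>2 + (2 * ((a \<bullet> x) * (b \<bullet> x)) + (b \<bullet> x)\<^sup>2))"
    by (simp add: inner_add_left power2_eq_square algebra_simps)
  also have "\<dots> = sphere_average r (\<lambda>x. (a \<bullet> x)\<^sup>2) +
      (2 * sphere_average r (\<lambda>x. (a \<bullet> x) * (b \<bullet> x)) + sphere_average r (\<lambda>x. (b \<bullet> x)\<^sup>2))"
    by (simp add: sphere_average_add[OF r] sphere_average_cmult[OF r] continuous_intros)
  finally show ?thesis unfolding sphere_average_square[OF r]
    by (simp add: inner_add_left inner_add_right inner_commute[of b a] field_simps)
qed

text \<open>The constant comes from \<open>E (a \<bullet> x)\<^sup>2 (b \<bullet> x)\<^sup>2 = E (a \<bullet> x)\<^sup>4 / 3\<close> for orthonormal \<open>a\<close>, \<open>b\<close> (rotate the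
  pair by 45 degrees) and from \<open>E (\<Sum>i. x\<^sub>i\<^sup>2)\<^sup>2 = r\<^sup>4\<close>.\<close>

lemma sphere_average_fourth:
  fixes a :: "real^'n"
  assumes r: "r > 0"
  shows "sphere_average r (\<lambda>x. (a \<bullet> x) ^ 4)
    = 3 * r ^ 4 / (real CARD('n) * (real CARD('n) + 2)) * (a \<bullet> a)\<^sup>2"
proof -
  define i :: 'n where "i = undefined"
  let ?n = "real CARD('n)"
  define m where "m = sphere_average r (\<lambda>x::real^'n. (x $ i) ^ 4)"
  have p: "sphere_average r (\<lambda>x. (c \<bullet> x) ^ 4) = (c \<bullet> c)\<^sup>2 * m" for c :: "real^'n"
    using sphere_average_power[OF r, of c 4 i]
    by (simp add: m_def flip: power2_norm_eq_inner)
  have diag: "sphere_average r (\<lambda>x::real^'n. (x $ j)\<^sup>2 * (x $ j)\<^sup>2) = m" for j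
    using p[of "axis j 1"] by (simp add: inner_axis' flip: power_add)
  have off: "sphere_average r (\<lambda>x::real^'n. (x $ j)\<^sup>2 * (x $ k)\<^sup>2) = m / 3" if "j \<noteq> k" for j k
  proof -
    let ?a = "axis j 1 :: real^'n" and ?b = "axis k 1 :: real^'n"
    have ab: "?a \<bullet> ?b = 0" "?b \<bullet> ?a = 0" "?a \<bullet> ?a = 1" "?b \<bullet> ?b = 1"
      using that by (auto simp: inner_axis_axis)
    have "12 * sphere_average r (\<lambda>x::real^'n. (x $ j)\<^sup>2 * (x $ k)\<^sup>2) + (2 * m + 2 * m)
       = sphere_average r (\<lambda>x. 12 * ((x $ j)\<^sup>2 * (x $ k)\<^sup>2) + (2 * (?a \<bullet> x) ^ 4 + 2 * (?b \<bullet> x) ^ 4))"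
      by (simp add: sphere_average_add[OF r] sphere_average_cmult[OF r] continuous_intros p ab
          del: inner_axis inner_axis')
    also have "\<dots> = sphere_average r (\<lambda>x. ((?a + ?b) \<bullet> x) ^ 4 + ((?a - ?b) \<bullet> x) ^ 4)"
    proof (rule arg_cong[where f="sphere_average r"], rule ext)
      fix x :: "real^'n"
      have "12 * (u\<^sup>2 * v\<^sup>2) + (2 * u ^ 4 + 2 * v ^ 4) = (u + v) ^ 4 + (u - v) ^ 4" for u v :: real
        by algebra
      then show "12 * ((x $ j)\<^sup>2 * (x $ k)\<^sup>2) + (2 * (?a \<bullet> x) ^ 4 + 2 * (?b \<bullet> x) ^ 4)
          = ((?a + ?b) \<bullet> x) ^ 4 + ((?a - ?b) \<bullet> x) ^ 4"
        by (simp add: inner_axis' inner_add_left inner_diff_left)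
    qed
    also have "\<dots> = 8 * m"
    proof -
      \<comment> \<open>Both \<open>?a + ?b\<close> and \<open>?a - ?b\<close> have squared length
        2, so each quartic average is \<open>4 * m\<close>.\<close>
      have "sphere_average r (\<lambda>x. ((?a + ?b) \<bullet> x) ^ 4 + ((?a - ?b) \<bullet> x) ^ 4)
          = ((?a + ?b) \<bullet> (?a + ?b))\<^sup>2 * m + ((?a - ?b) \<bullet> (?a - ?b))\<^sup>2 * m"
        unfolding p[symmetric] by (intro sphere_average_add r continuous_intros)
      then show ?thesis
        by (simp add: inner_add_left inner_add_right inner_diff_left inner_diff_right ab
            del: inner_axis inner_axis')
    qed
    finally show ?thesis by simp
  qed
  have "(\<Sum>j\<in>UNIV. \<Sum>k\<in>UNIV. sphere_average r (\<lambda>x::real^'n. (x $ j)\<^sup>2 * (x $ k)\<^sup>2))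
      = sphere_average r (\<lambda>x::real^'n. \<Sum>j\<in>UNIV. \<Sum>k\<in>UNIV. (x $ j)\<^sup>2 * (x $ k)\<^sup>2)"
    by (subst sphere_average_sum[OF r], simp, intro continuous_intros,
        subst sphere_average_sum[OF r], simp, intro continuous_intros, simp)
  also have "\<dots> = sphere_average r (\<lambda>x::real^'n. r ^ 4)"
    by (intro sphere_average_cong r)
      (simp add: sum_product[symmetric] flip: norm_power2_vec power_add)
  finally have "(\<Sum>j\<in>UNIV. \<Sum>k\<in>UNIV. sphere_average r (\<lambda>x::real^'n. (x $ j)\<^sup>2 * (x $ k)\<^sup>2)) = r ^ 4"
    by (simp add: sphere_average_const[OF r])
  moreover have "(\<Sum>k\<in>UNIV. sphere_average r (\<lambda>x::real^'n. (x $ j)\<^sup>2 * (x $ k)\<^sup>2)) = m + (?n - 1) * (m / 3)" for j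
  proof -
    have "(\<Sum>k\<in>UNIV. sphere_average r (\<lambda>x::real^'n. (x $ j)\<^sup>2 * (x $ k)\<^sup>2))
       = m + (\<Sum>k\<in>UNIV - {j}. sphere_average r (\<lambda>x::real^'n. (x $ j)\<^sup>2 * (x $ k)\<^sup>2))"
      using diag by (simp add: sum.remove[of UNIV j])
    also have "(\<Sum>k\<in>UNIV - {j}. sphere_average r (\<lambda>x::real^'n. (x $ j)\<^sup>2 * (x $ k)\<^sup>2)) = (\<Sum>k\<in>UNIV - {j}. m / 3)"
      by (intro sum.cong) (auto simp: off)
    finally show ?thesis by (simp add: card_Diff_singleton of_nat_diff Suc_leI)
  qed
  ultimately have "?n * (m + (?n - 1) * (m / 3)) = r ^ 4" by simp
  then have "m * (?n * (?n + 2)) = 3 * r ^ 4" by (simp add: field_simps)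
  then have "m = 3 * r ^ 4 / (?n * (?n + 2))"
    by (metis nonzero_eq_divide_eq mult_eq_0_iff add_is_0 of_nat_0_eq_iff of_nat_add of_nat_numeral zero_less_card_finite less_irrefl zero_neq_numeral)
  then show ?thesis using p[of a] by simp
qed

lemma sphere_average_inner4:
  fixes a b c d :: "real^'n"
  assumes r: "r > 0"
  shows "sphere_average r (\<lambda>x. (a \<bullet> x) * (b \<bullet> x) * (c \<bullet> x) * (d \<bullet> x))
    = r ^ 4 / (real CARD('n) * (real CARD('n) + 2)) *
      ((a \<bullet> b) * (c \<bullet> d) + (a \<bullet> c) * (b \<bullet> d) + (a \<bullet> d) * (b \<bullet> c))"
proof -
  define \<kappa> where "\<kappa> = r ^ 4 / (real CARD('n) * (real CARD('n) + 2))"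
  have p: "sphere_average r (\<lambda>x. (e \<bullet> x) ^ 4) = 3 * \<kappa> * (e \<bullet> e)\<^sup>2" for e :: "real^'n"
    using sphere_average_fourth[OF r, of e] by (simp add: \<kappa>_def)
  have cont: "continuous_on UNIV (\<lambda>x. (e \<bullet> x) ^ 4)" for e :: "real^'n"
    by (intro continuous_intros)
  \<comment> \<open>Polarisation: the eight sign patterns with \<open>p\<close> positive, each
    counted with the product of its signs. The constant is \<open>8 * 4!\<close>.\<close>
  have id: "192 * (p * q * s * t) = (p+q+s+t)^4 + (p+q-s-t)^4 + (p-q+s-t)^4 + (p-q-s+t)^4
      - ((p+q+s-t)^4 + (p+q-s+t)^4 + (p-q+s+t)^4 + (p-q-s-t)^4)" for p q s t :: real
    by algebra
  have "192 * sphere_average r (\<lambda>x. (a \<bullet> x) * (b \<bullet> x) * (c \<bullet> x) * (d \<bullet> x)) =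
    sphere_average r (\<lambda>x. ((a+b+c+d) \<bullet> x)^4 + (((a+b-c-d) \<bullet> x)^4 + (((a-b+c-d) \<bullet> x)^4 + (((a-b-c+d) \<bullet> x)^4
      + (-1) * (((a+b+c-d) \<bullet> x)^4 + (((a+b-c+d) \<bullet> x)^4 + (((a-b+c+d) \<bullet> x)^4 + ((a-b-c-d) \<bullet> x)^4)))))))"
    unfolding sphere_average_cmult[OF r, symmetric] id inner_add_left inner_diff_left
    by (rule arg_cong[where f="sphere_average r"], rule ext) (simp add: algebra_simps)
  also have "\<dots> = 3 * \<kappa> * ((a+b+c+d) \<bullet> (a+b+c+d))\<^sup>2 + (3 * \<kappa> * ((a+b-c-d) \<bullet> (a+b-c-d))\<^sup>2
      + (3 * \<kappa> * ((a-b+c-d) \<bullet> (a-b+c-d))\<^sup>2 + (3 * \<kappa> * ((a-b-c+d) \<bullet> (a-b-c+d))\<^sup>2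
      + (-1) * (3 * \<kappa> * ((a+b+c-d) \<bullet> (a+b+c-d))\<^sup>2 + (3 * \<kappa> * ((a+b-c+d) \<bullet> (a+b-c+d))\<^sup>2
      + (3 * \<kappa> * ((a-b+c+d) \<bullet> (a-b+c+d))\<^sup>2 + 3 * \<kappa> * ((a-b-c-d) \<bullet> (a-b-c-d))\<^sup>2))))))"
    by (simp only: sphere_average_add[OF r] sphere_average_cmult[OF r] cont continuous_on_add
        continuous_on_mult_left p)
  also have "\<dots> = 192 * (\<kappa> * ((a \<bullet> b) * (c \<bullet> d) + (a \<bullet> c) * (b \<bullet> d) + (a \<bullet> d) * (b \<bullet> c)))"
  proof -
    have c: "b \<bullet> a = a \<bullet> b" "c \<bullet> a = a \<bullet> c" "d \<bullet> a = a \<bullet> d" "c \<bullet> b = b \<bullet> c" "d \<bullet> b = b \<bullet> d" "d \<bullet> c = c \<bullet> d"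
      by (simp_all add: inner_commute)
    show ?thesis unfolding inner_add_left inner_diff_left inner_add_right inner_diff_right c
      by algebra
  qed
  finally show ?thesis by (simp add: \<kappa>_def)
qed

section \<open>Polynomial functions and moments\<close>

abbreviation monomial :: "('n \<Rightarrow> nat) \<Rightarrow> real^'n \<Rightarrow> real" where
  "monomial \<alpha> x \<equiv> \<Prod>i\<in>UNIV. x $ i ^ \<alpha> i"

abbreviation exponents :: "nat \<Rightarrow> ('n::finite \<Rightarrow> nat) set" where
  "exponents t \<equiv> {\<alpha>. (\<Sum>i\<in>UNIV. \<alpha> i) \<le> t}"

lemma finite_exponents: "finite (exponents t :: ('n::finite \<Rightarrow> nat) set)"
proof (rule finite_subset)
  show "exponents t \<subseteq> (PiE (UNIV :: 'n set) (\<lambda>_. {..t}))"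
  proof
    fix \<alpha> :: "'n \<Rightarrow> nat" assume "\<alpha> \<in> exponents t"
    then have "\<alpha> i \<le> t" for i using member_le_sum[of i UNIV \<alpha>] by simp
    then show "\<alpha> \<in> PiE UNIV (\<lambda>_. {..t})" by (simp add: PiE_iff)
  qed
qed (auto intro: finite_PiE)

lemma sum_fun_apply: "(\<Sum>i\<in>I. f i) x = (\<Sum>i\<in>I. f i x :: 'b::comm_monoid_add)"
  by (induction I rule: infinite_finite_induct) auto

text \<open>Makes closure under linear combinations and induction over monomials available.\<close>

lemma poly_funs_eq_span:
  "poly_funs t = fun_space.span (monomial ` (exponents t :: ('n::finite \<Rightarrow> nat) set))"
proof (intro equalityI subsetI)
  fix f :: "real^'n \<Rightarrow> real" assume "f \<in> poly_funs t"
  then obtain c where "\<And>x. f x = (\<Sum>\<alpha>\<in>exponents t. c \<alpha> * monomial \<alpha> x)" by (auto simp: poly_funs_def)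
  then have "f = (\<Sum>\<alpha>\<in>exponents t. (\<lambda>x. c \<alpha> * monomial \<alpha> x))"
    by (simp add: fun_eq_iff sum_fun_apply)
  then show "f \<in> fun_space.span (monomial ` exponents t)"
    by (auto intro!: fun_space.span_sum fun_space.span_scale[OF fun_space.span_base])
next
  fix f :: "real^'n \<Rightarrow> real" assume "f \<in> fun_space.span (monomial ` exponents t)"
  moreover have "fun_space.span (monomial ` exponents t) \<subseteq> (poly_funs t :: (real^'n \<Rightarrow> real) set)"
  proof (rule fun_space.span_minimal)
    show "monomial ` exponents t \<subseteq> (poly_funs t :: (real^'n \<Rightarrow> real) set)"
    proof (clarify, unfold poly_funs_def mem_Collect_eq)
      fix \<beta> :: "'n \<Rightarrow> nat" assume \<beta>: "sum \<beta> UNIV \<le> t"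
      show "\<exists>c. \<forall>x. monomial \<beta> x = (\<Sum>\<alpha>\<in>exponents t. c \<alpha> * monomial \<alpha> x)"
      proof (intro exI[of _ "\<lambda>\<alpha>. if \<alpha> = \<beta> then 1 else 0"] allI)
        fix x :: "real^'n"
        have "(\<Sum>\<alpha>\<in>exponents t. (if \<alpha> = \<beta> then 1 else 0) * monomial \<alpha> x)
          = (\<Sum>\<alpha>\<in>exponents t. if \<alpha> = \<beta> then monomial \<alpha> x else 0)"
          by (intro sum.cong) auto
        then show "monomial \<beta> x = (\<Sum>\<alpha>\<in>exponents t. (if \<alpha> = \<beta> then 1 else 0) * monomial \<alpha> x)"
          using \<beta> by (simp add: sum.delta finite_exponents)
      qed
    qed
    show "fun_space.subspace (poly_funs t :: (real^'n \<Rightarrow> real) set)"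
      unfolding fun_space.subspace_def poly_funs_def mem_Collect_eq
    proof (intro conjI ballI allI)
      show "\<exists>c. \<forall>x. (0 :: real^'n \<Rightarrow> real) x = (\<Sum>\<alpha>\<in>exponents t. c \<alpha> * monomial \<alpha> x)"
        by (intro exI[of _ "\<lambda>_. 0"]) simp
    next
      fix f g :: "real^'n \<Rightarrow> real"
      assume "f \<in> {f. \<exists>c. \<forall>x. f x = (\<Sum>\<alpha>\<in>exponents t. c \<alpha> * monomial \<alpha> x)}"
        "g \<in> {f. \<exists>c. \<forall>x. f x = (\<Sum>\<alpha>\<in>exponents t. c \<alpha> * monomial \<alpha> x)}"
      then obtain c d where "\<And>x. f x = (\<Sum>\<alpha>\<in>exponents t. c \<alpha> * monomial \<alpha> x)"
        "\<And>x. g x = (\<Sum>\<alpha>\<in>exponents t. d \<alpha> * monomial \<alpha> x)" by auto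
      then show "\<exists>c. \<forall>x. (f + g) x = (\<Sum>\<alpha>\<in>exponents t. c \<alpha> * monomial \<alpha> x)"
        by (intro exI[of _ "\<lambda>\<alpha>. c \<alpha> + d \<alpha>"]) (simp add: sum.distrib algebra_simps)
    next
      fix a :: real and f :: "real^'n \<Rightarrow> real"
      assume "f \<in> {f. \<exists>c. \<forall>x. f x = (\<Sum>\<alpha>\<in>exponents t. c \<alpha> * monomial \<alpha> x)}"
      then obtain c where "\<And>x. f x = (\<Sum>\<alpha>\<in>exponents t. c \<alpha> * monomial \<alpha> x)" by auto
      then show "\<exists>c. \<forall>x. a * f x = (\<Sum>\<alpha>\<in>exponents t. c \<alpha> * monomial \<alpha> x)"
        by (intro exI[of _ "\<lambda>\<alpha>. a * c \<alpha>"]) (simp add: sum_distrib_left algebra_simps)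
    qed
  qed
  ultimately show "f \<in> poly_funs t" by blast
qed

lemma continuous_on_monomial: "continuous_on UNIV (monomial \<alpha>)"
  by (intro continuous_intros)

lemma poly_funs_induct [consumes 1, case_names zero add monomial]:
  fixes f :: "real^'n \<Rightarrow> real"
  assumes "f \<in> poly_funs t" and "P (\<lambda>x. 0)"
    and "\<And>c f g. P f \<Longrightarrow> P g \<Longrightarrow> P (\<lambda>x. c * f x + g x)"
    and "\<And>\<alpha>. \<alpha> \<in> exponents t \<Longrightarrow> P (monomial \<alpha>)"
  shows "P f"
proof -
  have "f \<in> fun_space.span (monomial ` exponents t)" using assms(1) by (simp add: poly_funs_eq_span)
  then show ?thesis
  proof (induction rule: fun_space.span_induct_alt)
    case base
    then show ?case using assms(2) by (simp add: zero_fun_def)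
  next
    case (step c f g)
    then show ?case using assms(3)[of f g c] assms(4) by (auto simp: plus_fun_def)
  qed
qed

text \<open>Each coordinate is a linear form \<open>axis i 1 \<bullet> x\<close>, so this is how
  identities for products of linear forms reach all polynomials.\<close>

lemma monomial_eq_prod_list:
  fixes \<alpha> :: "'n::finite \<Rightarrow> nat"
  assumes "(\<Sum>i\<in>UNIV. \<alpha> i) = d"
  shows "\<exists>is. length is = d \<and> monomial \<alpha> = (\<lambda>x. prod_list (map (\<lambda>i. x $ i) is))"
  using assms
proof (induction d arbitrary: \<alpha>)
  case 0
  then show ?case by (auto simp: fun_eq_iff)
next
  case (Suc d)
  then obtain i where i: "\<alpha> i > 0" by (metis neq0_conv sum.neutral nat.distinct(1))
  let ?\<beta> = "\<alpha>(i := \<alpha> i - 1)"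
  have "(\<Sum>j\<in>UNIV. \<alpha> j) = \<alpha> i + (\<Sum>j\<in>UNIV - {i}. \<alpha> j)" by (simp add: sum.remove)
  moreover have "(\<Sum>j\<in>UNIV. ?\<beta> j) = \<alpha> i - 1 + (\<Sum>j\<in>UNIV - {i}. \<alpha> j)"
    by (simp add: sum.remove[of UNIV i])
  ultimately have "(\<Sum>j\<in>UNIV. ?\<beta> j) = d" using Suc.prems i by linarith
  then obtain js where js: "length js = d" "monomial ?\<beta> = (\<lambda>x. prod_list (map (\<lambda>i. x $ i) js))"
    using Suc.IH by blast
  have "monomial \<alpha> x = x $ i * monomial ?\<beta> x" for x
  proof -
    have "monomial \<alpha> x = x $ i ^ \<alpha> i * (\<Prod>j\<in>UNIV - {i}. x $ j ^ \<alpha> j)" by (simp add: prod.remove)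
    moreover have "monomial ?\<beta> x = x $ i ^ (\<alpha> i - 1) * (\<Prod>j\<in>UNIV - {i}. x $ j ^ \<alpha> j)"
      by (simp add: prod.remove[of UNIV i])
    ultimately show ?thesis using i by (cases "\<alpha> i") auto
  qed
  moreover have "monomial ?\<beta> x = prod_list (map (\<lambda>i. x $ i) js)" for x using fun_cong[OF js(2)] .
  ultimately show ?case using js(1) by (intro exI[of _ "i # js"]) (auto simp: fun_eq_iff)
qed

lemma poly_funs_coord_mult:
  fixes f :: "real^'n \<Rightarrow> real"
  assumes "f \<in> poly_funs t"
  shows "(\<lambda>x. x $ i * f x) \<in> poly_funs (Suc t)"
  using assms
proof (induction rule: poly_funs_induct)
  case zero
  then show ?case using fun_space.span_zero by (simp add: poly_funs_eq_span zero_fun_def)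
next
  case (add c f g)
  then have "(\<lambda>x. c * (x $ i * f x)) + (\<lambda>x. x $ i * g x) \<in> poly_funs (Suc t)"
    unfolding poly_funs_eq_span by (intro fun_space.span_add fun_space.span_scale)
  then show ?case by (simp add: plus_fun_def algebra_simps)
next
  case (monomial \<alpha>)
  let ?\<beta> = "\<alpha>(i := Suc (\<alpha> i))"
  have "(\<Sum>j\<in>UNIV. ?\<beta> j) = Suc (\<Sum>j\<in>UNIV. \<alpha> j)"
    by (simp add: sum.remove[of UNIV i])
  moreover have "(\<lambda>x. x $ i * monomial \<alpha> x) = monomial ?\<beta>"
    by (rule ext) (simp add: prod.remove[of UNIV i])
  ultimately show ?case using monomial unfolding poly_funs_eq_span
    by (intro fun_space.span_base image_eqI[of _ _ ?\<beta>]) auto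
qed

lemma poly_funs_inner_mult:
  fixes f :: "real^'n \<Rightarrow> real"
  assumes "f \<in> poly_funs t"
  shows "(\<lambda>x. (a \<bullet> x) * f x) \<in> poly_funs (Suc t)"
proof -
  have "(\<Sum>i\<in>UNIV. (\<lambda>x. a $ i * (x $ i * f x))) \<in> poly_funs (Suc t)"
    using poly_funs_coord_mult[OF assms] unfolding poly_funs_eq_span
    by (intro fun_space.span_sum fun_space.span_scale)
  moreover have "(\<lambda>x. (a \<bullet> x) * f x) = (\<Sum>i\<in>UNIV. (\<lambda>x. a $ i * (x $ i * f x)))"
    by (simp add: fun_eq_iff sum_fun_apply inner_vec_def sum_distrib_right mult.assoc)
  ultimately show ?thesis by simp
qed

lemma poly_funs_mono: "s \<le> t \<Longrightarrow> poly_funs s \<subseteq> poly_funs t"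
  unfolding poly_funs_eq_span by (intro fun_space.span_mono image_mono) auto

lemma poly_funs_one: "(\<lambda>x. 1) \<in> poly_funs t"
  unfolding poly_funs_eq_span by (intro fun_space.span_base image_eqI[of _ _ "\<lambda>_. 0"]) auto

lemma poly_funs_prod_inner:
  assumes "length as \<le> t"
  shows "(\<lambda>x. prod_list (map (\<lambda>a. a \<bullet> x) as)) \<in> poly_funs t"
proof -
  have "(\<lambda>x. prod_list (map (\<lambda>a. a \<bullet> x) as)) \<in> poly_funs (length as)"
    by (induction as) (auto intro: poly_funs_one poly_funs_inner_mult)
  then show ?thesis using poly_funs_mono[OF assms] by blast
qed

text \<open>The design condition tested on products of one to four linear forms, with the sphere
  averages evaluated. Degree 0 is left out because both sides are then the total weight. Arbitrary
  vectors in place of coordinates permit contraction with a basis and transport along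
  isometries.\<close>

definition design_moments ::
    "(real^'n) set \<Rightarrow> real \<Rightarrow> real \<Rightarrow> (real^'n) set \<Rightarrow> real \<Rightarrow> real \<Rightarrow> bool" where
  "design_moments X1 r1 w1 X2 r2 w2 \<longleftrightarrow>
     (\<forall>a. w1 * (\<Sum>x\<in>X1. a \<bullet> x) + w2 * (\<Sum>x\<in>X2. a \<bullet> x) = 0) \<and>
     (\<forall>a b. w1 * (\<Sum>x\<in>X1. (a \<bullet> x) * (b \<bullet> x)) + w2 * (\<Sum>x\<in>X2. (a \<bullet> x) * (b \<bullet> x))
        = (w1 * card X1 * r1\<^sup>2 + w2 * card X2 * r2\<^sup>2) / CARD('n) * (a \<bullet> b)) \<and>
     (\<forall>a b c. w1 * (\<Sum>x\<in>X1. (a \<bullet> x) * (b \<bullet> x) * (c \<bullet> x))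
        + w2 * (\<Sum>x\<in>X2. (a \<bullet> x) * (b \<bullet> x) * (c \<bullet> x)) = 0) \<and>
     (\<forall>a b c d. w1 * (\<Sum>x\<in>X1. (a \<bullet> x) * (b \<bullet> x) * (c \<bullet> x) * (d \<bullet> x))
        + w2 * (\<Sum>x\<in>X2. (a \<bullet> x) * (b \<bullet> x) * (c \<bullet> x) * (d \<bullet> x))
        = (w1 * card X1 * r1 ^ 4 + w2 * card X2 * r2 ^ 4) / (CARD('n) * (CARD('n) + 2)) *
          ((a \<bullet> b) * (c \<bullet> d) + (a \<bullet> c) * (b \<bullet> d) + (a \<bullet> d) * (b \<bullet> c)))"

text \<open>Both sides of the design condition are linear in the polynomial, and products of at most
  four linear forms span the polynomials of degree at most 4. One direction extracts moments from
  the given design, the other verifies the designs of the classification.\<close>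

lemma euclidean_design_4_iff:
  fixes X1 X2 :: "(real^'n) set"
  assumes fin: "finite X1" "finite X2" and ne: "X1 \<noteq> {}" "X2 \<noteq> {}"
    and sph: "X1 \<subseteq> sphere 0 r1" "X2 \<subseteq> sphere 0 r2"
    and r: "r1 > 0" "r2 > 0" "r1 \<noteq> r2" and wpos: "w1 > 0" "w2 > 0"
    and w: "\<And>x. x \<in> X1 \<Longrightarrow> w x = w1" "\<And>x. x \<in> X2 \<Longrightarrow> w x = w2"
  shows "euclidean_design 4 (X1 \<union> X2) w \<longleftrightarrow> design_moments X1 r1 w1 X2 r2 w2"
proof -
  define L where "L f = w1 * card X1 * sphere_average r1 f + w2 * card X2 * sphere_average r2 f"
    for f :: "real^'n \<Rightarrow> real"
  define R where "R f = w1 * (\<Sum>x\<in>X1. f x) + w2 * (\<Sum>x\<in>X2. f x)" for f :: "real^'n \<Rightarrow> real"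
  have nrm: "norm ` (X1 \<union> X2) = {r1, r2}"
  proof -
    have "norm ` X1 = {r1}" "norm ` X2 = {r2}" using ne sph by force+
    then show ?thesis by (simp add: image_Un insert_commute)
  qed
  have lay: "{x \<in> X1 \<union> X2. norm x = r1} = X1" "{x \<in> X1 \<union> X2. norm x = r2} = X2"
    using sph r by auto
  have disj: "X1 \<inter> X2 = {}"
    using sph r(3) by (metis disjoint_iff mem_sphere_0 subsetD)
  have ws: "weighted_set (X1 \<union> X2) w" using fin wpos w by (auto simp: weighted_set_def)
  have L1: "(\<Sum>r\<in>norm ` (X1 \<union> X2). (\<Sum>x | x \<in> X1 \<union> X2 \<and> norm x = r. w x) * sphere_average r f) = L f" for f
    using w r(3) unfolding nrm by (simp add: L_def lay[simplified] algebra_simps)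
  have R1: "(\<Sum>x\<in>X1 \<union> X2. w x * f x) = R f" for f
    using w by (simp add: R_def sum.union_disjoint[OF fin disj] sum_distrib_left)
  have ed: "euclidean_design 4 (X1 \<union> X2) w \<longleftrightarrow> (\<forall>f\<in>poly_funs 4. L f = R f)"
    unfolding euclidean_design_def using ws L1 R1 by simp
  have L0: "L (\<lambda>x. 1) = R (\<lambda>x. 1)"
    by (simp add: L_def R_def sphere_average_const[OF r(1)] sphere_average_const[OF r(2)])
  have P1: "L (\<lambda>x. a \<bullet> x) = 0" for a
    by (simp add: L_def sphere_average_inner r)
  have P2: "L (\<lambda>x. (a \<bullet> x) * (b \<bullet> x)) = (w1 * card X1 * r1\<^sup>2 + w2 * card X2 * r2\<^sup>2) / CARD('n) * (a \<bullet> b)" for a b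
    by (simp add: L_def sphere_average_inner2 r add_divide_distrib algebra_simps)
  have P3: "L (\<lambda>x. (a \<bullet> x) * (b \<bullet> x) * (c \<bullet> x)) = 0" for a b c
    by (simp add: L_def sphere_average_inner3 r)
  have P4: "L (\<lambda>x. (a \<bullet> x) * (b \<bullet> x) * (c \<bullet> x) * (d \<bullet> x)) =
      (w1 * card X1 * r1 ^ 4 + w2 * card X2 * r2 ^ 4) / (CARD('n) * (CARD('n) + 2)) *
          ((a \<bullet> b) * (c \<bullet> d) + (a \<bullet> c) * (b \<bullet> d) + (a \<bullet> d) * (b \<bullet> c))" for a b c d
  proof -
    have "A * (p / m * E) + B * (q / m * E) = (A * p + B * q) / m * E" for A p m E B q :: real
      by (simp add: add_divide_distrib distrib_right)
    then show ?thesis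
      unfolding L_def sphere_average_inner4[OF r(1)] sphere_average_inner4[OF r(2)]
        of_nat_mult of_nat_add of_nat_numeral .
  qed
  have dm: "design_moments X1 r1 w1 X2 r2 w2 \<longleftrightarrow>
     (\<forall>a. L (\<lambda>x. a \<bullet> x) = R (\<lambda>x. a \<bullet> x)) \<and>
     (\<forall>a b. L (\<lambda>x. (a \<bullet> x) * (b \<bullet> x)) = R (\<lambda>x. (a \<bullet> x) * (b \<bullet> x))) \<and>
     (\<forall>a b c. L (\<lambda>x. (a \<bullet> x) * (b \<bullet> x) * (c \<bullet> x)) = R (\<lambda>x. (a \<bullet> x) * (b \<bullet> x) * (c \<bullet> x))) \<and>
     (\<forall>a b c d. L (\<lambda>x. (a \<bullet> x) * (b \<bullet> x) * (c \<bullet> x) * (d \<bullet> x)) =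
        R (\<lambda>x. (a \<bullet> x) * (b \<bullet> x) * (c \<bullet> x) * (d \<bullet> x)))"
    unfolding P1 P2 P3 P4 unfolding R_def design_moments_def
    by (intro arg_cong2[where f="(\<and>)"] iff_allI eq_commute)
  show ?thesis
  proof
    assume "euclidean_design 4 (X1 \<union> X2) w"
    then have *: "L f = R f" if "f \<in> poly_funs 4" for f using ed that by blast
    show "design_moments X1 r1 w1 X2 r2 w2" unfolding dm
    proof (intro conjI allI)
      fix a b c d :: "real^'n"
      show "L (\<lambda>x. a \<bullet> x) = R (\<lambda>x. a \<bullet> x)"
        using *[OF poly_funs_prod_inner[of "[a]"]] by simp
      show "L (\<lambda>x. (a \<bullet> x) * (b \<bullet> x)) = R (\<lambda>x. (a \<bullet> x) * (b \<bullet> x))"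
        using *[OF poly_funs_prod_inner[of "[a,b]"]] by simp
      show "L (\<lambda>x. (a \<bullet> x) * (b \<bullet> x) * (c \<bullet> x)) = R (\<lambda>x. (a \<bullet> x) * (b \<bullet> x) * (c \<bullet> x))"
        using *[OF poly_funs_prod_inner[of "[a,b,c]"]] by (simp add: mult.assoc)
      show "L (\<lambda>x. (a \<bullet> x) * (b \<bullet> x) * (c \<bullet> x) * (d \<bullet> x)) =
        R (\<lambda>x. (a \<bullet> x) * (b \<bullet> x) * (c \<bullet> x) * (d \<bullet> x))"
        using *[OF poly_funs_prod_inner[of "[a,b,c,d]"]] by (simp add: mult.assoc)
    qed
  next
    assume "design_moments X1 r1 w1 X2 r2 w2"
    note dm' = this[unfolded dm]
    have mono: "L (monomial \<alpha>) = R (monomial \<alpha>)" if \<alpha>: "\<alpha> \<in> exponents 4" for \<alpha>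
    proof -
      obtain d js where js: "d \<le> 4" "length js = d" "monomial \<alpha> = (\<lambda>x. prod_list (map (\<lambda>i. x $ i) js))"
        using monomial_eq_prod_list[OF refl, of \<alpha>] \<alpha> by auto
      have ax: "x $ i = axis i 1 \<bullet> x" for x :: "real^'n" and i by (simp add: inner_axis')
      have len: "P xs" if "length xs \<le> 4" "P []" "\<And>a. P [a]" "\<And>a b. P [a, b]" "\<And>a b c. P [a, b, c]" "\<And>a b c d. P [a, b, c, d]"
        for P :: "'n list \<Rightarrow> bool" and xs
      proof -
        have "length xs = 0 \<or> length xs = Suc 0 \<or> length xs = Suc (Suc 0) \<or> length xs = Suc (Suc (Suc 0))
          \<or> length xs = Suc (Suc (Suc (Suc 0)))" using that(1) by linarith
        then show ?thesis using that(2-) by (auto simp: length_Suc_conv)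
      qed
      show ?thesis unfolding js(3)
      proof (rule len[of js])
        show "length js \<le> 4" using js by simp
      qed (use L0 dm' in \<open>simp_all add: ax mult.assoc[symmetric] del: inner_axis'\<close>)
    qed
    \<comment> \<open>Continuity is carried through the induction because additivity of the sphere
      average asks for it.\<close>
    have "continuous_on UNIV f \<and> L f = R f" if "f \<in> poly_funs 4" for f
      using that
    proof (induction rule: poly_funs_induct)
      case zero
      then show ?case by (simp add: L_def R_def sphere_average_const r)
    next
      case (add c f g)
      have "sphere_average s (\<lambda>x. c * f x + g x) = c * sphere_average s f + sphere_average s g" if "s > 0" for s
        using that add by (simp add: sphere_average_add sphere_average_cmult continuous_intros)
      then have "L (\<lambda>x. c * f x + g x) = c * L f + L g" using r by (simp add: L_def algebra_simps)
      moreover have "R (\<lambda>x. c * f x + g x) = c * R f + R g"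
        by (simp add: R_def sum.distrib sum_distrib_left algebra_simps)
      ultimately show ?case using add by (auto intro!: continuous_intros)
    next
      case (monomial \<alpha>)
      then show ?case using mono continuous_on_monomial by blast
    qed
    then show "euclidean_design 4 (X1 \<union> X2) w" using ed by blast
  qed
qed

section \<open>The kernel of degree two\<close>

abbreviation Q2 :: "real^'n \<Rightarrow> real^'n \<Rightarrow> real" where
  "Q2 x y \<equiv> (x \<bullet> y)\<^sup>2 - 1 / real CARD('n)"

lemma sum_axis_sq:
  fixes z :: "real^'n"
  shows "(\<Sum>i\<in>UNIV. (axis i 1 \<bullet> z) * (axis i 1 \<bullet> z)) = z \<bullet> z"
  by (simp only: inner_axis') (simp add: inner_vec_def)

lemma sum_axis_mult:
  fixes a b :: "real^'n"
  shows "(\<Sum>i\<in>UNIV. (axis i 1 \<bullet> a) * (axis i 1 \<bullet> b)) = a \<bullet> b"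
  by (simp only: inner_axis') (simp add: inner_vec_def)

text \<open>The layers are normalised to the unit sphere; for layers of radii \<open>r\<^sub>i\<close> and weights \<open>w\<^sub>i\<close> the
  constants are \<open>c\<^sub>i = w\<^sub>i r\<^sub>i\<^sup>3\<close> and \<open>d\<^sub>i = w\<^sub>i r\<^sub>i\<^sup>4\<close>.\<close>

locale unit_design_pair =
  fixes U V :: "(real^'n) set" and c1 c2 d1 d2 :: real
  assumes fin: "finite U" "finite V" and ne: "U \<noteq> {}" "V \<noteq> {}"
    and unit: "\<And>x. x \<in> U \<Longrightarrow> x \<bullet> x = 1" "\<And>x. x \<in> V \<Longrightarrow> x \<bullet> x = 1"
    and pos: "c1 > 0" "c2 > 0" "d1 > 0" "d2 > 0"
    and U1: "\<And>a. (\<Sum>z\<in>U. a \<bullet> z) = 0" and V1: "\<And>a. (\<Sum>z\<in>V. a \<bullet> z) = 0"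
    and U2: "\<And>a b. (\<Sum>z\<in>U. (a \<bullet> z) * (b \<bullet> z)) = card U / CARD('n) * (a \<bullet> b)"
    and V2: "\<And>a b. (\<Sum>z\<in>V. (a \<bullet> z) * (b \<bullet> z)) = card V / CARD('n) * (a \<bullet> b)"
    and M3: "\<And>a b c. c1 * (\<Sum>z\<in>U. (a \<bullet> z) * (b \<bullet> z) * (c \<bullet> z))
        + c2 * (\<Sum>z\<in>V. (a \<bullet> z) * (b \<bullet> z) * (c \<bullet> z)) = 0"
    and M4: "\<And>a b c d. d1 * (\<Sum>z\<in>U. (a \<bullet> z) * (b \<bullet> z) * (c \<bullet> z) * (d \<bullet> z))
        + d2 * (\<Sum>z\<in>V. (a \<bullet> z) * (b \<bullet> z) * (c \<bullet> z) * (d \<bullet> z))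
        = (d1 * card U + d2 * card V) / (CARD('n) * (CARD('n) + 2)) *
          ((a \<bullet> b) * (c \<bullet> d) + (a \<bullet> c) * (b \<bullet> d) + (a \<bullet> d) * (b \<bullet> c))"
    and n2: "CARD('n) \<ge> 2"

text \<open>By this symmetry facts proved for the first layer become available for the
  second.\<close>

lemma unit_design_pair_swap:
  assumes "unit_design_pair U V c1 c2 d1 d2"
  shows "unit_design_pair V U c2 c1 d2 d1"
proof -
  interpret unit_design_pair U V c1 c2 d1 d2 by fact
  show ?thesis
    by unfold_locales
      (use fin ne unit pos U1 V1 U2 V2 M3 M4 n2 in \<open>simp_all add: add.commute\<close>)
qed

text \<open>Contracting two arguments of the degree 3 and 4 identities with an orthonormal basis
  inserts \<open>z \<bullet> z = 1\<close>. This leaves the degree 1 and 2 identities with weights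
  multiplied by the squared radii. As the radii differ, each layer must satisfy these identities
  alone.\<close>

lemma design_moments_imp_unit_design_pair:
  fixes U V :: "(real^'n) set"
  assumes dm: "design_moments ((*\<^sub>R) r1 ` U) r1 w1 ((*\<^sub>R) r2 ` V) r2 w2"
    and r: "r1 > 0" "r2 > 0" "r1 \<noteq> r2" and w: "w1 > 0" "w2 > 0"
    and fin: "finite U" "finite V" and ne: "U \<noteq> {}" "V \<noteq> {}"
    and unit: "\<And>x. x \<in> U \<Longrightarrow> x \<bullet> x = 1" "\<And>x. x \<in> V \<Longrightarrow> x \<bullet> x = 1"
    and n2: "CARD('n) \<ge> 2"
  shows "unit_design_pair U V (w1 * r1 ^ 3) (w2 * r2 ^ 3) (w1 * r1 ^ 4) (w2 * r2 ^ 4)"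
proof -
  have inj: "inj_on ((*\<^sub>R) s) (Z :: (real^'n) set)" if "s > 0" for s Z
    using that by (auto simp: inj_on_def)
  note re = sum.reindex[OF inj[OF r(1), of U], unfolded o_def] sum.reindex[OF inj[OF r(2), of V], unfolded o_def]
  have card_eq: "card ((*\<^sub>R) r1 ` U) = card U" "card ((*\<^sub>R) r2 ` V) = card V"
    using inj r by (auto intro: card_image)
  let ?n = "real CARD('n)"
  note dm' = dm[unfolded design_moments_def re card_eq]
  have A1: "(w1 * r1) * (\<Sum>z\<in>U. a \<bullet> z) + (w2 * r2) * (\<Sum>z\<in>V. a \<bullet> z) = 0" for a
    using dm'[THEN conjunct1, rule_format, of a] by (simp add: sum_distrib_left mult_ac)
  have A2: "(w1 * r1\<^sup>2) * (\<Sum>z\<in>U. (a \<bullet> z) * (b \<bullet> z)) + (w2 * r2\<^sup>2) * (\<Sum>z\<in>V. (a \<bullet> z) * (b \<bullet> z))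
     = (w1 * card U * r1\<^sup>2 + w2 * card V * r2\<^sup>2) / ?n * (a \<bullet> b)" for a b
    using dm'[THEN conjunct2, THEN conjunct1, rule_format, of a b]
    by (simp add: sum_distrib_left power2_eq_square mult_ac)
  have A3: "(w1 * r1 ^ 3) * (\<Sum>z\<in>U. (a \<bullet> z) * (b \<bullet> z) * (c \<bullet> z))
      + (w2 * r2 ^ 3) * (\<Sum>z\<in>V. (a \<bullet> z) * (b \<bullet> z) * (c \<bullet> z)) = 0" for a b c
    using dm'[THEN conjunct2, THEN conjunct2, THEN conjunct1, rule_format, of a b c]
    by (simp add: sum_distrib_left power3_eq_cube mult_ac)
  have A4: "(w1 * r1 ^ 4) * (\<Sum>z\<in>U. (a \<bullet> z) * (b \<bullet> z) * (c \<bullet> z) * (d \<bullet> z))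
      + (w2 * r2 ^ 4) * (\<Sum>z\<in>V. (a \<bullet> z) * (b \<bullet> z) * (c \<bullet> z) * (d \<bullet> z))
      = (w1 * r1 ^ 4 * card U + w2 * r2 ^ 4 * card V) / (?n * (?n + 2)) *
          ((a \<bullet> b) * (c \<bullet> d) + (a \<bullet> c) * (b \<bullet> d) + (a \<bullet> d) * (b \<bullet> c))" for a b c d
  proof -
    have l: "w * s ^ 4 * (\<Sum>z\<in>Z. (a \<bullet> z) * (b \<bullet> z) * (c \<bullet> z) * (d \<bullet> z))
      = w * (\<Sum>z\<in>Z. (a \<bullet> (s *\<^sub>R z)) * (b \<bullet> (s *\<^sub>R z)) * (c \<bullet> (s *\<^sub>R z)) * (d \<bullet> (s *\<^sub>R z)))"
      for w s and Z :: "(real^'n) set"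
      by (simp add: sum_distrib_left power4_eq_xxxx mult_ac)
    have "w1 * r1 ^ 4 * card U = w1 * card U * r1 ^ 4" "w2 * r2 ^ 4 * card V = w2 * card V * r2 ^ 4"
      by simp_all
    then show ?thesis
      using dm'[THEN conjunct2, THEN conjunct2, THEN conjunct2, rule_format, of a b c d]
      unfolding l of_nat_add of_nat_mult of_nat_numeral by simp
  qed
  have swap: "(\<Sum>i\<in>UNIV. w * (\<Sum>z\<in>Z. (axis i 1 \<bullet> z) * (axis i 1 \<bullet> z) * f z)) = w * (\<Sum>z\<in>Z. f z)"
    if "\<And>x. x \<in> Z \<Longrightarrow> x \<bullet> x = 1" for Z :: "(real^'n) set" and f w
  proof -
    have "(\<Sum>i\<in>UNIV. w * (\<Sum>z\<in>Z. (axis i 1 \<bullet> z) * (axis i 1 \<bullet> z) * f z))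
        = w * (\<Sum>z\<in>Z. (\<Sum>i\<in>UNIV. (axis i 1 \<bullet> z) * (axis i 1 \<bullet> z)) * f z)"
      by (simp only: sum_distrib_left[symmetric] sum_distrib_right, subst sum.swap, rule refl)
    also have "\<dots> = w * (\<Sum>z\<in>Z. f z)"
      using that by (simp only: sum_axis_sq) simp
    finally show ?thesis .
  qed
  have A3': "(w1 * r1 ^ 3) * (\<Sum>z\<in>U. a \<bullet> z) + (w2 * r2 ^ 3) * (\<Sum>z\<in>V. a \<bullet> z) = 0" for a
  proof -
    have "(\<Sum>i\<in>UNIV. (w1 * r1 ^ 3) * (\<Sum>z\<in>U. (axis i 1 \<bullet> z) * (axis i 1 \<bullet> z) * (a \<bullet> z))
      + (w2 * r2 ^ 3) * (\<Sum>z\<in>V. (axis i 1 \<bullet> z) * (axis i 1 \<bullet> z) * (a \<bullet> z))) = 0"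
      by (simp only: A3 sum.neutral_const)
    then show ?thesis by (simp only: sum.distrib swap[OF unit(1)] swap[OF unit(2)])
  qed
  have A4': "(w1 * r1 ^ 4) * (\<Sum>z\<in>U. (a \<bullet> z) * (b \<bullet> z)) + (w2 * r2 ^ 4) * (\<Sum>z\<in>V. (a \<bullet> z) * (b \<bullet> z))
     = (w1 * r1 ^ 4 * card U + w2 * r2 ^ 4 * card V) / ?n * (a \<bullet> b)" for a b
  proof -
    let ?D = "w1 * r1 ^ 4 * card U + w2 * r2 ^ 4 * card V"
    \<comment> \<open>Under the contraction the three pairings give \<open>a \<bullet> b\<close>
      with factors \<open>n\<close>, \<open>1\<close> and \<open>1\<close>; the total
      \<open>n + 2\<close> cancels against the denominator.\<close>
    have "(\<Sum>i\<in>UNIV. (w1 * r1 ^ 4) * (\<Sum>z\<in>U. (axis i 1 \<bullet> z) * (axis i 1 \<bullet> z) * (a \<bullet> z) * (b \<bullet> z))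
      + (w2 * r2 ^ 4) * (\<Sum>z\<in>V. (axis i 1 \<bullet> z) * (axis i 1 \<bullet> z) * (a \<bullet> z) * (b \<bullet> z)))
      = (\<Sum>i\<in>(UNIV::'n set). ?D / (?n * (?n + 2)) * (a \<bullet> b + 2 * ((axis i 1 \<bullet> a) * (axis i 1 \<bullet> b))))"
      by (intro sum.cong refl) (simp only: A4, simp add: inner_axis inner_axis' inner_axis_axis)
    also have "\<dots> = ?D / (?n * (?n + 2)) * (?n * (a \<bullet> b) + 2 * (a \<bullet> b))"
      by (simp only: sum_distrib_left[symmetric] sum.distrib sum_axis_mult) simp
    also have "\<dots> = ?D / ?n * (a \<bullet> b)"
    proof -
      have "D / (m * (m + 2)) * (m * t + 2 * t) = D / m * t" if "m > 0" for D m t :: real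
      proof -
        have "m * t + 2 * t = (m + 2) * t" by algebra
        then show ?thesis using that by simp
      qed
      then show ?thesis by simp
    qed
    finally show ?thesis
      by (simp only: sum.distrib mult.assoc[of "_ * _" _ "_ \<bullet> _"] swap[OF unit(1)] swap[OF unit(2)])
  qed
  \<comment> \<open>Two linear equations in \<open>p * A\<close> and \<open>q * B\<close>, with
    determinant \<open>r2\<^sup>2 - r1\<^sup>2\<close>.\<close>
  have sep: "A = 0 \<and> B = 0" if "p * A + q * B = 0" "p * r1\<^sup>2 * A + q * r2\<^sup>2 * B = 0" "p > 0" "q > 0" for p q A B :: real
  proof -
    have "r1\<^sup>2 \<noteq> r2\<^sup>2" using r by (simp add: power2_eq_iff)
    moreover have "p * A * (r1\<^sup>2 - r2\<^sup>2) = 0"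
      using that(1,2) by algebra
    ultimately have "A = 0" using that by simp
    then show ?thesis using that by simp
  qed
  have 1: "(\<Sum>z\<in>U. a \<bullet> z) = 0 \<and> (\<Sum>z\<in>V. a \<bullet> z) = 0" for a
    using A1[of a] A3'[of a] r w
    by (intro sep[of "w1 * r1" _ "w2 * r2"]) (auto simp: power2_eq_square power3_eq_cube mult_ac)
  have 2: "(\<Sum>z\<in>U. (a \<bullet> z) * (b \<bullet> z)) - card U / ?n * (a \<bullet> b) = 0 \<and> (\<Sum>z\<in>V. (a \<bullet> z) * (b \<bullet> z)) - card V / ?n * (a \<bullet> b) = 0" for a b
  proof (rule sep[of "w1 * r1\<^sup>2" _ "w2 * r2\<^sup>2"])
    show "w1 * r1\<^sup>2 * ((\<Sum>z\<in>U. (a \<bullet> z) * (b \<bullet> z)) - card U / ?n * (a \<bullet> b))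
      + w2 * r2\<^sup>2 * ((\<Sum>z\<in>V. (a \<bullet> z) * (b \<bullet> z)) - card V / ?n * (a \<bullet> b)) = 0"
      using A2[of a b] by (simp add: add_divide_distrib algebra_simps)
    show "w1 * r1\<^sup>2 * r1\<^sup>2 * ((\<Sum>z\<in>U. (a \<bullet> z) * (b \<bullet> z)) - card U / ?n * (a \<bullet> b))
      + w2 * r2\<^sup>2 * r2\<^sup>2 * ((\<Sum>z\<in>V. (a \<bullet> z) * (b \<bullet> z)) - card V / ?n * (a \<bullet> b)) = 0"
      using A4'[of a b] by (simp add: add_divide_distrib algebra_simps power2_eq_square power4_eq_xxxx)
  qed (use r w in auto)
  show ?thesis
  proof
    show "(\<Sum>z\<in>U. (a \<bullet> z) * (b \<bullet> z)) = card U / CARD('n) * (a \<bullet> b)" for a b using 2 by (simp only: right_minus_eq)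
    show "(\<Sum>z\<in>V. (a \<bullet> z) * (b \<bullet> z)) = card V / CARD('n) * (a \<bullet> b)" for a b using 2 by (simp only: right_minus_eq)
    show "(w1 * r1 ^ 4) * (\<Sum>z\<in>U. (a \<bullet> z) * (b \<bullet> z) * (c \<bullet> z) * (d \<bullet> z))
      + (w2 * r2 ^ 4) * (\<Sum>z\<in>V. (a \<bullet> z) * (b \<bullet> z) * (c \<bullet> z) * (d \<bullet> z))
      = (w1 * r1 ^ 4 * card U + w2 * r2 ^ 4 * card V) / (CARD('n) * (CARD('n) + 2)) *
          ((a \<bullet> b) * (c \<bullet> d) + (a \<bullet> c) * (b \<bullet> d) + (a \<bullet> d) * (b \<bullet> c))" for a b c d
      using A4[of a b c d] by (simp only: of_nat_add of_nat_mult of_nat_numeral)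
  qed (use fin ne unit r w 1 A3 n2 in auto)
qed

lemma unit_inner_eq_1D:
  fixes x y :: "'a::real_inner"
  assumes "x \<bullet> x = 1" "y \<bullet> y = 1" "x \<bullet> y = 1"
  shows "x = y"
proof -
  have "(x - y) \<bullet> (x - y) = 0" using assms by (simp add: inner_diff_left inner_diff_right inner_commute)
  then show ?thesis by simp
qed

text \<open>The kernel as a combination of the Gram matrix and of the projection onto the functions with sum
  zero: \<open>g\<close> is its eigenvalue on the complement of the linear functions, which is trivial exactly if
  \<open>U\<close> is a regular simplex.\<close>

lemma layer_kernel:
  fixes U :: "(real^'n) set"
  assumes fin: "finite U" and ne: "U \<noteq> {}" and unit: "\<And>x. x \<in> U \<Longrightarrow> x \<bullet> x = 1"
    and U1: "\<And>a. (\<Sum>z\<in>U. a \<bullet> z) = 0"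
    and U2: "\<And>a b. (\<Sum>z\<in>U. (a \<bullet> z) * (b \<bullet> z)) = card U / CARD('n) * (a \<bullet> b)"
    and ab: "\<And>x y. x \<in> U \<Longrightarrow> y \<in> U \<Longrightarrow> x \<noteq> y \<Longrightarrow> x \<bullet> y = a \<or> x \<bullet> y = b"
  shows "\<exists>s g. (\<forall>x\<in>U. \<forall>z\<in>U. Q2 x z
      = s * (x \<bullet> z) + g * ((if x = z then 1 else 0) - 1 / card U)) \<and> (g = 0 \<longleftrightarrow> card U = CARD('n) + 1)"
proof (cases "card U = CARD('n) + 1")
  case True
  let ?n = "real CARD('n)"
  have N: "real (card U) = ?n + 1" using True by simp
  have val: "x \<bullet> y = - 1 / ?n" if "x \<in> U" "y \<in> U" "x \<noteq> y" for x y
  proof -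
    \<comment> \<open>With \<open>n + 1\<close> points the total of these squares equals the term at
      \<open>z = x\<close>, so every other term vanishes.\<close>
    have "(\<Sum>z\<in>U. (x \<bullet> z + 1 / ?n)\<^sup>2) = (\<Sum>z\<in>U. (x \<bullet> z) * (x \<bullet> z) + 2 / ?n * (x \<bullet> z) + (1 / ?n)\<^sup>2)"
      by (intro sum.cong refl) (simp add: power2_sum power2_eq_square field_simps)
    also have "\<dots> = real (card U) / ?n * (x \<bullet> x) + 2 / ?n * 0 + card U * (1 / ?n)\<^sup>2"
      by (simp only: sum.distrib sum_distrib_left[symmetric] U1 U2) simp
    also have "\<dots> = (1 + 1 / ?n)\<^sup>2" using unit[OF that(1)] by (simp add: N power2_eq_square field_simps)
    also have "(\<Sum>z\<in>U. (x \<bullet> z + 1 / ?n)\<^sup>2) = (1 + 1 / ?n)\<^sup>2 + (\<Sum>z\<in>U - {x}. (x \<bullet> z + 1 / ?n)\<^sup>2)"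
      using fin that unit by (simp add: sum.remove)
    finally have "(\<Sum>z\<in>U - {x}. (x \<bullet> z + 1 / ?n)\<^sup>2) = 0" by simp
    then have "\<forall>z\<in>U - {x}. (x \<bullet> z + 1 / ?n)\<^sup>2 = 0" using fin by (subst (asm) sum_nonneg_eq_0_iff) auto
    then show ?thesis using that by (auto simp: eq_neg_iff_add_eq_0)
  qed
  show ?thesis
  proof (rule exI[of _ "1 - 1 / ?n"], rule exI[of _ 0], intro conjI ballI)
    fix x z assume xz: "x \<in> U" "z \<in> U"
    show "(x \<bullet> z)\<^sup>2 - 1 / ?n = (1 - 1 / ?n) * (x \<bullet> z) + 0 * ((if x = z then 1 else 0) - 1 / real (card U))"
      using val[OF xz] unit[OF xz(1)] by (cases "x = z") (auto simp: power2_eq_square field_simps)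
  qed (use True in simp)
next
  case False
  let ?n = "real CARD('n)" and ?N = "real (card U)"
  define s where "s = a + b"
  define g where "g = (1 - a) * (1 - b)"
  \<comment> \<open>Off the diagonal this is
    \<open>(x \<bullet> z - a) * (x \<bullet> z - b) = 0\<close>; the value of \<open>g\<close> is
    what corrects the diagonal.\<close>
  have K0: "(x \<bullet> z)\<^sup>2 - 1 / ?n = s * (x \<bullet> z) + g * (if x = z then 1 else 0) - (a * b + 1 / ?n)"
    if "x \<in> U" "z \<in> U" for x z
  proof (cases "x = z")
    case True
    then show ?thesis using unit that by (simp add: s_def g_def algebra_simps)
  next
    case False
    then have "(x \<bullet> z - a) * (x \<bullet> z - b) = 0" using ab that by auto
    then show ?thesis using False by (simp add: s_def power2_eq_square algebra_simps)
  qed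
  obtain x where x: "x \<in> U" using ne by auto
  have N0: "?N > 0" using fin ne by (simp add: card_gt_0_iff)
  \<comment> \<open>The row sums of the kernel vanish, and this fixes the constant
    \<open>a * b + 1 / n\<close>.\<close>
  have "0 = (\<Sum>z\<in>U. (x \<bullet> z) * (x \<bullet> z) - 1 / ?n)"
    by (simp only: sum_subtractf U2) (simp add: unit[OF x])
  also have "\<dots> = (\<Sum>z\<in>U. s * (x \<bullet> z) + g * (if x = z then 1 else 0) - (a * b + 1 / ?n))"
    using K0[OF x] by (intro sum.cong refl) (simp add: power2_eq_square)
  also have "\<dots> = s * 0 + g * 1 - ?N * (a * b + 1 / ?n)"
    using x fin by (simp only: sum_subtractf sum.distrib sum_distrib_left[symmetric] U1) (simp add: algebra_simps)
  finally have g: "a * b + 1 / ?n = g / ?N" using N0 by (simp add: field_simps)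
  \<comment> \<open>If \<open>g = 0\<close>, then one of \<open>a\<close>, \<open>b\<close> is 1,
    which distinct unit vectors cannot attain. All products would be \<open>- 1 / n\<close>, and the
    first moment would give \<open>n + 1\<close> points.\<close>
  have "g \<noteq> 0"
  proof
    assume g0: "g = 0"
    then have "a = 1 \<or> b = 1" by (simp add: g_def)
    moreover have "a * b = - 1 / ?n" using g g0 by simp
    ultimately have "(a = 1 \<and> b = - 1 / ?n) \<or> (b = 1 \<and> a = - 1 / ?n)" by auto
    then have off: "x \<bullet> z = - 1 / ?n" if "z \<in> U" "x \<noteq> z" for z
      using ab[OF x that] unit_inner_eq_1D[OF unit[OF x] unit[OF that(1)]] that by auto
    have "0 = (\<Sum>z\<in>U. x \<bullet> z)" using U1 by simp
    also have "\<dots> = 1 + (\<Sum>z\<in>U - {x}. x \<bullet> z)" using fin x unit by (simp add: sum.remove)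
    also have "(\<Sum>z\<in>U - {x}. x \<bullet> z) = (\<Sum>z\<in>U - {x}. - 1 / ?n)" using off by (intro sum.cong) auto
    also have "\<dots> = - (?N - 1) / ?n" using x fin N0 by (simp add: card_Diff_singleton of_nat_diff field_simps)
    finally have "?N = ?n + 1" by (simp add: field_simps)
    then show False using False by (metis of_nat_1 of_nat_add of_nat_eq_iff)
  qed
  then show ?thesis using K0 False
    by (subst ex_comm, rule_tac x=g in exI, rule_tac x=s in exI) (auto simp: g algebra_simps)
qed

section \<open>The kernel, its block form and its eigenvalues\<close>

context unit_design_pair
begin

abbreviation "N \<equiv> real (card U)"
abbreviation "M \<equiv> real (card V)"

lemma n_ge_2: "real CARD('n) \<ge> 2" using n2 by simp

lemma N_pos: "N > 0" and M_pos: "M > 0"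
  using fin ne by (simp_all add: card_gt_0_iff)

text \<open>The reproducing property of the kernel: \<open>M4\<close> at \<open>x\<close>,
  \<open>x\<close>, \<open>y\<close>, \<open>y\<close>, from which the second moments remove the
  mean. The constant on the right is named \<open>C\<close> below.\<close>

lemma kernel_moment4:
  assumes "x \<bullet> x = 1" "y \<bullet> y = 1"
  shows "d1 * (\<Sum>z\<in>U. Q2 x z * Q2 y z)
    + d2 * (\<Sum>z\<in>V. Q2 x z * Q2 y z)
    = 2 * (d1 * N + d2 * M) / (real CARD('n) * (real CARD('n) + 2)) * Q2 x y"
proof -
  have *: "(\<Sum>z\<in>Z. Q2 x z * Q2 y z)
      = (\<Sum>z\<in>Z. (x \<bullet> z) * (x \<bullet> z) * (y \<bullet> z) * (y \<bullet> z)) - card Z / (real CARD('n))\<^sup>2"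
    if "\<And>a b. (\<Sum>z\<in>Z. (a \<bullet> z) * (b \<bullet> z)) = card Z / real CARD('n) * (a \<bullet> b)" for Z :: "(real^'n) set"
  proof -
    have "(\<Sum>z\<in>Z. Q2 x z * Q2 y z)
      = (\<Sum>z\<in>Z. (x \<bullet> z) * (x \<bullet> z) * (y \<bullet> z) * (y \<bullet> z)
          - (1 / real CARD('n) * ((x \<bullet> z) * (x \<bullet> z)) + 1 / real CARD('n) * ((y \<bullet> z) * (y \<bullet> z)) - (1 / real CARD('n))\<^sup>2))"
      by (intro sum.cong refl) (simp add: power2_eq_square algebra_simps diff_divide_distrib)
    also have "\<dots> = (\<Sum>z\<in>Z. (x \<bullet> z) * (x \<bullet> z) * (y \<bullet> z) * (y \<bullet> z))
        - (1 / real CARD('n) * (card Z / real CARD('n) * (x \<bullet> x)) + 1 / real CARD('n) * (card Z / real CARD('n) * (y \<bullet> y)) - card Z * (1 / real CARD('n))\<^sup>2)"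
      by (simp only: sum_subtractf sum.distrib sum_distrib_left[symmetric] that) simp
    finally show ?thesis using assms by (simp add: power2_eq_square)
  qed
  have "d1 * (\<Sum>z\<in>U. Q2 x z * Q2 y z)
    + d2 * (\<Sum>z\<in>V. Q2 x z * Q2 y z)
    = (d1 * N + d2 * M) / (real CARD('n) * (real CARD('n) + 2)) * (1 + 2 * (x \<bullet> y)\<^sup>2) - (d1 * N + d2 * M) / (real CARD('n))\<^sup>2"
    using M4[of x x y y] assms unfolding *[OF U2] *[OF V2]
    by (simp add: algebra_simps power2_eq_square add_divide_distrib)
  also have "\<dots> = 2 * (d1 * N + d2 * M) / (real CARD('n) * (real CARD('n) + 2)) * Q2 x y"
  proof -
    have "D / (m * (m + 2)) * (1 + 2 * t) - D / m\<^sup>2 = 2 * D / (m * (m + 2)) * (t - 1 / m)"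
      if "m > 0" for D m t :: real
    proof -
      have "m + 2 \<noteq> 0" "m \<noteq> 0" using that by auto
      then show ?thesis by (simp add: divide_simps power2_eq_square) (simp add: algebra_simps)
    qed
    then show ?thesis by simp
  qed
  finally show ?thesis .
qed

text \<open>Harmonic polynomials of degree 2 stay orthogonal to linear functions when summed over
  the design; since the product has degree 3, the weights are \<open>c1\<close> and
  \<open>c2\<close>.\<close>

lemma kernel_moment3:
  assumes "x \<bullet> x = 1"
  shows "c1 * (\<Sum>z\<in>U. Q2 x z * (y \<bullet> z)) + c2 * (\<Sum>z\<in>V. Q2 x z * (y \<bullet> z)) = 0"
proof -
  have *: "(\<Sum>z\<in>Z. Q2 x z * (y \<bullet> z)) = (\<Sum>z\<in>Z. (x \<bullet> z) * (x \<bullet> z) * (y \<bullet> z))"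
    if "\<And>a. (\<Sum>z\<in>Z. a \<bullet> z) = 0" for Z :: "(real^'n) set"
  proof -
    have "(\<Sum>z\<in>Z. Q2 x z * (y \<bullet> z))
        = (\<Sum>z\<in>Z. (x \<bullet> z) * (x \<bullet> z) * (y \<bullet> z) - 1 / real CARD('n) * (y \<bullet> z))"
      by (intro sum.cong refl) (simp add: power2_eq_square algebra_simps)
    then show ?thesis by (simp only: sum_subtractf sum_distrib_left[symmetric] that)
  qed
  show ?thesis unfolding *[OF U1] *[OF V1] by (rule M3)
qed

end

text \<open>The blocks of the kernel matrix: a multiple of the Gram matrix between the layers, and
  inside a layer the Gram matrix together with the projection onto functions with sum zero. This
  form is common to two-valued layers and simplices, so the case distinction survives only in
  \<open>g1\<close> and \<open>g2\<close>.\<close>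

locale kernel_pair = unit_design_pair U V c1 c2 d1 d2
  for U V :: "(real^'n) set" and c1 c2 d1 d2 +
  fixes \<sigma> s1 g1 s2 g2 :: real
  assumes cross: "\<And>x y. x \<in> U \<Longrightarrow> y \<in> V \<Longrightarrow> Q2 x y = \<sigma> * (x \<bullet> y)"
    and kerU: "\<And>x z. x \<in> U \<Longrightarrow> z \<in> U \<Longrightarrow> Q2 x z
      = s1 * (x \<bullet> z) + g1 * ((if x = z then 1 else 0) - 1 / card U)"
    and kerV: "\<And>x z. x \<in> V \<Longrightarrow> z \<in> V \<Longrightarrow> Q2 x z
      = s2 * (x \<bullet> z) + g2 * ((if x = z then 1 else 0) - 1 / card V)"
    and g1: "g1 = 0 \<longleftrightarrow> card U = CARD('n) + 1" and g2: "g2 = 0 \<longleftrightarrow> card V = CARD('n) + 1"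

lemma kernel_pair_swap:
  assumes "kernel_pair U V c1 c2 d1 d2 \<sigma> s1 g1 s2 g2"
  shows "kernel_pair V U c2 c1 d2 d1 \<sigma> s2 g2 s1 g1"
proof -
  interpret kernel_pair U V c1 c2 d1 d2 \<sigma> s1 g1 s2 g2 by fact
  interpret S: unit_design_pair V U c2 c1 d2 d1
    by (rule unit_design_pair_swap) unfold_locales
  show ?thesis
    by unfold_locales (use kerV kerU g1 g2 in simp_all, metis cross inner_commute)
qed

context kernel_pair
begin

text \<open>\<open>C\<close> is the eigenvalue of the weighted kernel in
  \<open>kernel_moment4\<close>. By \<open>kernel_linear\<close>, \<open>h1\<close> is the
  eigenvalue of the first block on linear functions; \<open>h2\<close> is its analogue for the
  second.\<close>

abbreviation "C \<equiv> 2 * (d1 * N + d2 * M) / (real CARD('n) * (real CARD('n) + 2))"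
abbreviation "h1 \<equiv> s1 * N / real CARD('n) + g1"
abbreviation "h2 \<equiv> s2 * M / real CARD('n) + g2"

lemma C_pos: "C > 0"
  using pos N_pos M_pos n_ge_2 by (intro divide_pos_pos mult_pos_pos add_pos_pos) auto

lemma kernel_linear:
  assumes x: "x \<in> U"
  shows "(\<Sum>z\<in>U. Q2 x z * (y \<bullet> z)) = s1 * N / real CARD('n) * (x \<bullet> y) + g1 * (x \<bullet> y)"
proof -
  have "(\<Sum>z\<in>U. Q2 x z * (y \<bullet> z))
      = (\<Sum>z\<in>U. s1 * ((x \<bullet> z) * (y \<bullet> z)) + g1 * (if z = x then y \<bullet> z else 0) - g1 / N * (y \<bullet> z))"
    by (intro sum.cong refl) (simp add: kerU[OF x] algebra_simps)
  also have "\<dots> = s1 * (N / real CARD('n) * (x \<bullet> y)) + g1 * (y \<bullet> x) - g1 / N * 0"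
    using x fin by (simp only: sum_subtractf sum.distrib sum_distrib_left[symmetric] U1 U2) simp
  finally show ?thesis by (simp add: inner_commute)
qed

lemma kernel_square:
  assumes x: "x \<in> U" and y: "y \<in> U"
  shows "(\<Sum>z\<in>U. Q2 x z * Q2 y z)
    = (s1\<^sup>2 * N / real CARD('n) + 2 * s1 * g1) * (x \<bullet> y) + g1\<^sup>2 * ((if x = y then 1 else 0) - 1 / N)"
proof -
  have "(\<Sum>z\<in>U. Q2 x z * Q2 y z)
      = (\<Sum>z\<in>U. s1 * (Q2 x z * (y \<bullet> z)) + g1 * (if z = y then Q2 x z else 0)
          - g1 / N * Q2 x z)"
    by (intro sum.cong refl, subst kerU[OF y], assumption)
      (simp add: algebra_simps add_divide_distrib diff_divide_distrib)
  also have "\<dots> = s1 * (s1 * N / real CARD('n) * (x \<bullet> y) + g1 * (x \<bullet> y)) + g1 * Q2 x y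
      - g1 / N * (\<Sum>z\<in>U. Q2 x z)"
    using y fin by (simp only: sum_subtractf sum.distrib sum_distrib_left[symmetric] kernel_linear[OF x]) simp
  also have "(\<Sum>z\<in>U. Q2 x z) = 0"
    using U2[of x x] unit(1)[OF x] by (simp add: sum_subtractf power2_eq_square)
  finally show ?thesis unfolding kerU[OF x y] by (simp add: power2_eq_square algebra_simps)
qed

lemma kernel_cross_linear:
  assumes x: "x \<in> U"
  shows "(\<Sum>z\<in>V. Q2 x z * (y \<bullet> z)) = \<sigma> * M / real CARD('n) * (x \<bullet> y)"
proof -
  have "(\<Sum>z\<in>V. Q2 x z * (y \<bullet> z)) = \<sigma> * (\<Sum>z\<in>V. (x \<bullet> z) * (y \<bullet> z))"
    using cross[OF x] by (simp add: sum_distrib_left mult.assoc)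
  then show ?thesis by (simp add: V2)
qed

text \<open>\<open>kernel_moment3\<close> at a point of \<open>U\<close>. It makes the linear
  eigenvalue of the layer vanish as soon as the cross block does.\<close>

lemma kernel_linear_degree3: "c1 * h1 + c2 * (\<sigma> * M / real CARD('n)) = 0"
proof -
  obtain x where x: "x \<in> U" using ne by auto
  show ?thesis using kernel_moment3[OF unit(1)[OF x], of x]
    unfolding kernel_linear[OF x] kernel_cross_linear[OF x] unit(1)[OF x] by simp
qed

text \<open>On \<open>U\<close> the reproducing property is a relation between the Gram matrix and
  the projection off the constants. Unless \<open>U\<close> has \<open>n + 1\<close> points these
  are independent, so both coefficients vanish, and the one of the projection is
  \<open>g1 * (d1 * g1 - C)\<close>.\<close>

lemma complement_eigenvalue:
  assumes "card U \<noteq> CARD('n) + 1"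
  shows "d1 * g1 = C"
proof -
  define p where "p = d1 * (s1\<^sup>2 * N / real CARD('n) + 2 * s1 * g1) + d2 * (\<sigma>\<^sup>2 * M / real CARD('n)) - C * s1"
  define q where "q = d1 * g1\<^sup>2 - C * g1"
  have pq: "p * (x \<bullet> y) + q * ((if x = y then 1 else 0) - 1 / N) = 0" if x: "x \<in> U" and y: "y \<in> U" for x y
  proof -
    have "(\<Sum>z\<in>V. Q2 x z * Q2 y z)
        = \<sigma> * (\<Sum>z\<in>V. Q2 x z * (y \<bullet> z))"
      unfolding sum_distrib_left by (intro sum.cong refl) (simp add: cross[OF y])
    then have V: "(\<Sum>z\<in>V. Q2 x z * Q2 y z) = \<sigma>\<^sup>2 * M / real CARD('n) * (x \<bullet> y)"
      unfolding kernel_cross_linear[OF x] by (simp add: power2_eq_square)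
    show ?thesis
      using kernel_moment4[OF unit(1)[OF x] unit(1)[OF y]]
      unfolding V kernel_square[OF x y] kerU[OF x y] p_def q_def by algebra
  qed
  obtain x where x: "x \<in> U" using ne by auto
  \<comment> \<open>Two equations for \<open>p\<close> and \<open>q\<close>: the relation applied to
    a linear function, and its diagonal entry. Together they give
    \<open>p * (n + 1 - N) = 0\<close>.\<close>
  have "0 = (\<Sum>y\<in>U. (p * (x \<bullet> y) + q * ((if x = y then 1 else 0) - 1 / N)) * (x \<bullet> y))"
    using pq[OF x] by simp
  also have "\<dots> = (\<Sum>y\<in>U. p * ((x \<bullet> y) * (x \<bullet> y)) + q * (if y = x then x \<bullet> y else 0) - q / N * (x \<bullet> y))"
    by (intro sum.cong refl) (simp add: algebra_simps)
  also have "\<dots> = p * (N / real CARD('n) * (x \<bullet> x)) + q * (x \<bullet> x) - q / N * 0"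
    using x fin by (simp only: sum_subtractf sum.distrib sum_distrib_left[symmetric] U1 U2) simp
  finally have 1: "q = - (p * N / real CARD('n))" using unit(1)[OF x] by simp
  have 2: "p + q * (1 - 1 / N) = 0" using pq[OF x x] unit(1)[OF x] by simp
  have "p * (real CARD('n) + 1 - N) = 0"
  proof -
    have "p = p * N / real CARD('n) * (1 - 1 / N)"
      using 2 unfolding 1 by (simp only: minus_mult_left[symmetric])
    also have "\<dots> = p * (N - 1) / real CARD('n)"
      using N_pos by (simp add: right_diff_distrib diff_divide_distrib)
    finally have "p = p * (N - 1) / real CARD('n)" .
    then have "p * real CARD('n) = p * (N - 1)" using n_ge_2 by (simp add: eq_divide_eq)
    then show ?thesis by algebra
  qed
  moreover have "real CARD('n) + 1 - N \<noteq> 0" using assms by (simp add: eq_diff_eq)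
  ultimately have "q = 0" using 1 by simp
  then have "g1 * (d1 * g1 - C) = 0" by (simp add: q_def power2_eq_square algebra_simps)
  then show ?thesis using g1 assms by simp
qed

text \<open>The left side sums the diagonal entries; the right side sums the eigenvalues,
  \<open>0\<close> on constants, \<open>h1\<close> with multiplicity \<open>n\<close> and
  \<open>g1\<close> on the remaining \<open>N - 1 - n\<close> dimensions.\<close>

lemma kernel_trace: "N * (1 - 1 / real CARD('n)) = real CARD('n) * h1 + (N - 1 - real CARD('n)) * g1"
proof -
  obtain x where x: "x \<in> U" using ne by auto
  have "1 - 1 / real CARD('n) = s1 + g1 * (1 - 1 / N)" using kerU[OF x x] unit(1)[OF x] by simp
  then show ?thesis using N_pos n_ge_2 by (simp add: field_simps)
qed

text \<open>If \<open>U\<close> has \<open>n + 1\<close> points, the value of \<open>d1 * g1\<close>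
  is unknown but its multiplicity is zero, so \<open>C\<close> may stand for it.\<close>

lemma weighted_kernel_trace: "d1 * N * (1 - 1 / real CARD('n)) = d1 * real CARD('n) * h1 + (N - 1 - real CARD('n)) * C"
proof (cases "card U = CARD('n) + 1")
  case True
  then have *: "N - 1 - real CARD('n) = 0" by auto
  show ?thesis using arg_cong[OF kernel_trace, of "(*) d1"] unfolding * by (simp only: mult_zero_left add_0_right mult.assoc)
next
  case False
  have "d1 * N * (1 - 1 / real CARD('n)) = d1 * (N * (1 - 1 / real CARD('n)))" by simp
  also have "\<dots> = d1 * real CARD('n) * h1 + (N - 1 - real CARD('n)) * (d1 * g1)" unfolding kernel_trace by algebra
  finally show ?thesis by (simp only: complement_eigenvalue[OF False])
qed

end

section \<open>Traces and the number of points\<close>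

context kernel_pair
begin

interpretation S: kernel_pair V U c2 c1 d2 d1 \<sigma> s2 g2 s1 g1
  by (rule kernel_pair_swap) unfold_locales

text \<open>The factor of \<open>C\<close> on the left is the dimension of the space of harmonic
  polynomials of degree 2.\<close>

lemma total_kernel_trace: "(real CARD('n) - 1) * (real CARD('n) + 2) / 2 * C = real CARD('n) * (d1 * h1 + d2 * h2) + (N + M - 2 - 2 * real CARD('n)) * C"
proof -
  have "(d1 * N + d2 * M) * (1 - 1 / real CARD('n)) = real CARD('n) * (d1 * h1 + d2 * h2) + (N + M - 2 - 2 * real CARD('n)) * C"
    using weighted_kernel_trace S.weighted_kernel_trace unfolding add.commute[of "d2 * M" "d1 * N"] by algebra
  moreover have "(real CARD('n) - 1) * (real CARD('n) + 2) / 2 * C = (d1 * N + d2 * M) * (1 - 1 / real CARD('n))"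
  proof -
    have "(m - 1) * (m + 2) / 2 * (2 * D / (m * (m + 2))) = D * (1 - 1 / m)" if "m \<ge> 2" for m D :: real
    proof -
      have "m \<noteq> 0" "m + 2 \<noteq> 0" using that by auto
      then show ?thesis by (simp add: divide_simps)
    qed
    then show ?thesis using n_ge_2 by blast
  qed
  ultimately show ?thesis by simp
qed

text \<open>The reproducing property between the layers, where both sides are multiples of
  \<open>\<sigma> * (x \<bullet> y)\<close>. This factor is nonzero: orthogonal \<open>x\<close> and
  \<open>y\<close> would have kernel value \<open>- 1 / n\<close>, not \<open>0\<close>.\<close>

lemma linear_eigenvalue_if_mixed:
  assumes "\<sigma> \<noteq> 0"
  shows "d1 * h1 + d2 * h2 = C"
proof -
  obtain x y where x: "x \<in> U" and y: "y \<in> V" using ne by auto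
  have xy: "x \<bullet> y \<noteq> 0" using cross[OF x y] n_ge_2 by auto
  have "(\<Sum>z\<in>U. Q2 x z * Q2 y z) = \<sigma> * (\<Sum>z\<in>U. Q2 x z * (y \<bullet> z))"
    unfolding sum_distrib_left
    by (intro sum.cong refl) (use cross[OF _ y] in \<open>simp add: inner_commute\<close>)
  then have 1: "(\<Sum>z\<in>U. Q2 x z * Q2 y z) = \<sigma> * h1 * (x \<bullet> y)"
    unfolding kernel_linear[OF x] by (simp add: algebra_simps)
  have "(\<Sum>z\<in>V. Q2 x z * Q2 y z) = \<sigma> * (\<Sum>z\<in>V. Q2 y z * (x \<bullet> z))"
    unfolding sum_distrib_left by (intro sum.cong refl) (simp add: cross[OF x])
  then have 2: "(\<Sum>z\<in>V. Q2 x z * Q2 y z) = \<sigma> * h2 * (x \<bullet> y)"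
    unfolding S.kernel_linear[OF y] inner_commute[of y x] by (simp add: algebra_simps)
  have "\<sigma> * (x \<bullet> y) * (d1 * h1 + d2 * h2) = \<sigma> * (x \<bullet> y) * C"
    using kernel_moment4[OF unit(1)[OF x] unit(2)[OF y]] unfolding 1 2 cross[OF x y] by algebra
  moreover have "\<sigma> * (x \<bullet> y) \<noteq> 0" using assms xy by simp
  ultimately show ?thesis using mult_left_cancel by blast
qed

lemma card_sum_if_mixed:
  assumes "\<sigma> \<noteq> 0"
  shows "N + M = (real CARD('n) + 1) * (real CARD('n) + 2) / 2"
proof -
  have aux: "(p - q) * c = 0" if "p * c = m * c + r * c" "r = q - m" for p q r m c :: real
    using that by algebra
  have "((real CARD('n) - 1) * (real CARD('n) + 2) / 2 - (N + M - 2 - real CARD('n))) * C = 0"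
    using total_kernel_trace unfolding linear_eigenvalue_if_mixed[OF assms] by (rule aux) simp
  then have "(real CARD('n) - 1) * (real CARD('n) + 2) / 2 = N + M - 2 - real CARD('n)" using C_pos by (metis less_irrefl mult_eq_0_iff right_minus_eq)
  then show ?thesis by (simp add: field_simps)
qed

text \<open>Everything follows from \<open>h1 = 0\<close> and the trace: the complement must carry
  the whole positive trace, which excludes \<open>n + 1\<close> points and expresses
  \<open>g1\<close> and \<open>s1\<close> by \<open>N\<close> and \<open>n\<close>.\<close>

lemma unmixed_layer:
  assumes "\<sigma> = 0"
  shows "h1 = 0" and "d1 * g1 = C" and "g1 > 0" and "(N - 1 - real CARD('n)) * g1 = N * (1 - 1 / real CARD('n))"
    and "N > real CARD('n) + 1" and "s1 = - ((real CARD('n) - 1) / (N - real CARD('n) - 1))"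
proof -
  show h: "h1 = 0" using kernel_linear_degree3 pos assms by simp
  have tr: "(N - 1 - real CARD('n)) * g1 = N * (1 - 1 / real CARD('n))" using kernel_trace unfolding h by simp
  have nz: "N * (1 - 1 / real CARD('n)) > 0" using N_pos n_ge_2 by simp
  have "card U \<noteq> CARD('n) + 1"
  proof
    assume "card U = CARD('n) + 1"
    then have "N - 1 - real CARD('n) = 0" by simp
    then show False using tr nz by simp
  qed
  then show dg: "d1 * g1 = C" by (rule complement_eigenvalue)
  show gp: "g1 > 0" using dg C_pos pos(3) by (metis zero_less_mult_pos)
  show "(N - 1 - real CARD('n)) * g1 = N * (1 - 1 / real CARD('n))" by (rule tr)
  have "N - 1 - real CARD('n) > 0" using tr nz gp by (metis zero_less_mult_pos2)
  then show Nn: "N > real CARD('n) + 1" by simp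
  have g: "g1 = N * (1 - 1 / real CARD('n)) / (N - 1 - real CARD('n))"
    using tr Nn by (subst nonzero_eq_divide_eq) (auto simp: mult.commute)
  have "s1 = - g1 * real CARD('n) / N" using h N_pos n_ge_2 by (simp add: field_simps)
  also have "\<dots> = - ((real CARD('n) - 1) / (N - real CARD('n) - 1))"
    unfolding g using N_pos n_ge_2 Nn by (simp add: divide_simps) (simp add: algebra_simps)
  finally show "s1 = - ((real CARD('n) - 1) / (N - real CARD('n) - 1))" .
qed

end

context kernel_pair
begin

interpretation S: kernel_pair V U c2 c1 d2 d1 \<sigma> s2 g2 s1 g1
  by (rule kernel_pair_swap) unfold_locales

text \<open>Now the linear functions of both layers lie in the kernel of the operator, and the
  complements alone account for the trace.\<close>

lemma card_sum_if_unmixed: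
  assumes "\<sigma> = 0"
  shows "N + M - 2 - 2 * real CARD('n) = (real CARD('n) - 1) * (real CARD('n) + 2) / 2"
proof -
  have aux: "(p - q) * c = 0" if "p * c = m * (d1 * 0 + d2 * 0) + q * c" for p q m c :: real
    using that by (simp add: left_diff_distrib)
  have "((real CARD('n) - 1) * (real CARD('n) + 2) / 2 - (N + M - 2 - 2 * real CARD('n))) * C = 0"
    using total_kernel_trace unfolding unmixed_layer(1)[OF assms] S.unmixed_layer(1)[OF assms]
    by (rule aux)
  then show ?thesis using C_pos by (metis less_irrefl mult_eq_0_iff right_minus_eq)
qed

lemma weight_ratio_if_unmixed:
  assumes "\<sigma> = 0"
  shows "d1 * g1 = d2 * g2"
  using unmixed_layer(2)[OF assms] S.unmixed_layer(2)[OF assms] by (simp add: add.commute)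

text \<open>\<open>h1 = 0\<close> eliminates \<open>g1\<close> from the off-diagonal entries,
  leaving \<open>s1\<close> as the only parameter of the layer besides \<open>n\<close>.\<close>

lemma layer_quadratic_if_unmixed:
  assumes "\<sigma> = 0" and "x \<in> U" "y \<in> U" "x \<noteq> y"
  shows "(x \<bullet> y)\<^sup>2 - s1 * (x \<bullet> y) - (1 + s1) / real CARD('n) = 0"
proof -
  have "g1 / N = - s1 / real CARD('n)" using unmixed_layer(1)[OF assms(1)] N_pos n_ge_2 by (simp add: field_simps)
  then show ?thesis using kerU[OF assms(2,3)] assms(4)
    by (simp add: diff_divide_distrib add_divide_distrib)
qed

end

section \<open>The case of opposite cross values\<close>

text \<open>Summing the hypothesis over \<open>y\<close> gives the squared norm of the tensor of
  third moments, so every component of this tensor vanishes.\<close>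

lemma cubic_moments_zero:
  fixes U :: "(real^'n) set"
  assumes "\<And>y. y \<in> U \<Longrightarrow> (\<Sum>z\<in>U. (y \<bullet> z) ^ 3) = 0"
  shows "(\<Sum>z\<in>U. (a \<bullet> z) * (b \<bullet> z) * (c \<bullet> z)) = 0"
proof -
  define e :: "'n \<times> 'n \<times> 'n \<Rightarrow> real^'n \<Rightarrow> real" where
    "e p z = z $ fst p * z $ fst (snd p) * z $ snd (snd p)" for p z
  have triple: "(\<Sum>p\<in>UNIV. (x $ fst p * y $ fst (snd p) * z $ snd (snd p)) * e p v) = (x \<bullet> v) * (y \<bullet> v) * (z \<bullet> v)"
    for x y z v
  proof -
    have "(x \<bullet> v) * (y \<bullet> v) * (z \<bullet> v) = (\<Sum>i\<in>UNIV. \<Sum>j\<in>UNIV. \<Sum>k\<in>UNIV. x $ i * v $ i * (y $ j * v $ j) * (z $ k * v $ k))"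
    proof -
      have "(x \<bullet> v) * ((y \<bullet> v) * (z \<bullet> v)) = (\<Sum>i\<in>UNIV. x $ i * v $ i) * (\<Sum>j\<in>UNIV. \<Sum>k\<in>UNIV. (y $ j * v $ j) * (z $ k * v $ k))"
        by (simp only: inner_vec_def inner_real_def sum_product)
      then show ?thesis by (simp only: sum_distrib_right) (simp only: sum_distrib_left mult.assoc)
    qed
    also have "\<dots> = (\<Sum>p\<in>UNIV. x $ fst p * v $ fst p * (y $ fst (snd p) * v $ fst (snd p)) * (z $ snd (snd p) * v $ snd (snd p)))"
      by (simp add: sum.cartesian_product case_prod_beta)
    finally show ?thesis by (simp add: e_def mult_ac)
  qed
  have "(\<Sum>p\<in>UNIV. (\<Sum>z\<in>U. e p z) * (\<Sum>z\<in>U. e p z)) = (\<Sum>y\<in>U. \<Sum>z\<in>U. \<Sum>p\<in>UNIV. e p y * e p z)"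
    by (simp add: sum_product sum.swap[of _ _ UNIV])
  also have "\<dots> = (\<Sum>y\<in>U. \<Sum>z\<in>U. (y \<bullet> z) ^ 3)"
  proof (intro sum.cong refl)
    fix y z
    show "(\<Sum>p\<in>UNIV. e p y * e p z) = (y \<bullet> z) ^ 3"
      using triple[of y y y z] by (simp add: e_def power3_eq_cube)
  qed
  also have "\<dots> = 0" using assms by simp
  finally have "(\<Sum>p\<in>UNIV. (\<Sum>z\<in>U. e p z) * (\<Sum>z\<in>U. e p z)) = 0" .
  then have e0: "(\<Sum>z\<in>U. e p z) = 0" for p
    by (subst (asm) sum_nonneg_eq_0_iff) (auto simp del: split_paired_All)
  have "(\<Sum>z\<in>U. (a \<bullet> z) * (b \<bullet> z) * (c \<bullet> z))
      = (\<Sum>p\<in>UNIV. (a $ fst p * b $ fst (snd p) * c $ snd (snd p)) * (\<Sum>z\<in>U. e p z))"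
    unfolding triple[symmetric] sum_distrib_left by (rule sum.swap)
  then show ?thesis by (simp add: e0)
qed

text \<open>\<open>- (1 - b) / (a - b)\<close> is an eigenvalue of the strongly regular graph \<open>x \<bullet> y = a\<close>, hence an
  algebraic integer.\<close>

lemma eigenvalue_integral:
  fixes U :: "(real^'n) set"
  assumes fin: "finite U" and unit: "\<And>x. x \<in> U \<Longrightarrow> x \<bullet> x = 1"
    and U1: "\<And>a. (\<Sum>z\<in>U. a \<bullet> z) = 0"
    and U2: "\<And>a b. (\<Sum>z\<in>U. (a \<bullet> z) * (b \<bullet> z)) = card U / CARD('n) * (a \<bullet> b)"
    and val: "\<And>x y. x \<in> U \<Longrightarrow> y \<in> U \<Longrightarrow> x \<noteq> y \<Longrightarrow> x \<bullet> y = a \<or> x \<bullet> y = b"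
    and xy: "x0 \<in> U" "y0 \<in> U" "x0 \<noteq> y0" "x0 \<bullet> y0 = a" "x1 \<in> U" "y1 \<in> U" "x1 \<noteq> y1" "x1 \<bullet> y1 = b"
    and ab: "a \<noteq> b" "a \<in> \<rat>" "b \<in> \<rat>"
  shows "(1 - b) / (a - b) \<in> \<int>"
proof -
  define \<kappa> where "\<kappa> = 1 - b"
  define L where "L = card U / CARD('n)"
  \<comment> \<open>On \<open>U\<close> this is the adjacency matrix of the graph
    \<open>x \<bullet> y = a\<close>; the term with \<open>\<kappa>\<close> clears the diagonal.
    Then \<open>S\<close> is its square and counts common neighbours.\<close>
  define A where "A x z = (x \<bullet> z - b - \<kappa> * (if x = z then 1 else 0)) / (a - b)" for x z :: "real^'n"
  define S where "S x y = (\<Sum>z\<in>U. A x z * A y z)" for x y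
  have "A x z \<in> \<int>" if "x \<in> U" "z \<in> U" for x z
    using val[OF that] unit[OF that(1)] ab(1) by (cases "x = z") (auto simp: A_def \<kappa>_def)
  then have S_int: "S x y \<in> \<int>" if "x \<in> U" "y \<in> U" for x y
    using that unfolding S_def by (intro Ints_sum Ints_mult) auto
  have S_eq: "(a - b)\<^sup>2 * S x y = L * (x \<bullet> y) + card U * b\<^sup>2 - 2 * \<kappa> * (x \<bullet> y - b) + \<kappa>\<^sup>2 * (if x = y then 1 else 0)"
    if "x \<in> U" "y \<in> U" for x y
  proof -
    have "(a - b)\<^sup>2 * S x y = (\<Sum>z\<in>U. ((a - b) * A x z) * ((a - b) * A y z))"
      unfolding S_def sum_distrib_left by (intro sum.cong refl) (simp add: power2_eq_square)
    also have "\<dots> = (\<Sum>z\<in>U. (x \<bullet> z - b - \<kappa> * (if x = z then 1 else 0)) * (y \<bullet> z - b - \<kappa> * (if y = z then 1 else 0)))"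
      using ab(1) by (simp add: A_def)
    also have "\<dots> = (\<Sum>z\<in>U. (x \<bullet> z) * (y \<bullet> z) - b * (x \<bullet> z) - b * (y \<bullet> z) + b\<^sup>2
        - \<kappa> * (if z = x then y \<bullet> z - b else 0) - \<kappa> * (if z = y then x \<bullet> z - b else 0)
        + \<kappa>\<^sup>2 * (if z = x then if x = y then 1 else 0 else 0))"
      by (intro sum.cong refl) (auto simp: power2_eq_square algebra_simps)
    also have "\<dots> = card U / CARD('n) * (x \<bullet> y) - b * 0 - b * 0 + card U * b\<^sup>2 - \<kappa> * (y \<bullet> x - b) - \<kappa> * (x \<bullet> y - b)
        + \<kappa>\<^sup>2 * (if x = y then 1 else 0)"
      using that fin by (simp only: sum_subtractf sum.distrib sum_distrib_left[symmetric] U1 U2) simp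
    finally show ?thesis by (simp add: L_def inner_commute algebra_simps)
  qed
  have d: "(a - b)\<^sup>2 \<noteq> 0" "a - b \<noteq> 0" using ab by auto
  let ?K = "\<kappa> / (a - b)"
  \<comment> \<open>\<open>f\<close> and \<open>e\<close> are the coefficients of the usual
    quadratic for the eigenvalues: common neighbours of adjacent minus those of non-adjacent points,
    and valency minus the latter.\<close>
  define f where "f = S x0 y0 - S x1 y1"
  define e where "e = S x0 x0 - S x1 y1"
  have fe: "f \<in> \<int>" "e \<in> \<int>" using S_int xy by (auto simp: f_def e_def intro!: Ints_diff)
  have K: "\<kappa> = ?K * (a - b)" using d by simp
  have "(a - b)\<^sup>2 * f = (L - 2 * \<kappa>) * (a - b)"
    using S_eq[OF xy(1,2)] S_eq[OF xy(5,6)] xy by (simp add: f_def algebra_simps)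
  then have 1: "L = (a - b) * f + 2 * \<kappa>"
    using d by (simp add: power2_eq_square)
  have "(a - b)\<^sup>2 * e = \<kappa> * (L - \<kappa>)"
    using S_eq[OF xy(1,1)] S_eq[OF xy(5,6)] xy unit[OF xy(1)]
    by (simp add: e_def \<kappa>_def algebra_simps power2_eq_square)
  then have "(a - b)\<^sup>2 * (?K\<^sup>2 + f * ?K - e) = 0" using 1 K by algebra
  then have root: "?K\<^sup>2 + f * ?K - e = 0" using d by simp
  obtain f' e' where fe': "f = of_int f'" "e = of_int e'" using fe by (auto elim!: Ints_cases)
  have "algebraic_int ?K"
  proof (rule algebraic_int.intros[of "[:- e, f, 1:]"])
    show "lead_coeff [:- e, f, 1:] = 1" by simp
    show "\<forall>i. coeff [:- e, f, 1:] i \<in> \<int>"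
      using fe by (auto simp: coeff_pCons split: nat.splits)
    show "poly [:- e, f, 1:] ?K = 0" using root by (simp add: power2_eq_square algebra_simps)
  qed
  moreover have "?K \<in> \<rat>" using ab by (auto simp: \<kappa>_def)
  ultimately show ?thesis unfolding \<kappa>_def by (rule rational_algebraic_int_is_int)
qed

section \<open>Integrality for the inner products in a layer\<close>

context kernel_pair
begin

lemma cross_sq_if_unmixed:
  assumes "\<sigma> = 0" "x \<in> U" "z \<in> V"
  shows "(x \<bullet> z)\<^sup>2 = 1 / real CARD('n)"
  using cross[OF assms(2,3)] assms(1) by simp

text \<open>For \<open>y\<close> in \<open>U\<close> the square
  \<open>(y \<bullet> z)\<^sup>2\<close> is constant on \<open>V\<close>, so the third moment there
  reduces to the first and vanishes. \<open>M3\<close> then leaves only the contribution of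
  \<open>U\<close>.\<close>

lemma cubic_moments_if_unmixed:
  assumes "\<sigma> = 0"
  shows "(\<Sum>z\<in>U. (a \<bullet> z) * (b \<bullet> z) * (c \<bullet> z)) = 0"
proof (rule cubic_moments_zero)
  fix y assume y: "y \<in> U"
  have "(\<Sum>z\<in>V. (y \<bullet> z) * (y \<bullet> z) * (y \<bullet> z)) = (\<Sum>z\<in>V. 1 / real CARD('n) * (y \<bullet> z))"
    using cross_sq_if_unmixed[OF assms y] by (intro sum.cong refl) (simp add: power2_eq_square)
  also have "\<dots> = 0" by (simp only: sum_distrib_left[symmetric] V1)
  finally have "(\<Sum>z\<in>V. (y \<bullet> z) * (y \<bullet> z) * (y \<bullet> z)) = 0" .
  then have "(\<Sum>z\<in>U. (y \<bullet> z) * (y \<bullet> z) * (y \<bullet> z)) = 0" using M3[of y y y] pos by simp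
  then show "(\<Sum>z\<in>U. (y \<bullet> z) ^ 3) = 0" by (simp add: power3_eq_cube)
qed

text \<open>For \<open>z\<close> in \<open>V\<close>,
  \<open>n * (x \<bullet> z) * (y \<bullet> z)\<close> has square 1. Summing these signs over
  \<open>V\<close> gives \<open>M * (x \<bullet> y)\<close> by the second moment.\<close>

lemma inner_integral_if_unmixed:
  assumes "\<sigma> = 0" and x: "x \<in> U" and y: "y \<in> U"
  shows "M * (x \<bullet> y) \<in> \<int>"
proof -
  have "real CARD('n) * ((x \<bullet> z) * (y \<bullet> z)) \<in> \<int>" if z: "z \<in> V" for z
  proof -
    have "(real CARD('n) * ((x \<bullet> z) * (y \<bullet> z)))\<^sup>2 = (real CARD('n))\<^sup>2 * ((x \<bullet> z)\<^sup>2 * (y \<bullet> z)\<^sup>2)"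
      by (simp add: power_mult_distrib)
    also have "\<dots> = 1"
      unfolding cross_sq_if_unmixed[OF assms(1) x z] cross_sq_if_unmixed[OF assms(1) y z]
      using n_ge_2 by (simp add: power2_eq_square)
    finally show ?thesis by (auto simp: power2_eq_1_iff)
  qed
  then have "(\<Sum>z\<in>V. real CARD('n) * ((x \<bullet> z) * (y \<bullet> z))) \<in> \<int>" by (rule Ints_sum)
  moreover have "(\<Sum>z\<in>V. real CARD('n) * ((x \<bullet> z) * (y \<bullet> z))) = M * (x \<bullet> y)"
    using n_ge_2 by (simp only: sum_distrib_left[symmetric] V2) simp
  ultimately show ?thesis by simp
qed

lemma inner_rational_if_unmixed:
  assumes "\<sigma> = 0" "x \<in> U" "y \<in> U"
  shows "x \<bullet> y \<in> \<rat>"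
proof -
  have "x \<bullet> y = (M * (x \<bullet> y)) / M" using M_pos by simp
  also have "\<dots> \<in> \<rat>" using inner_integral_if_unmixed[OF assms] Ints_subset_Rats by (intro Rats_divide) auto
  finally show ?thesis .
qed

text \<open>If some point saw a single inner product, the first two moments at this point would give
  \<open>N = n + 1\<close>, against \<open>unmixed_layer\<close>.\<close>

lemma two_values_if_unmixed:
  assumes \<sigma>: "\<sigma> = 0"
  obtains x0 y0 x1 y1 where "x0 \<in> U" "y0 \<in> U" "x0 \<noteq> y0" "x1 \<in> U" "y1 \<in> U" "x1 \<noteq> y1"
    "x0 \<bullet> y0 > x1 \<bullet> y1"
proof -
  obtain x where x: "x \<in> U" using ne by auto
  have "\<exists>y\<in>U - {x}. \<exists>z\<in>U - {x}. x \<bullet> y \<noteq> x \<bullet> z"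
  proof (rule ccontr)
    assume "\<not> ?thesis"
    then have "\<exists>t. \<forall>z\<in>U - {x}. x \<bullet> z = t" by (metis equals0I)
    then obtain t where t: "\<forall>z\<in>U - {x}. x \<bullet> z = t" by blast
    have cd: "real (card (U - {x})) = N - 1" using x fin N_pos by (simp add: of_nat_diff)
    have "0 = (\<Sum>z\<in>U. x \<bullet> z)" using U1 by simp
    also have "\<dots> = 1 + (\<Sum>z\<in>U - {x}. x \<bullet> z)" using x fin unit by (simp add: sum.remove)
    also have "(\<Sum>z\<in>U - {x}. x \<bullet> z) = (\<Sum>z\<in>U - {x}. t)" using t by (intro sum.cong) auto
    finally have 1: "(N - 1) * t = - 1" using cd by simp
    have "N / real CARD('n) = (\<Sum>z\<in>U. (x \<bullet> z) * (x \<bullet> z))" using U2[of x x] unit(1)[OF x] by simp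
    also have "\<dots> = 1 + (\<Sum>z\<in>U - {x}. (x \<bullet> z) * (x \<bullet> z))" using x fin unit by (simp add: sum.remove)
    also have "(\<Sum>z\<in>U - {x}. (x \<bullet> z) * (x \<bullet> z)) = (\<Sum>z\<in>U - {x}. t * t)" using t by (intro sum.cong) auto
    finally have "N / real CARD('n) = 1 + (N - 1) * t * t" using cd by simp
    then have 2: "N = real CARD('n) * (1 - t)" unfolding 1 using n_ge_2 by (simp add: field_simps)
    have "(N - 1) * N = real CARD('n) * (N - 1 - (N - 1) * t)" unfolding 2 by algebra
    then have "(N - 1) * N = real CARD('n) * N" unfolding 1 by simp
    then have "N - 1 = real CARD('n)" using N_pos by (metis less_irrefl mult_right_cancel)
    then show False using unmixed_layer(5)[OF \<sigma>] by simp
  qed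
  then obtain y z where yz: "y \<in> U" "z \<in> U" "x \<noteq> y" "x \<noteq> z" "x \<bullet> y \<noteq> x \<bullet> z" by auto
  show thesis
    using that[OF x yz(1) yz(3) x yz(2) yz(4)] that[OF x yz(2) yz(4) x yz(1) yz(3)] yz(5)
    by linarith
qed

lemma vieta_if_unmixed:
  assumes \<sigma>: "\<sigma> = 0" and xy: "x0 \<in> U" "y0 \<in> U" "x0 \<noteq> y0" "x1 \<in> U" "y1 \<in> U" "x1 \<noteq> y1"
    and gt: "x0 \<bullet> y0 > x1 \<bullet> y1"
  shows "x0 \<bullet> y0 + x1 \<bullet> y1 = s1" "(x0 \<bullet> y0) * (x1 \<bullet> y1) = - (1 + s1) / real CARD('n)"
proof -
  define c where "c = (1 + s1) / real CARD('n)"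
  have 1: "(x0 \<bullet> y0)\<^sup>2 - s1 * (x0 \<bullet> y0) - c = 0" "(x1 \<bullet> y1)\<^sup>2 - s1 * (x1 \<bullet> y1) - c = 0"
    using layer_quadratic_if_unmixed[OF \<sigma>] xy by (auto simp: c_def)
  then have "(x0 \<bullet> y0 - x1 \<bullet> y1) * (x0 \<bullet> y0 + x1 \<bullet> y1 - s1) = 0" by algebra
  then show s: "x0 \<bullet> y0 + x1 \<bullet> y1 = s1" using gt by simp
  have "(x0 \<bullet> y0) * (x1 \<bullet> y1) = - c" using 1(1) s by algebra
  then show "(x0 \<bullet> y0) * (x1 \<bullet> y1) = - (1 + s1) / real CARD('n)" by (simp add: c_def minus_divide_left)
qed

text \<open>The sum and product are those of the roots of \<open>layer_quadratic_if_unmixed\<close>,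
  and both roots occur since two distinct inner products do. So explicit values need only be checked
  by their sum and product.\<close>

lemma value_set_if_unmixed:
  assumes \<sigma>: "\<sigma> = 0" and \<alpha>\<beta>: "\<alpha> + \<beta> = s1" "\<alpha> * \<beta> = - (1 + s1) / real CARD('n)"
  shows "{x \<bullet> y | x y. x \<in> U \<and> y \<in> U \<and> x \<noteq> y} = {\<alpha>, \<beta>}"
proof -
  have root: "x \<bullet> y = \<alpha> \<or> x \<bullet> y = \<beta>" if "x \<in> U" "y \<in> U" "x \<noteq> y" for x y
  proof -
    have "(x \<bullet> y)\<^sup>2 - s1 * (x \<bullet> y) + \<alpha> * \<beta> = 0"
      using layer_quadratic_if_unmixed[OF \<sigma> that] \<alpha>\<beta>(2)
      by (simp add: diff_divide_distrib add_divide_distrib)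
    then have "(x \<bullet> y - \<alpha>) * (x \<bullet> y - \<beta>) = 0" unfolding \<alpha>\<beta>(1)[symmetric] by algebra
    then show ?thesis by auto
  qed
  obtain x0 y0 x1 y1 where xy: "x0 \<in> U" "y0 \<in> U" "x0 \<noteq> y0" "x1 \<in> U" "y1 \<in> U" "x1 \<noteq> y1"
    "x0 \<bullet> y0 > x1 \<bullet> y1" using two_values_if_unmixed[OF \<sigma>] .
  have "{\<alpha>, \<beta>} = {x0 \<bullet> y0, x1 \<bullet> y1}" using root[OF xy(1-3)] root[OF xy(4-6)] xy(7) by auto
  then show ?thesis using root xy by blast
qed

text \<open>With \<open>k = (1 - b) / (a - b)\<close> one has
  \<open>(2 * k - 1) * (a - b) = 2 - s1\<close>, and \<open>(a - b)\<^sup>2\<close> is the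
  discriminant of the quadratic. The bound on \<open>k\<close> comes from
  \<open>a < 1\<close>.\<close>

lemma integral_ratio_if_unmixed:
  assumes \<sigma>: "\<sigma> = 0"
  obtains k :: int where "k \<ge> 2"
    "(2 * real_of_int k - 1)\<^sup>2 * (s1\<^sup>2 + 4 * (1 + s1) / real CARD('n)) = (2 - s1)\<^sup>2"
proof -
  obtain x0 y0 x1 y1 where xy: "x0 \<in> U" "y0 \<in> U" "x0 \<noteq> y0" "x1 \<in> U" "y1 \<in> U" "x1 \<noteq> y1"
    "x0 \<bullet> y0 > x1 \<bullet> y1" using two_values_if_unmixed[OF \<sigma>] .
  define a where "a = x0 \<bullet> y0"
  define b where "b = x1 \<bullet> y1"
  have ab: "a > b" "a + b = s1" "a * b = - (1 + s1) / real CARD('n)"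
    using vieta_if_unmixed[OF \<sigma> xy] xy(7) by (auto simp: a_def b_def)
  have "{x \<bullet> y | x y. x \<in> U \<and> y \<in> U \<and> x \<noteq> y} = {a, b}" by (rule value_set_if_unmixed[OF \<sigma> ab(2,3)])
  then have val: "x \<bullet> y = a \<or> x \<bullet> y = b" if "x \<in> U" "y \<in> U" "x \<noteq> y" for x y using that by blast
  have rat: "a \<in> \<rat>" "b \<in> \<rat>" using inner_rational_if_unmixed[OF \<sigma>] xy by (auto simp: a_def b_def)
  have "(1 - b) / (a - b) \<in> \<int>"
    using eigenvalue_integral[OF fin(1) unit(1) U1 U2 val, of x0 y0 x1 y1] xy ab rat by (auto simp: a_def b_def)
  then obtain k :: int where k: "(1 - b) / (a - b) = real_of_int k" by (elim Ints_cases)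
  have "a \<le> 1" using norm_cauchy_schwarz[of x0 y0] unit xy by (simp add: a_def norm_eq_sqrt_inner)
  moreover have "a \<noteq> 1" using unit_inner_eq_1D[of x0 y0] unit xy by (auto simp: a_def)
  ultimately have a1: "a < 1" by simp
  have "real_of_int k > 1" unfolding k[symmetric] using ab(1) a1 by (simp add: less_divide_eq)
  then have "k \<ge> 2" by linarith
  moreover have "(2 * real_of_int k - 1)\<^sup>2 * (s1\<^sup>2 + 4 * (1 + s1) / real CARD('n)) = (2 - s1)\<^sup>2"
  proof -
    have kab: "real_of_int k * (a - b) = 1 - b" using k ab(1) by (simp add: field_simps)
    have "(2 * real_of_int k - 1) * (a - b) = 2 * (real_of_int k * (a - b)) - (a - b)" by algebra
    also have "\<dots> = 2 - s1" unfolding kab ab(2)[symmetric] by simp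
    finally have 1: "(2 * real_of_int k - 1) * (a - b) = 2 - s1" .
    have "s1\<^sup>2 + 4 * (1 + s1) / real CARD('n) = (a - b)\<^sup>2"
    proof -
      have "4 * (1 + s1) / real CARD('n) = - 4 * (a * b)" unfolding ab(3) by (simp add: minus_divide_left)
      then show ?thesis unfolding ab(2)[symmetric] by (simp add: power2_eq_square algebra_simps)
    qed
    then show ?thesis unfolding 1[symmetric] by (simp add: power_mult_distrib)
  qed
  ultimately show thesis using that by blast
qed

end

text \<open>With \<open>p = 2 S - 1\<close> and \<open>q = 2 T - 1\<close> we have \<open>p + q = n\<close>, and the hypothesis on \<open>k\<close> says
  \<open>m (q\<^sup>2 + n - 1) = n (q + 2)\<^sup>2\<close> for the odd square \<open>m = (2 k - 1)\<^sup>2\<close>. On \<open>n/2 \<le> q < n + 1\<close> this forces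
  \<open>n + 3 < m \<le> n + 4 + 4/(n - 1)\<close>, which pins down \<open>m\<close>.\<close>

lemma odd_square_parameter:
  fixes n :: nat and S T :: real and k :: int
  assumes n: "n \<ge> 2" and S: "S > 0" and ST: "S + T = (n + 2) / 2" "S \<le> T" and k: "k \<ge> 2"
    and eq: "(2 * real_of_int k - 1)\<^sup>2 * ((- 1 / T)\<^sup>2 + 4 * (1 + - 1 / T) / n) = (2 - - 1 / T)\<^sup>2"
  shows "n = 2 \<or> (n = 4 \<and> T = 8 / 5) \<or>
    (real n = (2 * real_of_int k - 1)\<^sup>2 - 4 \<and> T = (2 * real_of_int k ^ 2 - real_of_int k - 1) / 2)"
proof -
  have T: "T > 0" using S ST by linarith
  define m where "m = (2 * k - 1)\<^sup>2"
  define q where "q = 2 * T - 1"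
  have mr: "real_of_int m = (2 * real_of_int k - 1)\<^sup>2" by (simp add: m_def)
  have n0: "real n > 0" using n by simp
  have Tq: "T = (q + 1) / 2" by (simp add: q_def)
  have main: "real_of_int m * (q\<^sup>2 + n - 1) = n * (q + 2)\<^sup>2"
  proof -
    have e1: "T\<^sup>2 * n * (real_of_int m * ((- 1 / T)\<^sup>2 + 4 * (1 + - 1 / T) / n)) = T\<^sup>2 * n * (2 - - 1 / T)\<^sup>2"
      using eq by (simp add: mr)
    have e2: "T\<^sup>2 * n * (real_of_int m * ((- 1 / T)\<^sup>2 + 4 * (1 + - 1 / T) / n)) = real_of_int m * (n + 4 * (T\<^sup>2 - T))"
      using T n0 by (simp add: field_simps power2_eq_square)
    have e3: "T\<^sup>2 * n * (2 - - 1 / T)\<^sup>2 = n * (2 * T + 1)\<^sup>2"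
      using T by (simp add: field_simps power2_eq_square)
    have "real_of_int m * (n + 4 * (T\<^sup>2 - T)) = n * (2 * T + 1)\<^sup>2"
      by (rule trans[OF e2[symmetric] trans[OF e1 e3]])
    then show ?thesis unfolding Tq by (simp add: field_simps power2_eq_square)
  qed
  have q_lo: "2 * q \<ge> n" and q_hi: "q < n + 1" using ST S by (auto simp: q_def field_simps)
  have qq: "q\<^sup>2 + n - 1 > 0"
  proof -
    have "real n \<ge> 2" using n by simp
    then show ?thesis using zero_le_power2[of q] by linarith
  qed
  have lower: "m \<ge> n + 4"
  proof -
    \<comment> \<open>For \<open>m = n + 3\<close> the difference of the two sides of
      \<open>main\<close> factors, and both factors are positive on the range of
      \<open>q\<close>.\<close>
    have "n * (q + 2)\<^sup>2 - (n + 3) * (q\<^sup>2 + n - 1) = (n + 1 - q) * (3 * q - n + 3)"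
      by (simp add: power2_eq_square algebra_simps)
    also have "\<dots> > 0" using q_lo q_hi n0 by (intro mult_pos_pos) auto
    finally have "(real n + 3) * (q\<^sup>2 + n - 1) < real_of_int m * (q\<^sup>2 + n - 1)" using main by simp
    then have "real n + 3 < real_of_int m" using qq by simp
    then show ?thesis by linarith
  qed
  have upper: "(int n - 1) * (m - n - 4) \<le> 4"
  proof -
    \<comment> \<open>The bound is \<open>m = n * (n + 3) / (n - 1)\<close>, which equals
      \<open>n + 4 + 4 / (n - 1)\<close>; for it the difference of the sides is a multiple of a
      square.\<close>
    have "(real n + 3) * (q\<^sup>2 + n - 1) - (n - 1) * (q + 2)\<^sup>2 = (2 * q - n + 1)\<^sup>2"
      using n by (simp add: power2_eq_square algebra_simps of_nat_diff)
    then have "(n - 1) * (q + 2)\<^sup>2 \<le> (real n + 3) * (q\<^sup>2 + n - 1)" by (smt (verit) zero_le_power2)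
    then have "n * ((n - 1) * (q + 2)\<^sup>2) \<le> n * ((real n + 3) * (q\<^sup>2 + n - 1))" using n0 by simp
    moreover have "(real (n - 1) * m) * (q\<^sup>2 + n - 1) = n * ((n - 1) * (q + 2)\<^sup>2)"
      using arg_cong[OF main, of "(*) (real (n - 1))"] by (simp only: mult_ac)
    ultimately have "(real (n - 1) * m) * (q\<^sup>2 + n - 1) \<le> (n * (real n + 3)) * (q\<^sup>2 + n - 1)"
      by (simp only: mult.assoc)
    then have "real (n - 1) * m \<le> n * (real n + 3)" using qq by simp
    then have "real_of_int ((int n - 1) * m) \<le> real_of_int (int n * (int n + 3))" using n by (simp add: of_nat_diff)
    then have "(int n - 1) * m \<le> int n * (int n + 3)" by (simp only: of_int_le_iff)
    then show ?thesis by (simp add: algebra_simps)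
  qed
  have m_small: "m = 9 \<or> m \<ge> 25"
  proof (cases "k = 2")
    case False
    then have "2 * k - 1 \<ge> 5" using k by simp
    then have "(2 * k - 1)\<^sup>2 \<ge> 5\<^sup>2" by (intro power_mono) auto
    then show ?thesis by (simp add: m_def)
  qed (simp add: m_def)
  consider "n = 2" | "n = 3" | "n = 4" | "n \<ge> 5" using n by linarith
  then show ?thesis
  proof cases
    case 2
    then have "m = 9" using m_small upper by simp
    then have "(q - 1)\<^sup>2 = 0" using main 2 by (simp add: power2_eq_square algebra_simps)
    then show ?thesis using q_lo 2 by simp
  next
    case 3
    then have "m = 9" using m_small upper by simp
    then have "(5 * q - 11) * (q - 1) = 0" using main 3 by (simp add: power2_eq_square algebra_simps)
    then have "5 * q = 11" using q_lo 3 by auto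
    then show ?thesis using 3 by (simp add: Tq)
  next
    case 4
    \<comment> \<open>The bounds allow one other pair, \<open>n = 5\<close> and
      \<open>m = 10\<close>, which is not an odd square.\<close>
    have "m = int n + 4"
    proof (rule ccontr)
      assume "m \<noteq> int n + 4"
      then have ge: "m - n - 4 \<ge> 1" using lower by simp
      have "4 * (m - n - 4) \<le> (int n - 1) * (m - n - 4)" using 4 ge by (intro mult_right_mono) auto
      then have "4 * (m - n - 4) \<le> 4" using upper by (rule order_trans)
      then have "m - n - 4 = 1" using ge by simp
      moreover from this have "n = 5" using upper 4 by simp
      ultimately show False using m_small by simp
    qed
    then have nm: "real_of_int m = n + 4" by simp
    \<comment> \<open>For \<open>m = n + 4\<close> the equation \<open>main\<close> becomes a
      perfect square equal to \<open>m\<close>; \<open>q \<ge> n / 2\<close> selects the positive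
      root.\<close>
    have "(2 * q - n)\<^sup>2 = (2 * real_of_int k - 1)\<^sup>2"
      using main unfolding mr[symmetric] nm by (simp add: power2_eq_square algebra_simps)
    moreover have "2 * q - n \<ge> 0" "2 * real_of_int k - 1 \<ge> 0" using q_lo k by auto
    ultimately have q: "2 * q - n = 2 * real_of_int k - 1" by (simp add: power2_eq_iff_nonneg)
    have n': "real n = (2 * real_of_int k - 1)\<^sup>2 - 4" using nm mr by simp
    have "T = (n + 2 * real_of_int k + 1) / 4" using q by (simp add: q_def field_simps)
    also have "\<dots> = (2 * real_of_int k ^ 2 - real_of_int k - 1) / 2" unfolding n' by (simp add: power2_eq_square field_simps)
    finally show ?thesis using n' by blast
  qed blast
qed

context kernel_pair
begin

interpretation S: kernel_pair V U c2 c1 d2 d1 \<sigma> s2 g2 s1 g1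
  by (rule kernel_pair_swap) unfold_locales

text \<open>\<open>odd_square_parameter\<close> is applied to \<open>V\<close>, the larger layer;
  the total number of points then yields \<open>U\<close>, and the weights follow from
  \<open>d1 * g1 = d2 * g2\<close>.\<close>

lemma parameters_if_unmixed:
  assumes \<sigma>: "\<sigma> = 0" and le: "card U \<le> card V"
  shows "(CARD('n) = 2 \<and> card U = 4 \<and> card V = 4) \<or>
    (\<exists>k::nat. k \<ge> 2 \<and> int CARD('n) = (2 * int k - 1)\<^sup>2 - 4 \<and>
      int (card U) = 2 * (2 * int k + 1) * (int k - 1) ^ 3 \<and> int (card V) = 2 * int k ^ 3 * (2 * int k - 3) \<and>
      s1 = - 2 / (real k * (2 * real k - 3)) \<and> s2 = - 2 / ((real k - 1) * (2 * real k + 1)) \<and>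
      d2 / d1 = (2 * real k + 1)\<^sup>2 * (real k - 1) ^ 4 / ((2 * real k - 3)\<^sup>2 * real k ^ 4))"
proof -
  let ?n = "real CARD('n)"
  \<comment> \<open>\<open>A\<close> and \<open>B\<close> are \<open>- 1 / s1\<close> and
    \<open>- 1 / s2\<close>. They become the \<open>S\<close> and \<open>T\<close> of
    \<open>odd_square_parameter\<close>.\<close>
  define A where "A = (N - ?n - 1) / (?n - 1)"
  define B where "B = (M - ?n - 1) / (?n - 1)"
  have n1: "?n - 1 > 0" using n_ge_2 by simp
  have A: "A > 0" "s1 = - 1 / A" using unmixed_layer(5,6)[OF \<sigma>] n1 by (auto simp: A_def minus_divide_left)
  have B: "B > 0" "s2 = - 1 / B" using S.unmixed_layer(5,6)[OF \<sigma>] n1 by (auto simp: B_def minus_divide_left)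
  have AB: "A + B = (?n + 2) / 2"
  proof -
    have "A + B = (N + M - 2 - 2 * ?n) / (?n - 1)" by (simp add: A_def B_def add_divide_distrib[symmetric])
    also have "\<dots> = (?n + 2) / 2"
    proof -
      have "(m * t / 2) / m = t / 2" if "m > 0" for m t :: real using that by simp
      then show ?thesis using n1 unfolding card_sum_if_unmixed[OF \<sigma>] by blast
    qed
    finally show ?thesis .
  qed
  have leAB: "A \<le> B" using le n1 by (simp add: A_def B_def divide_right_mono)
  have NA: "N = ?n + 1 + (?n - 1) * A" "M = ?n + 1 + (?n - 1) * B" using n1 by (auto simp: A_def B_def)
  obtain k :: int where k: "k \<ge> 2" "(2 * real_of_int k - 1)\<^sup>2 * (s2\<^sup>2 + 4 * (1 + s2) / ?n) = (2 - s2)\<^sup>2"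
    using S.integral_ratio_if_unmixed[OF \<sigma>] .
  have "CARD('n) = 2 \<or> (CARD('n) = 4 \<and> B = 8 / 5) \<or>
    (?n = (2 * real_of_int k - 1)\<^sup>2 - 4 \<and> B = (2 * real_of_int k ^ 2 - real_of_int k - 1) / 2)"
    by (rule odd_square_parameter[OF n2 A(1) _ leAB k(1)]) (use AB k(2) B(2) in simp_all)
  then consider "CARD('n) = 2" | "CARD('n) = 4" "B = 8 / 5"
    | "?n = (2 * real_of_int k - 1)\<^sup>2 - 4" "B = (2 * real_of_int k ^ 2 - real_of_int k - 1) / 2" by blast
  then show ?thesis
  proof cases
    case 1
    \<comment> \<open>For \<open>n = 2\<close> the numbers of points exceed 3 and add up to 8, so
      both are 4.\<close>
    have "N > 3" "M > 3" "N + M = 8" using NA A(1) B(1) AB 1 by auto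
    then have "card U > 3" "card V > 3" "card U + card V = 8" by linarith+
    then show ?thesis using 1 by simp
  next
    case 2
    \<comment> \<open>The exceptional solution for \<open>n = 4\<close> dies because the number of
      points would not be an integer.\<close>
    then have "5 * M = 49" using NA by simp
    then have "5 * card V = 49" by linarith
    then show ?thesis by presburger
  next
    case 3
    define h where "h = nat k"
    have h: "h \<ge> 2" "real_of_int k = real h" "int h = k" using k(1) by (auto simp: h_def)
    let ?h = "real h"
    have h2: "?h \<ge> 2" using h by simp
    have n: "?n = (2 * ?h - 1)\<^sup>2 - 4" and Bh: "B = (?h - 1) * (2 * ?h + 1) / 2"
      using 3 unfolding h(2) by (auto simp: power2_eq_square algebra_simps)
    have Ah: "A = ?h * (2 * ?h - 3) / 2"
      using AB unfolding Bh n by (simp add: power2_eq_square field_simps)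
    have Nh: "N = 2 * (2 * ?h + 1) * (?h - 1) ^ 3" unfolding NA(1) Ah n by algebra
    have Mh: "M = 2 * ?h ^ 3 * (2 * ?h - 3)" unfolding NA(2) Bh n by algebra
    have "real_of_int (int CARD('n)) = real_of_int ((2 * int h - 1)\<^sup>2 - 4)" using n by simp
    then have 1: "int CARD('n) = (2 * int h - 1)\<^sup>2 - 4" by (simp only: of_int_eq_iff)
    have "real_of_int (int (card U)) = real_of_int (2 * (2 * int h + 1) * (int h - 1) ^ 3)" using Nh by simp
    then have 2: "int (card U) = 2 * (2 * int h + 1) * (int h - 1) ^ 3" by (simp only: of_int_eq_iff)
    have "real_of_int (int (card V)) = real_of_int (2 * int h ^ 3 * (2 * int h - 3))" using Mh by simp
    then have 3: "int (card V) = 2 * int h ^ 3 * (2 * int h - 3)" by (simp only: of_int_eq_iff)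
    have s: "s1 = - 2 / (?h * (2 * ?h - 3))" "s2 = - 2 / ((?h - 1) * (2 * ?h + 1))"
      using A(2) B(2) unfolding Ah Bh by auto
    have g: "g1 = - s1 * N / ?n" "g2 = - s2 * M / ?n" using unmixed_layer(1)[OF \<sigma>] S.unmixed_layer(1)[OF \<sigma>] by auto
    have pos': "?h > 0" "2 * ?h - 3 > 0" "?h - 1 > 0" "2 * ?h + 1 > 0" using h2 by auto
    have "d2 / d1 = g1 / g2"
      using weight_ratio_if_unmixed[OF \<sigma>] pos S.unmixed_layer(3)[OF \<sigma>] by (simp add: field_simps)
    also have "\<dots> = (s1 * N) / (s2 * M)" unfolding g using n_ge_2 by simp
    also have "\<dots> = (N / (?h * (2 * ?h - 3))) / (M / ((?h - 1) * (2 * ?h + 1)))" unfolding s by simp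
    also have "\<dots> = (2 * ?h + 1)\<^sup>2 * (?h - 1) ^ 4 / ((2 * ?h - 3)\<^sup>2 * ?h ^ 4)"
    proof -
      have "(2 * q * b ^ 3 / (x * y)) / (2 * x ^ 3 * y / (b * q)) = q\<^sup>2 * b ^ 4 / (y\<^sup>2 * x ^ 4)"
        if "x > 0" "y > 0" "b > 0" "q > 0" for x y b q :: real
        using that by (simp add: field_simps eval_nat_numeral)
      from this[OF pos'] show ?thesis unfolding Nh Mh .
    qed
    finally show ?thesis using h(1) 1 2 3 s by blast
  qed
qed

lemma k_family_value_sets:
  fixes k :: nat
  assumes \<sigma>: "\<sigma> = 0" and k: "k \<ge> 2" and n: "int CARD('n) = (2 * int k - 1)\<^sup>2 - 4"
    and s: "s1 = - 2 / (real k * (2 * real k - 3))" "s2 = - 2 / ((real k - 1) * (2 * real k + 1))"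
  shows "{x \<bullet> y | x y. x \<in> U \<and> y \<in> U \<and> x \<noteq> y} = {(real k - 2) / (real k * (2 * real k - 3)), - (1 / (2 * real k - 3))}"
    and "{x \<bullet> y | x y. x \<in> V \<and> y \<in> V \<and> x \<noteq> y} = {1 / (2 * real k + 1), - ((real k + 1) / ((real k - 1) * (2 * real k + 1)))}"
proof -
  have "real_of_int (int CARD('n)) = real_of_int ((2 * int k - 1)\<^sup>2 - 4)" using n by (simp only:)
  then have n': "real CARD('n) = (2 * real k - 3) * (2 * real k + 1)" by (simp add: power2_eq_square algebra_simps)
  have pos': "real k > 0" "2 * real k - 3 > 0" "real k - 1 > 0" "2 * real k + 1 > 0" using k by auto
  show "{x \<bullet> y | x y. x \<in> U \<and> y \<in> U \<and> x \<noteq> y} = {(real k - 2) / (real k * (2 * real k - 3)), - (1 / (2 * real k - 3))}"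
  proof (rule value_set_if_unmixed[OF \<sigma>])
    show "(real k - 2) / (real k * (2 * real k - 3)) + - (1 / (2 * real k - 3)) = s1"
      unfolding s using pos' by (simp add: divide_simps)
    show "(real k - 2) / (real k * (2 * real k - 3)) * - (1 / (2 * real k - 3)) = - (1 + s1) / real CARD('n)"
      unfolding s n' using pos' by (simp add: divide_simps) algebra
  qed
  show "{x \<bullet> y | x y. x \<in> V \<and> y \<in> V \<and> x \<noteq> y} = {1 / (2 * real k + 1), - ((real k + 1) / ((real k - 1) * (2 * real k + 1)))}"
  proof (rule S.value_set_if_unmixed[OF \<sigma>])
    show "1 / (2 * real k + 1) + - ((real k + 1) / ((real k - 1) * (2 * real k + 1))) = s2"
      unfolding s using pos' by (simp add: divide_simps)
    show "1 / (2 * real k + 1) * - ((real k + 1) / ((real k - 1) * (2 * real k + 1))) = - (1 + s2) / real CARD('n)"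
      unfolding s n' using pos' by (simp add: divide_simps) algebra
  qed
qed

end

section \<open>Coherent configurations\<close>

lemma layer_relations_cases:
  assumes "R \<in> layer_relations I r X"
  obtains (Diag) l where "l \<in> I" "R = Id_on (X l)"
  | (Rel) l m \<alpha> where "l \<in> I" "m \<in> I" "\<alpha> \<in> inner_values (r l) (r m) (X l) (X m)"
      "R = {(x, y) \<in> X l \<times> X m. x \<noteq> y \<and> x \<bullet> y = r l * r m * \<alpha>}"
  using assms unfolding layer_relations_def by blast

context
  fixes I :: "nat set" and X :: "nat \<Rightarrow> (real^'n) set" and r :: "nat \<Rightarrow> real" and \<kappa> :: "nat \<Rightarrow> real"
  assumes finI: "finite I" and fin: "\<And>l. l \<in> I \<Longrightarrow> finite (X l)" and ne: "\<And>l. l \<in> I \<Longrightarrow> X l \<noteq> {}"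
    and r: "\<And>l. l \<in> I \<Longrightarrow> r l > 0" and sph: "\<And>l x. l \<in> I \<Longrightarrow> x \<in> X l \<Longrightarrow> x \<bullet> x = r l * r l"
    and disj: "\<And>l m x. l \<in> I \<Longrightarrow> m \<in> I \<Longrightarrow> x \<in> X l \<Longrightarrow> x \<in> X m \<Longrightarrow> l = m"
    and lin: "\<And>l a. l \<in> I \<Longrightarrow> (\<Sum>z\<in>X l. a \<bullet> z) = 0"
    and quad: "\<And>l a b. l \<in> I \<Longrightarrow> (\<Sum>z\<in>X l. (a \<bullet> z) * (b \<bullet> z)) = \<kappa> l * (a \<bullet> b)"
    and two: "\<And>l m. l \<in> I \<Longrightarrow> m \<in> I \<Longrightarrow> card (inner_values (r l) (r m) (X l) (X m)) \<le> 2"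
begin

lemma inner_valuesI:
  assumes "l \<in> I" "m \<in> I" "x \<in> X l" "y \<in> X m" "x \<noteq> y"
  obtains \<alpha> where "\<alpha> \<in> inner_values (r l) (r m) (X l) (X m)" "x \<bullet> y = r l * r m * \<alpha>"
proof
  show "(x \<bullet> y) / (r l * r m) \<in> inner_values (r l) (r m) (X l) (X m)"
    using assms unfolding inner_values_def by blast
  show "x \<bullet> y = r l * r m * ((x \<bullet> y) / (r l * r m))" using r[OF assms(1)] r[OF assms(2)] by simp
qed

lemma finite_inner_values:
  assumes "l \<in> I" "m \<in> I"
  shows "finite (inner_values (r l) (r m) (X l) (X m))"
proof (rule finite_subset)
  show "inner_values (r l) (r m) (X l) (X m) \<subseteq> (\<lambda>(x, y). (x \<bullet> y) / (r l * r m)) ` (X l \<times> X m)"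
    unfolding inner_values_def by force
qed (use fin assms in auto)

lemma layer_relation_affine:
  assumes "R \<in> layer_relations I r X"
  shows "\<exists>l m p q c. l \<in> I \<and> m \<in> I \<and> R \<subseteq> X l \<times> X m \<and>
    (\<forall>x\<in>X l. \<forall>z\<in>X m. of_bool ((x, z) \<in> R) = p + q * (x \<bullet> z) - c * of_bool (x = z))"
  using assms
proof (cases rule: layer_relations_cases)
  case (Diag l)
  show ?thesis
    \<comment> \<open>The diagonal is pure correction: \<open>p = q = 0\<close> and
      \<open>c = -1\<close>.\<close>
    by (rule exI[of _ l], rule exI[of _ l], rule exI[of _ 0], rule exI[of _ 0], rule exI[of _ "-1"])
      (use Diag in auto)
next
  case (Rel l m \<alpha>)
  let ?A = "inner_values (r l) (r m) (X l) (X m)"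
  have rr: "r l * r m > 0" using r Rel by simp
  \<comment> \<open>\<open>\<beta>\<close> is the other inner product between the two layers; if
    there is none, any number other than \<open>\<alpha>\<close> serves.\<close>
  have "\<exists>\<beta>. \<beta> \<noteq> \<alpha> \<and> ?A \<subseteq> {\<alpha>, \<beta>}"
  proof (cases "?A = {\<alpha>}")
    case True
    then show ?thesis by (intro exI[of _ "\<alpha> + 1"]) auto
  next
    case False
    then obtain \<beta> where \<beta>: "\<beta> \<in> ?A" "\<beta> \<noteq> \<alpha>" using Rel(3) by blast
    then have "card {\<alpha>, \<beta>} = 2" "{\<alpha>, \<beta>} \<subseteq> ?A" using Rel(3) by auto
    then have "{\<alpha>, \<beta>} = ?A"
      using two[OF Rel(1,2)] finite_inner_values[OF Rel(1,2)] by (intro card_seteq) auto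
    then show ?thesis using \<beta> by blast
  qed
  then obtain \<beta> where \<beta>: "\<beta> \<noteq> \<alpha>" "?A \<subseteq> {\<alpha>, \<beta>}" by blast
  \<comment> \<open>Linear interpolation, 1 at \<open>\<alpha>\<close> and 0 at
    \<open>\<beta>\<close>. For \<open>x = z\<close> the normalised product is 1, and the last term
    removes the value interpolated there.\<close>
  have eq: "of_bool ((x, z) \<in> R) = - \<beta> / (\<alpha> - \<beta>) + 1 / (r l * r m * (\<alpha> - \<beta>)) * (x \<bullet> z)
      - (1 - \<beta>) / (\<alpha> - \<beta>) * of_bool (x = z)" if x: "x \<in> X l" and z: "z \<in> X m" for x z
  proof (cases "x = z")
    case True
    have "m = l" using disj[OF Rel(1,2) x] z True by simp
    then have "x \<bullet> z = r l * r m" using sph[OF Rel(1) x] True by simp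
    moreover have "(x, z) \<notin> R" using True Rel(4) by simp
    ultimately show ?thesis
      using True \<beta>(1) r[OF Rel(1)] r[OF Rel(2)] by (simp add: diff_divide_distrib)
  next
    case False
    then obtain \<gamma> where g: "\<gamma> \<in> ?A" "x \<bullet> z = r l * r m * \<gamma>" using inner_valuesI[OF Rel(1,2) x z] by blast
    then have "\<gamma> = \<alpha> \<or> \<gamma> = \<beta>" using \<beta>(2) by auto
    moreover have "(x, z) \<in> R \<longleftrightarrow> \<gamma> = \<alpha>" using False g x z rr unfolding Rel(4) by auto
    ultimately show ?thesis using False \<beta>(1) g(2) rr by (auto simp: divide_simps)
  qed
  have "R \<subseteq> X l \<times> X m" using Rel(4) by auto
  with Rel(1,2) eq show ?thesis
    by - (rule exI[of _ l], rule exI[of _ m], rule exI[of _ "- \<beta> / (\<alpha> - \<beta>)"],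
        rule exI[of _ "1 / (r l * r m * (\<alpha> - \<beta>))"], rule exI[of _ "(1 - \<beta>) / (\<alpha> - \<beta>)"],
        intro conjI ballI)
qed

text \<open>The count in \<open>card_intermediate_points\<close> depends on the endpoints only
  through their layers, inner product and equality; these are fixed on a relation.\<close>

lemma layer_relation_constant:
  assumes "R \<in> layer_relations I r X"
  shows "\<exists>l m t e. l \<in> I \<and> m \<in> I \<and> R \<subseteq> X l \<times> X m \<and> (\<forall>(x, y)\<in>R. x \<bullet> y = t \<and> (x = y \<longleftrightarrow> e))"
  using assms
proof (cases rule: layer_relations_cases)
  case (Diag l)
  show ?thesis
    by (rule exI[of _ l], rule exI[of _ l], rule exI[of _ "r l * r l"], rule exI[of _ True])
      (use Diag sph[OF Diag(1)] in auto)
next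
  case (Rel l m \<alpha>)
  show ?thesis
    by (rule exI[of _ l], rule exI[of _ m], rule exI[of _ "r l * r m * \<alpha>"], rule exI[of _ False])
      (use Rel in auto)
qed

text \<open>The indicator of an intermediate point is a product of two affine functions, so only the
  moments of degree 0, 1 and 2 of the middle layer enter. A diagonal correction contributes only
  when its endpoint lies in the middle layer.\<close>

lemma card_intermediate_points:
  fixes p q c p' q' c' :: real
  assumes l: "l \<in> I" and v: "v \<in> I" and m: "m \<in> I" and R: "R \<subseteq> X l \<times> X v" and S: "S \<subseteq> X v \<times> X m"
    and \<chi>R: "\<And>x z. x \<in> X l \<Longrightarrow> z \<in> X v \<Longrightarrow> of_bool ((x, z) \<in> R) = p + q * (x \<bullet> z) - c * of_bool (x = z)"
    and \<chi>S: "\<And>x z. x \<in> X v \<Longrightarrow> z \<in> X m \<Longrightarrow> of_bool ((x, z) \<in> S) = p' + q' * (x \<bullet> z) - c' * of_bool (x = z)"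
    and x: "x \<in> X l" and y: "y \<in> X m"
  shows "real (card {z \<in> \<Union>(X ` I). (x, z) \<in> R \<and> (z, y) \<in> S}) = card (X v) * (p * p') + q * q' * \<kappa> v * (x \<bullet> y)
      - c * of_bool (l = v) * (p' + q' * (x \<bullet> y)) - c' * of_bool (m = v) * (p + q * (x \<bullet> y))
      + c * c' * of_bool (l = v) * of_bool (x = y)"
proof -
  have xv: "x \<in> X v \<longleftrightarrow> l = v" using disj[OF l v x] x by blast
  have yv: "y \<in> X v \<longleftrightarrow> m = v" using disj[OF m v y] y by blast
  have "{z \<in> \<Union>(X ` I). (x, z) \<in> R \<and> (z, y) \<in> S} = {z \<in> X v. (x, z) \<in> R \<and> (z, y) \<in> S}"
    using v R by auto
  then have "real (card {z \<in> \<Union>(X ` I). (x, z) \<in> R \<and> (z, y) \<in> S})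
      = (\<Sum>z\<in>X v. of_bool ((x, z) \<in> R \<and> (z, y) \<in> S))"
    using fin[OF v] by (simp add: of_bool_def sum.If_cases Int_def)
  also have "\<dots> = (\<Sum>z\<in>X v. of_bool ((x, z) \<in> R) * of_bool ((z, y) \<in> S))"
    by (intro sum.cong refl) simp
  also have "\<dots> = (\<Sum>z\<in>X v. (p + q * (x \<bullet> z) - c * of_bool (x = z)) * (p' + q' * (z \<bullet> y) - c' * of_bool (z = y)))"
    using x y by (intro sum.cong refl) (simp only: \<chi>R \<chi>S)
  also have "\<dots> = (\<Sum>z\<in>X v. p * p' + p * q' * (y \<bullet> z) + q * p' * (x \<bullet> z) + q * q' * ((x \<bullet> z) * (y \<bullet> z))
      - (if z = x then c * (p' + q' * (x \<bullet> y)) else 0) - (if z = y then c' * (p + q * (x \<bullet> y)) else 0)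
      + (if z = x then c * c' * of_bool (x = y) else 0))"
    by (intro sum.cong refl) (auto simp: algebra_simps inner_commute)
  also have "\<dots> = card (X v) * (p * p') + p * q' * 0 + q * p' * 0 + q * q' * (\<kappa> v * (x \<bullet> y))
      - c * of_bool (l = v) * (p' + q' * (x \<bullet> y)) - c' * of_bool (m = v) * (p + q * (x \<bullet> y))
      + c * c' * of_bool (l = v) * of_bool (x = y)"
    using fin[OF v]
    by (simp only: sum_subtractf sum.distrib sum_distrib_left[symmetric] lin[OF v] quad[OF v])
      (simp add: xv yv of_bool_def)
  finally show ?thesis by simp
qed

lemma coherent_layer_relations:
  "coherent_configuration (\<Union>(X ` I)) (layer_relations I r X)"
  unfolding coherent_configuration_def
proof (intro conjI ballI)
  let ?R = "layer_relations I r X" and ?X = "\<Union>(X ` I)"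
  show "finite ?X" using finI fin by auto
  show "partition_on (?X \<times> ?X) ?R"
  proof (rule partition_onI)
    show "\<Union>?R = ?X \<times> ?X"
    proof (intro equalityI subsetI)
      fix xy assume "xy \<in> \<Union>?R"
      then obtain R where R: "R \<in> ?R" "xy \<in> R" by blast
      then show "xy \<in> ?X \<times> ?X" using layer_relation_constant[OF R(1)] by blast
    next
      fix xy assume "xy \<in> ?X \<times> ?X"
      then obtain x y l m where xy: "xy = (x, y)" "l \<in> I" "m \<in> I" "x \<in> X l" "y \<in> X m" by blast
      show "xy \<in> \<Union>?R"
      proof (cases "x = y")
        case True
        then have "xy \<in> Id_on (X l)" using xy by (auto simp: Id_on_iff)
        then show ?thesis using xy(2) unfolding layer_relations_def by blast
      next
        case False
        then obtain \<alpha> where "\<alpha> \<in> inner_values (r l) (r m) (X l) (X m)" "x \<bullet> y = r l * r m * \<alpha>"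
          using inner_valuesI[OF xy(2-5)] by blast
        then show ?thesis using xy False unfolding layer_relations_def by blast
      qed
    qed
    show "disjnt R S" if R: "R \<in> ?R" and S: "S \<in> ?R" and RS: "R \<noteq> S" for R S
    proof (rule ccontr)
      assume "\<not> disjnt R S"
      then obtain x y where xy: "(x, y) \<in> R" "(x, y) \<in> S" by (auto simp: disjnt_def)
      have "R = S"
        using R
      proof (cases rule: layer_relations_cases)
        case RD: (Diag l)
        show ?thesis
          using S
        proof (cases rule: layer_relations_cases)
          case (Diag m)
          then show ?thesis using RD xy disj[OF RD(1) Diag(1), of x] by auto
        next
          case (Rel m k \<alpha>)
          then show ?thesis using RD xy by auto
        qed
      next
        case RR: (Rel l m \<alpha>)
        show ?thesis
          using S
        proof (cases rule: layer_relations_cases)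
          case (Diag k)
          then show ?thesis using RR xy by auto
        next
          case (Rel l' m' \<beta>)
          have x: "x \<in> X l" "x \<in> X l'" and y: "y \<in> X m" "y \<in> X m'" and ip: "r l * r m * \<alpha> = r l' * r m' * \<beta>"
            using xy unfolding RR(4) Rel(4) by auto
          have lm: "l' = l" "m' = m" using disj[OF Rel(1) RR(1) x(2,1)] disj[OF Rel(2) RR(2) y(2,1)] by auto
          have "\<alpha> = \<beta>" using ip r[OF RR(1)] r[OF RR(2)] unfolding lm by simp
          then show ?thesis unfolding RR(4) Rel(4) lm by simp
        qed
      qed
      then show False using RS by simp
    qed
    show "{} \<notin> ?R"
    proof
      assume "{} \<in> ?R"
      then show False
      proof (cases rule: layer_relations_cases)
        case (Diag l)
        then show ?thesis using ne by (metis Id_onI emptyE equals0I)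
      next
        case (Rel l m \<alpha>)
        then obtain x y where "x \<in> X l" "y \<in> X m" "x \<noteq> y" "\<alpha> = (x \<bullet> y) / (r l * r m)"
          unfolding inner_values_def by blast
        then have "(x, y) \<in> {(x, y) \<in> X l \<times> X m. x \<noteq> y \<and> x \<bullet> y = r l * r m * \<alpha>}"
          using r[OF Rel(1)] r[OF Rel(2)] by simp
        then show ?thesis unfolding Rel(4)[symmetric] by simp
      qed
    qed
  qed
  show "\<exists>\<D>\<subseteq>?R. Id_on ?X = \<Union>\<D>"
  proof (intro exI[of _ "(\<lambda>l. Id_on (X l)) ` I"] conjI)
    show "(\<lambda>l. Id_on (X l)) ` I \<subseteq> ?R" unfolding layer_relations_def by blast
    show "Id_on ?X = \<Union>((\<lambda>l. Id_on (X l)) ` I)" by (auto simp: Id_on_def)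
  qed
  show "R\<inverse> \<in> ?R" if "R \<in> ?R" for R
    using that
  proof (cases rule: layer_relations_cases)
    case (Diag l)
    then show ?thesis unfolding layer_relations_def by (auto simp: converse_Id_on)
  next
    case (Rel l m \<alpha>)
    have "R\<inverse> = {(x, y) \<in> X m \<times> X l. x \<noteq> y \<and> x \<bullet> y = r m * r l * \<alpha>}"
      unfolding Rel(4) by (auto simp: inner_commute mult_ac)
    moreover have "\<alpha> \<in> inner_values (r m) (r l) (X m) (X l)"
      using Rel(3) unfolding inner_values_def by (force simp: inner_commute mult_ac)
    ultimately show ?thesis using Rel(1,2) unfolding layer_relations_def by blast
  qed
  fix R S T assume RST: "R \<in> ?R" "S \<in> ?R" "T \<in> ?R"
  obtain l v p q c where R: "l \<in> I" "v \<in> I" "R \<subseteq> X l \<times> X v"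
    "\<And>x z. x \<in> X l \<Longrightarrow> z \<in> X v \<Longrightarrow> of_bool ((x, z) \<in> R) = p + q * (x \<bullet> z) - c * of_bool (x = z)"
    using layer_relation_affine[OF RST(1)] by metis
  obtain v' m p' q' c' where S: "v' \<in> I" "m \<in> I" "S \<subseteq> X v' \<times> X m"
    "\<And>x z. x \<in> X v' \<Longrightarrow> z \<in> X m \<Longrightarrow> of_bool ((x, z) \<in> S) = p' + q' * (x \<bullet> z) - c' * of_bool (x = z)"
    using layer_relation_affine[OF RST(2)] by metis
  obtain l' m' t e where T': "l' \<in> I" "m' \<in> I" "T \<subseteq> X l' \<times> X m'" "\<forall>(x, y)\<in>T. x \<bullet> y = t \<and> (x = y \<longleftrightarrow> e)"
    using layer_relation_constant[OF RST(3)] by (elim exE conjE)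
  then have T: "l' \<in> I" "m' \<in> I" "T \<subseteq> X l' \<times> X m'" "\<And>x y. (x, y) \<in> T \<Longrightarrow> x \<bullet> y = t"
    "\<And>x y. (x, y) \<in> T \<Longrightarrow> (x = y \<longleftrightarrow> e)"
    by auto
  show "\<exists>p. \<forall>(x, y)\<in>T. card {z \<in> ?X. (x, z) \<in> R \<and> (z, y) \<in> S} = p"
  proof (cases "v' = v \<and> l' = l \<and> m' = m")
    case False
    \<comment> \<open>When the layers of the three relations do not fit together, there are no
      intermediate points at all.\<close>
    have emp: "{z \<in> ?X. (x, z) \<in> R \<and> (z, y) \<in> S} = {}" if xy: "(x, y) \<in> T" for x y
    proof (rule ccontr)
      assume "{z \<in> ?X. (x, z) \<in> R \<and> (z, y) \<in> S} \<noteq> {}"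
      then obtain z where z: "(x, z) \<in> R" "(z, y) \<in> S" by blast
      have "v' = v" using z R(3) S(3) disj[OF S(1) R(2), of z] by blast
      moreover have "l' = l" using z xy R(3) T(3) disj[OF T(1) R(1), of x] by blast
      moreover have "m' = m" using z xy S(3) T(3) disj[OF T(2) S(2), of y] by blast
      ultimately show False using False by simp
    qed
    show ?thesis by (rule exI[of _ 0], clarify) (simp only: emp card.empty)
  next
    case True
    define F where "F = card (X v) * (p * p') + q * q' * \<kappa> v * t
      - c * of_bool (l = v) * (p' + q' * t) - c' * of_bool (m = v) * (p + q * t)
      + c * c' * of_bool (l = v) * of_bool e"
    have eq: "real (card {z \<in> ?X. (x, z) \<in> R \<and> (z, y) \<in> S}) = F" if xy: "(x, y) \<in> T" for x y
    proof -
      have mem: "x \<in> X l" "y \<in> X m" using xy T(3) True by auto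
      have S3: "S \<subseteq> X v \<times> X m" using S(3) True by simp
      have S4: "of_bool ((x, z) \<in> S) = p' + q' * (x \<bullet> z) - c' * of_bool (x = z)" if "x \<in> X v" "z \<in> X m" for x z
        using S(4) that True by simp
      show ?thesis
        using card_intermediate_points[OF R(1,2) S(2) R(3) S3 R(4) S4 mem] unfolding T(4)[OF xy] T(5)[OF xy] F_def .
    qed
    \<comment> \<open>\<open>F\<close> is a real expression while an intersection number is natural;
      the floor recovers it.\<close>
    have cnt: "card {z \<in> ?X. (x, z) \<in> R \<and> (z, y) \<in> S} = nat \<lfloor>F\<rfloor>" if "(x, y) \<in> T" for x y
      unfolding eq[OF that, symmetric] by simp
    show ?thesis by (rule exI[of _ "nat \<lfloor>F\<rfloor>"], clarify) (rule cnt)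
  qed
qed

end

section \<open>Polynomials of degree two on two spheres\<close>

text \<open>Stars and bars: the extra variable \<open>None\<close> absorbs the missing degree, so
  exponents of degree at most \<open>t\<close> become multisets of size exactly \<open>t\<close>
  over \<open>n + 1\<close> variables.\<close>

lemma card_exponents: "card (exponents t :: ('n::finite \<Rightarrow> nat) set) = (CARD('n) + t) choose t"
proof -
  define F :: "'n option multiset \<Rightarrow> 'n \<Rightarrow> nat" where "F Y i = count Y (Some i)" for Y i
  have size_eq: "size Y = count Y None + (\<Sum>i\<in>UNIV. F Y i)" for Y :: "'n option multiset"
  proof -
    have "size Y = (\<Sum>v\<in>UNIV. count Y v)"
      unfolding size_multiset_overloaded_eq by (intro sum.mono_neutral_left) (auto simp: not_in_iff)
    then show ?thesis by (simp add: UNIV_option_conv sum.reindex F_def)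
  qed
  have "bij_betw F (multisets_of_size UNIV t) (exponents t)"
  proof (rule bij_betw_imageI)
    show "inj_on F (multisets_of_size UNIV t)"
    proof (rule inj_onI)
      fix Y Z assume YZ: "Y \<in> multisets_of_size UNIV t" "Z \<in> multisets_of_size UNIV t" "F Y = F Z"
      then have "count Y None = count Z None"
        using size_eq[of Y] size_eq[of Z] by (simp add: multisets_of_size_def)
      moreover have "count Y (Some i) = count Z (Some i)" for i
        using fun_cong[OF YZ(3), of i] by (simp add: F_def)
      ultimately show "Y = Z" by (intro multiset_eqI) (metis option.exhaust)
    qed
    show "F ` multisets_of_size UNIV t = exponents t"
    proof (intro equalityI subsetI)
      fix \<alpha> assume "\<alpha> \<in> F ` multisets_of_size UNIV t"
      then show "\<alpha> \<in> exponents t" using size_eq by (auto simp: multisets_of_size_def)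
    next
      fix \<alpha> :: "'n \<Rightarrow> nat" assume \<alpha>: "\<alpha> \<in> exponents t"
      define Y where "Y = Abs_multiset (case_option (t - (\<Sum>i\<in>UNIV. \<alpha> i)) \<alpha>)"
      have "count Y = case_option (t - (\<Sum>i\<in>UNIV. \<alpha> i)) \<alpha>"
        unfolding Y_def by (rule count_Abs_multiset) simp
      then have "F Y = \<alpha>" "count Y None = t - (\<Sum>i\<in>UNIV. \<alpha> i)" by (auto simp: F_def)
      then have "size Y = t" using size_eq[of Y] \<alpha> by simp
      then show "\<alpha> \<in> F ` multisets_of_size UNIV t"
        using \<open>F Y = \<alpha>\<close> by (intro image_eqI[of _ _ Y]) (auto simp: multisets_of_size_def)
    qed
  qed
  then have "card (exponents t :: ('n \<Rightarrow> nat) set) = card (multisets_of_size (UNIV :: 'n option set) t)"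
    by (simp add: bij_betw_same_card)
  then show ?thesis by (simp add: card_multisets_of_size)
qed

definition exponent_at :: "'n \<Rightarrow> nat \<Rightarrow> 'n \<Rightarrow> nat" where
  "exponent_at i a = (\<lambda>k. if k = i then a else 0)"

lemma exponents_2_cases:
  fixes \<alpha> :: "'n::finite \<Rightarrow> nat"
  assumes "\<alpha> \<in> exponents 2"
  obtains (Single) i a where "a \<le> 2" "\<alpha> = exponent_at i a"
  | (Pair) i j where "i \<noteq> j" "\<alpha> = (\<lambda>k. exponent_at i 1 k + exponent_at j 1 k)"
proof -
  have tot: "\<alpha> i + (\<Sum>k\<in>UNIV - {i}. \<alpha> k) \<le> 2" for i
    using assms by (simp add: sum.remove[of UNIV i])
  show thesis
  proof (cases "\<exists>i j. i \<noteq> j \<and> \<alpha> i > 0 \<and> \<alpha> j > 0")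
    case True
    then obtain i j where ij: "i \<noteq> j" "\<alpha> i > 0" "\<alpha> j > 0" by blast
    have eq: "(\<Sum>k\<in>UNIV - {i}. \<alpha> k) = \<alpha> j + (\<Sum>k\<in>UNIV - {i} - {j}. \<alpha> k)"
      using ij by (intro sum.remove) auto
    have 1: "\<alpha> i = 1" "\<alpha> j = 1" "(\<Sum>k\<in>UNIV - {i} - {j}. \<alpha> k) = 0"
      using tot[of i] ij unfolding eq by linarith+
    have "\<forall>k\<in>UNIV - {i} - {j}. \<alpha> k = 0" using 1(3) by (subst (asm) sum_eq_0_iff) auto
    then have "\<alpha> k = 0" if "k \<noteq> i" "k \<noteq> j" for k using that by simp
    then have "\<alpha> = (\<lambda>k. exponent_at i 1 k + exponent_at j 1 k)" using 1 ij(1) by (auto simp: exponent_at_def)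
    then show thesis using Pair ij(1) by blast
  next
    case False
    show thesis
    proof (cases "\<exists>i. \<alpha> i > 0")
      case True
      then obtain i where i: "\<alpha> i > 0" by blast
      then have "\<alpha> k = 0" if "k \<noteq> i" for k using False that by (metis neq0_conv)
      then have "\<alpha> = exponent_at i (\<alpha> i)" by (auto simp: exponent_at_def fun_eq_iff)
      moreover have "\<alpha> i \<le> 2" using tot[of i] by simp
      ultimately show thesis using Single by blast
    next
      case False
      \<comment> \<open>The zero exponent is \<open>exponent_at i 0\<close> for every
        \<open>i\<close>, so the index is arbitrary.\<close>
      then have "\<alpha> = exponent_at undefined 0" by (auto simp: exponent_at_def)
      then show thesis using Single[of 0] by simp
    qed
  qed
qed

text \<open>The points \<open>r\<close> and \<open>- r\<close> kill the odd part; then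
  \<open>r\<^sup>2\<close> and \<open>s\<^sup>2\<close> are two distinct zeros of the even part,
  which is affine in \<open>t\<^sup>2\<close>.\<close>

lemma quadratic_poly_coeffs_zero:
  fixes a b c :: real
  assumes "\<And>t. t \<in> {r, - r, s, - s} \<Longrightarrow> a + b * t + c * t\<^sup>2 = 0" "r > 0" "s > 0" "r \<noteq> s"
  shows "a = 0 \<and> b = 0 \<and> c = 0"
proof -
  have 1: "a + b * r + c * r\<^sup>2 = 0" "a - b * r + c * r\<^sup>2 = 0" "a + b * s + c * s\<^sup>2 = 0"
    using assms(1)[of r] assms(1)[of "- r"] assms(1)[of s] by auto
  have "b * r = 0" using 1(1,2) by linarith
  then have b: "b = 0" using assms by simp
  have "c * (r\<^sup>2 - s\<^sup>2) = 0" using 1(1,3) unfolding b by algebra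
  moreover have "r\<^sup>2 \<noteq> s\<^sup>2" using assms by (simp add: power2_eq_iff)
  ultimately have "c = 0" by simp
  then show ?thesis using 1(1) b by simp
qed

text \<open>On the line through \<open>axis i 1\<close> only the powers of \<open>x $ i\<close>
  survive, which settles their coefficients. At \<open>axis i 1 + axis j 1\<close> the only monomial
  left is then the mixed product.\<close>

lemma monomials_2_independent:
  fixes c :: "('n::finite \<Rightarrow> nat) \<Rightarrow> real"
  assumes zero: "\<And>x::real^'n. (\<Sum>\<alpha>\<in>exponents 2. c \<alpha> * monomial \<alpha> x) = 0" and \<alpha>: "\<alpha> \<in> exponents 2"
  shows "c \<alpha> = 0"
proof -
  let ?E = "exponents 2 :: ('n \<Rightarrow> nat) set"
  have single_E: "exponent_at i a \<in> ?E" if "a \<le> 2" for i a using that by (simp add: exponent_at_def)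
  have single0: "c (exponent_at i a) = 0" if "a \<le> 2" for i a
  proof -
    let ?S = "{exponent_at i 0, exponent_at i 1, exponent_at i (2::nat)}"
    have lin: "c (exponent_at i 0) + c (exponent_at i 1) * t + c (exponent_at i 2) * t\<^sup>2 = 0" for t
    proof -
      let ?x = "t *\<^sub>R axis i 1 :: real^'n"
      have x: "?x $ k = (if k = i then t else 0)" for k by (simp add: axis_def)
      have s: "monomial (exponent_at i a) ?x = t ^ a" for a
        unfolding x by (simp add: exponent_at_def prod.remove[of UNIV i])
      have "0 = (\<Sum>\<alpha>\<in>?E. c \<alpha> * monomial \<alpha> ?x)" by (simp only: zero)
      also have "\<dots> = (\<Sum>\<alpha>\<in>?S. c \<alpha> * monomial \<alpha> ?x)"
      proof (rule sum.mono_neutral_right[OF finite_exponents])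
        show "?S \<subseteq> ?E" using single_E by auto
        show "\<forall>\<alpha>\<in>?E - ?S. c \<alpha> * monomial \<alpha> ?x = 0"
        proof
          fix \<alpha> assume a: "\<alpha> \<in> ?E - ?S"
          have "\<exists>k. k \<noteq> i \<and> \<alpha> k > 0"
          proof (rule ccontr)
            assume "\<not> ?thesis"
            then have "\<alpha> = exponent_at i (\<alpha> i)" by (auto simp: exponent_at_def fun_eq_iff)
            moreover have "\<alpha> i \<le> 2" using a member_le_sum[of i UNIV \<alpha>] by auto
            ultimately show False using a by (auto simp: le_Suc_eq numeral_2_eq_2)
          qed
          then obtain k where "k \<noteq> i" "\<alpha> k > 0" by blast
          then have "?x $ k ^ \<alpha> k = 0" unfolding x by simp
          then have "monomial \<alpha> ?x = 0" by (intro prod_zero) auto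
          then show "c \<alpha> * monomial \<alpha> ?x = 0" by simp
        qed
      qed
      also have "\<dots> = c (exponent_at i 0) * t ^ 0 + (c (exponent_at i 1) * t ^ 1 + c (exponent_at i 2) * t\<^sup>2)"
      proof -
        have "exponent_at i 0 \<noteq> exponent_at i 1" "exponent_at i 0 \<noteq> exponent_at i 2" "exponent_at i 1 \<noteq> exponent_at i (2::nat)"
          by (auto simp: exponent_at_def fun_eq_iff)
        then have "(\<Sum>\<alpha>\<in>?S. g \<alpha>) = g (exponent_at i 0) + (g (exponent_at i 1) + g (exponent_at i 2))" for g :: "_ \<Rightarrow> real" by simp
        then show ?thesis by (simp only: s)
      qed
      finally show ?thesis by simp
    qed
    have "c (exponent_at i 0) = 0 \<and> c (exponent_at i 1) = 0 \<and> c (exponent_at i 2) = 0"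
      by (rule quadratic_poly_coeffs_zero[of 1 2]) (use lin in auto)
    then show ?thesis using that by (auto simp: le_Suc_eq numeral_2_eq_2)
  qed
  show ?thesis using \<alpha>
  proof (cases rule: exponents_2_cases)
    case (Single i a)
    then show ?thesis using single0 by simp
  next
    case (Pair i j)
    let ?x = "axis i 1 + axis j 1 :: real^'n"
    have x: "?x $ k = (if k = i \<or> k = j then 1 else 0)" for k using Pair(1) by (auto simp: axis_def)
    have a1: "monomial \<alpha> ?x = 1" unfolding x Pair(2) by (intro prod.neutral) (auto simp: exponent_at_def)
    have "0 = (\<Sum>\<beta>\<in>?E. c \<beta> * monomial \<beta> ?x)" by (simp only: zero)
    also have "\<dots> = (\<Sum>\<beta>\<in>{\<alpha>}. c \<beta> * monomial \<beta> ?x)"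
    proof (rule sum.mono_neutral_right[OF finite_exponents])
      show "{\<alpha>} \<subseteq> ?E" using \<alpha> by auto
      show "\<forall>\<beta>\<in>?E - {\<alpha>}. c \<beta> * monomial \<beta> ?x = 0"
      proof
        fix \<beta> assume b: "\<beta> \<in> ?E - {\<alpha>}"
        then have "\<beta> \<in> ?E" by simp
        then show "c \<beta> * monomial \<beta> ?x = 0"
        proof (cases rule: exponents_2_cases)
          case (Single i' a)
          then show ?thesis using single0 by simp
        next
          case P: (Pair i' j')
          have "{i', j'} \<noteq> {i, j}" using b P Pair by (auto simp: doubleton_eq_iff add.commute)
          then have "\<not> {i', j'} \<subseteq> {i, j}" using P(1) by auto
          then obtain k where "k \<in> {i', j'}" "k \<noteq> i" "k \<noteq> j" by blast
          then have "?x $ k ^ \<beta> k = 0" unfolding x P(2) by (auto simp: exponent_at_def)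
          then have "monomial \<beta> ?x = 0" by (intro prod_zero) auto
          then show ?thesis by simp
        qed
      qed
    qed
    also have "\<dots> = c \<alpha> * monomial \<alpha> ?x"
      by (simp only: sum.insert finite.emptyI empty_iff sum.empty add_0_right not_False_eq_True)
    finally show ?thesis unfolding a1 by simp
  qed
qed

text \<open>On a line through the origin the polynomial is quadratic in the parameter and vanishes
  at four points, two on each sphere.\<close>

lemma poly_2_zero_on_spheres:
  fixes c :: "('n::finite \<Rightarrow> nat) \<Rightarrow> real"
  assumes r: "r > 0" "s > 0" "r \<noteq> s"
    and zero: "\<And>x::real^'n. x \<in> sphere 0 r \<union> sphere 0 s \<Longrightarrow> (\<Sum>\<alpha>\<in>exponents 2. c \<alpha> * monomial \<alpha> x) = 0"
  shows "(\<Sum>\<alpha>\<in>exponents 2. c \<alpha> * monomial \<alpha> (x::real^'n)) = 0"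
proof -
  have "\<exists>u a. norm u = 1 \<and> x = a *\<^sub>R u"
  proof (cases "x = 0")
    case True
    then show ?thesis by (intro exI[of _ "axis undefined 1"] exI[of _ 0]) simp
  next
    case False
    then show ?thesis by (intro exI[of _ "x /\<^sub>R norm x"] exI[of _ "norm x"]) simp
  qed
  then obtain u a where u: "norm u = 1" "x = a *\<^sub>R u" by blast
  define A where "A d = (\<Sum>\<alpha> | \<alpha> \<in> exponents 2 \<and> (\<Sum>i\<in>UNIV. \<alpha> i) = d. c \<alpha> * monomial \<alpha> u)" for d
  have m: "monomial \<alpha> (t *\<^sub>R u) = t ^ (\<Sum>i\<in>UNIV. \<alpha> i) * monomial \<alpha> u" for t \<alpha>
    by (simp add: power_mult_distrib prod.distrib power_sum)
  have expand: "(\<Sum>\<alpha>\<in>exponents 2. c \<alpha> * monomial \<alpha> (t *\<^sub>R u)) = A 0 + A 1 * t + A 2 * t\<^sup>2" for t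
  proof -
    have "(\<Sum>\<alpha>\<in>exponents 2. c \<alpha> * monomial \<alpha> (t *\<^sub>R u))
        = (\<Sum>d\<in>{0, 1, 2}. \<Sum>\<alpha> | \<alpha> \<in> exponents 2 \<and> (\<Sum>i\<in>UNIV. \<alpha> i) = d. c \<alpha> * monomial \<alpha> (t *\<^sub>R u))"
      by (rule sum.group[symmetric, OF finite_exponents]) auto
    also have "\<dots> = (\<Sum>d\<in>{0, 1, 2}. A d * t ^ d)"
      unfolding A_def sum_distrib_right by (intro sum.cong refl) (simp only: m, auto)
    finally show ?thesis by simp
  qed
  have "A 0 = 0 \<and> A 1 = 0 \<and> A 2 = 0"
  proof (rule quadratic_poly_coeffs_zero[OF _ r])
    fix t assume "t \<in> {r, - r, s, - s}"
    then have "t *\<^sub>R u \<in> sphere 0 r \<union> sphere 0 s" using u r by auto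
    then show "A 0 + A 1 * t + A 2 * t\<^sup>2 = 0" unfolding expand[symmetric] by (rule zero)
  qed
  then show ?thesis unfolding u(2) expand by simp
qed

lemma poly_funs_on_eq_span:
  "poly_funs_on t S = fun_space.span ((\<lambda>\<alpha> x. if x \<in> S then monomial \<alpha> x else 0) ` exponents t)"
proof -
  have eq: "(\<lambda>x. if x \<in> S then f x else 0) \<in> fun_space.span ((\<lambda>\<alpha> x. if x \<in> S then monomial \<alpha> x else 0) ` exponents t)"
    if "f \<in> poly_funs t" for f
    using that
  proof (induction rule: poly_funs_induct)
    case zero
    then show ?case using fun_space.span_zero by (simp add: zero_fun_def)
  next
    case (add c f g)
    have "(\<lambda>x. c * (if x \<in> S then f x else 0)) + (\<lambda>x. if x \<in> S then g x else 0)
      \<in> fun_space.span ((\<lambda>\<alpha> x. if x \<in> S then monomial \<alpha> x else 0) ` exponents t)"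
      using add by (intro fun_space.span_add fun_space.span_scale)
    moreover have "(\<lambda>x. c * (if x \<in> S then f x else 0)) + (\<lambda>x. if x \<in> S then g x else 0)
      = (\<lambda>x. if x \<in> S then c * f x + g x else 0)" by (simp add: fun_eq_iff)
    ultimately show ?case by simp
  next
    case (monomial \<alpha>)
    then show ?case by (intro fun_space.span_base) auto
  qed
  show ?thesis
  proof (intro equalityI fun_space.span_minimal)
    show "poly_funs_on t S \<subseteq> fun_space.span ((\<lambda>\<alpha> x. if x \<in> S then monomial \<alpha> x else 0) ` exponents t)"
      using eq by (auto simp: poly_funs_on_def)
    have mem: "monomial \<alpha> \<in> poly_funs t" if "\<alpha> \<in> exponents t" for \<alpha> :: "'a \<Rightarrow> nat"
      unfolding poly_funs_eq_span using that by (intro fun_space.span_base) auto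
    show "(\<lambda>\<alpha> x. if x \<in> S then monomial \<alpha> x else 0) ` exponents t \<subseteq> poly_funs_on t S"
      unfolding poly_funs_on_def by (intro image_subsetI imageI[where f="\<lambda>f x. if x \<in> S then f x else 0"] mem)
    have sub: "fun_space.subspace (poly_funs t :: (real^'a \<Rightarrow> real) set)"
      unfolding poly_funs_eq_span by (rule fun_space.subspace_span)
    show "fun_space.subspace (poly_funs_on t S)"
      unfolding fun_space.subspace_def
    proof (intro conjI ballI allI)
      show "0 \<in> poly_funs_on t S" unfolding poly_funs_on_def
        using fun_space.subspace_0[OF sub] by (intro image_eqI[of _ _ 0]) (auto simp: fun_eq_iff)
    next
      fix f g assume "f \<in> poly_funs_on t S" "g \<in> poly_funs_on t S"
      then obtain f' g' where "f' \<in> poly_funs t" "g' \<in> poly_funs t" "f = (\<lambda>x. if x \<in> S then f' x else 0)"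
        "g = (\<lambda>x. if x \<in> S then g' x else 0)" by (auto simp: poly_funs_on_def)
      then show "f + g \<in> poly_funs_on t S" unfolding poly_funs_on_def
        using fun_space.subspace_add[OF sub] by (intro image_eqI[of _ _ "f' + g'"]) (auto simp: fun_eq_iff)
    next
      fix c :: real and f assume "f \<in> poly_funs_on t S"
      then obtain f' where "f' \<in> poly_funs t" "f = (\<lambda>x. if x \<in> S then f' x else 0)" by (auto simp: poly_funs_on_def)
      then show "(\<lambda>x. c * f x) \<in> poly_funs_on t S" unfolding poly_funs_on_def
        using fun_space.subspace_scale[OF sub] by (intro image_eqI[of _ _ "\<lambda>x. c * f' x"]) (auto simp: fun_eq_iff)
    qed
  qed
qed

text \<open>By the two preceding independence results, restriction to two spheres loses nothing in
  degree 2, so the dimension is the number of monomials.\<close>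

lemma dim_poly_funs_on_two_spheres:
  assumes r: "r > 0" "s > 0" "r \<noteq> s"
  shows "fun_space.dim (poly_funs_on 2 (sphere 0 r \<union> sphere 0 s) :: (real^'n \<Rightarrow> real) set) = (CARD('n) + 2) choose 2"
proof -
  let ?S = "sphere 0 r \<union> sphere 0 s :: (real^'n) set" and ?E = "exponents 2 :: ('n \<Rightarrow> nat) set"
  define b where "b \<alpha> x = (if x \<in> ?S then monomial \<alpha> x else 0)" for \<alpha> :: "'n \<Rightarrow> nat" and x :: "real^'n"
  have indep: "c \<alpha> = 0" if "(\<Sum>\<alpha>\<in>?E. (\<lambda>x. c \<alpha> * b \<alpha> x)) = 0" "\<alpha> \<in> ?E" for c \<alpha>
  proof (rule monomials_2_independent[OF poly_2_zero_on_spheres[OF r] that(2)])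
    fix x assume x: "x \<in> ?S"
    have "(\<Sum>\<alpha>\<in>?E. c \<alpha> * b \<alpha> x) = 0" using fun_cong[OF that(1), of x] by (simp add: sum_fun_apply)
    then show "(\<Sum>\<alpha>\<in>?E. c \<alpha> * monomial \<alpha> x) = 0" using x by (simp add: b_def)
  qed
  \<comment> \<open>Linear dependence is a notion for sets of functions, so coinciding restrictions
    must be excluded first; they would give a relation with coefficients \<open>1\<close> and
    \<open>- 1\<close>.\<close>
  have inj: "inj_on b ?E"
  proof (rule inj_onI, rule ccontr)
    fix \<alpha> \<beta> assume ab: "\<alpha> \<in> ?E" "\<beta> \<in> ?E" "b \<alpha> = b \<beta>" "\<alpha> \<noteq> \<beta>"
    define c where "c = (\<lambda>\<gamma>. if \<gamma> = \<alpha> then 1 else if \<gamma> = \<beta> then - 1 else 0 :: real)"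
    have "(\<Sum>\<gamma>\<in>?E. (\<lambda>x. c \<gamma> * b \<gamma> x)) = 0"
    proof (rule ext)
      fix x
      have "(\<Sum>\<gamma>\<in>?E. c \<gamma> * b \<gamma> x) = (\<Sum>\<gamma>\<in>?E. (if \<gamma> = \<alpha> then b \<gamma> x else 0) - (if \<gamma> = \<beta> then b \<gamma> x else 0))"
        using ab(4) by (intro sum.cong) (auto simp: c_def)
      also have "\<dots> = b \<alpha> x - b \<beta> x" using ab by (simp add: sum_subtractf finite_exponents)
      finally show "(\<Sum>\<gamma>\<in>?E. (\<lambda>x. c \<gamma> * b \<gamma> x)) x = 0 x" using ab(3) by (simp add: sum_fun_apply)
    qed
    then have "c \<alpha> = 0" using indep ab(1) by blast
    then show False by (simp add: c_def)
  qed
  have "\<not> fun_space.dependent (b ` ?E)"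
  proof
    assume "fun_space.dependent (b ` ?E)"
    then obtain u v where u: "v \<in> b ` ?E" "u v \<noteq> 0" "(\<Sum>v\<in>b ` ?E. (\<lambda>x. u v * v x)) = 0"
      unfolding fun_space.dependent_finite[OF finite_imageI[OF finite_exponents]] by blast
    have "(\<Sum>\<alpha>\<in>?E. (\<lambda>x. u (b \<alpha>) * b \<alpha> x)) = 0" using u(3) by (simp add: sum.reindex[OF inj])
    then show False using indep[of "\<lambda>\<alpha>. u (b \<alpha>)"] u by auto
  qed
  moreover have "poly_funs_on 2 ?S = fun_space.span (b ` ?E)"
    by (simp only: poly_funs_on_eq_span b_def[abs_def])
  ultimately have "fun_space.dim (poly_funs_on 2 ?S) = card (b ` ?E)"
    using fun_space.dim_eq_card[of "b ` ?E" "poly_funs_on 2 ?S"] by (simp add: fun_space.span_span)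
  then show ?thesis by (simp add: card_image[OF inj] card_exponents)
qed

section \<open>Rescaling and classification\<close>

lemma design_moments_orthogonal_image:
  fixes f :: "real^'n \<Rightarrow> real^'n"
  assumes f: "orthogonal_transformation f"
    and dm: "design_moments (f ` X1) r1 w1 (f ` X2) r2 w2"
  shows "design_moments X1 r1 w1 X2 r2 w2"
proof -
  have inj: "inj_on f Z" for Z using orthogonal_transformation_inj[OF f] by (rule inj_on_subset) simp
  have ip: "f a \<bullet> f b = a \<bullet> b" for a b using f by (simp add: orthogonal_transformation_def)
  note dm' = dm[unfolded design_moments_def sum.reindex[OF inj] o_def card_image[OF inj]]
  show ?thesis unfolding design_moments_def
  proof (intro conjI allI)
    fix a b c d :: "real^'n"
    show "w1 * (\<Sum>x\<in>X1. a \<bullet> x) + w2 * (\<Sum>x\<in>X2. a \<bullet> x) = 0"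
      using dm'[THEN conjunct1, rule_format, of "f a"] by (simp only: ip)
    show "w1 * (\<Sum>x\<in>X1. (a \<bullet> x) * (b \<bullet> x)) + w2 * (\<Sum>x\<in>X2. (a \<bullet> x) * (b \<bullet> x))
        = (w1 * card X1 * r1\<^sup>2 + w2 * card X2 * r2\<^sup>2) / CARD('n) * (a \<bullet> b)"
      using dm'[THEN conjunct2, THEN conjunct1, rule_format, of "f a" "f b"] by (simp only: ip)
    show "w1 * (\<Sum>x\<in>X1. (a \<bullet> x) * (b \<bullet> x) * (c \<bullet> x)) + w2 * (\<Sum>x\<in>X2. (a \<bullet> x) * (b \<bullet> x) * (c \<bullet> x)) = 0"
      using dm'[THEN conjunct2, THEN conjunct2, THEN conjunct1, rule_format, of "f a" "f b" "f c"] by (simp only: ip)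
    show "w1 * (\<Sum>x\<in>X1. (a \<bullet> x) * (b \<bullet> x) * (c \<bullet> x) * (d \<bullet> x))
        + w2 * (\<Sum>x\<in>X2. (a \<bullet> x) * (b \<bullet> x) * (c \<bullet> x) * (d \<bullet> x))
        = (w1 * card X1 * r1 ^ 4 + w2 * card X2 * r2 ^ 4) / (CARD('n) * (CARD('n) + 2)) *
          ((a \<bullet> b) * (c \<bullet> d) + (a \<bullet> c) * (b \<bullet> d) + (a \<bullet> d) * (b \<bullet> c))"
      using dm'[THEN conjunct2, THEN conjunct2, THEN conjunct2, rule_format, of "f a" "f b" "f c" "f d"]
      by (simp only: ip)
  qed
qed

context kernel_pair
begin

interpretation S: kernel_pair V U c2 c1 d2 d1 \<sigma> s2 g2 s1 g1
  by (rule kernel_pair_swap) unfold_locales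

text \<open>In degrees 1 to 3 each layer satisfies its identities alone, so radii and weights are
  free there. Only degree 4 couples the layers, and it fixes weight times fourth power of the
  radius; hence the weight \<open>d2 / d1 / t ^ 4\<close>.\<close>

lemma rescaled_moments_if_unmixed:
  assumes \<sigma>: "\<sigma> = 0" and t: "t > 0"
  shows "design_moments U 1 1 ((*\<^sub>R) t ` V) t (d2 / d1 / t ^ 4)"
proof -
  have inj: "inj_on ((*\<^sub>R) t) V" using t by (auto simp: inj_on_def)
  show ?thesis
    unfolding design_moments_def sum.reindex[OF inj] o_def card_image[OF inj] inner_scaleR_right
  proof (intro conjI allI)
    fix a b c d :: "real^'n"
    have "(\<Sum>x\<in>V. t * (a \<bullet> x)) = 0" by (simp only: sum_distrib_left[symmetric] V1)
    then show "1 * (\<Sum>x\<in>U. a \<bullet> x) + d2 / d1 / t ^ 4 * (\<Sum>x\<in>V. t * (a \<bullet> x)) = 0" by (simp only: U1)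
    have "(\<Sum>x\<in>V. t * (a \<bullet> x) * (t * (b \<bullet> x))) = t\<^sup>2 * (\<Sum>x\<in>V. (a \<bullet> x) * (b \<bullet> x))"
      unfolding sum_distrib_left by (intro sum.cong refl) (simp add: power2_eq_square)
    then show "1 * (\<Sum>x\<in>U. (a \<bullet> x) * (b \<bullet> x)) + d2 / d1 / t ^ 4 * (\<Sum>x\<in>V. t * (a \<bullet> x) * (t * (b \<bullet> x)))
        = (1 * N * 1\<^sup>2 + d2 / d1 / t ^ 4 * M * t\<^sup>2) / real CARD('n) * (a \<bullet> b)"
      by (simp only: U2 V2) (simp add: add_divide_distrib algebra_simps)
    have "(\<Sum>x\<in>V. t * (a \<bullet> x) * (t * (b \<bullet> x)) * (t * (c \<bullet> x))) = t ^ 3 * (\<Sum>x\<in>V. (a \<bullet> x) * (b \<bullet> x) * (c \<bullet> x))"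
      unfolding sum_distrib_left by (intro sum.cong refl) (simp add: power3_eq_cube)
    then show "1 * (\<Sum>x\<in>U. (a \<bullet> x) * (b \<bullet> x) * (c \<bullet> x))
        + d2 / d1 / t ^ 4 * (\<Sum>x\<in>V. t * (a \<bullet> x) * (t * (b \<bullet> x)) * (t * (c \<bullet> x))) = 0"
      by (simp only: cubic_moments_if_unmixed[OF \<sigma>] S.cubic_moments_if_unmixed[OF \<sigma>])
    have "(\<Sum>x\<in>V. t * (a \<bullet> x) * (t * (b \<bullet> x)) * (t * (c \<bullet> x)) * (t * (d \<bullet> x)))
        = t ^ 4 * (\<Sum>x\<in>V. (a \<bullet> x) * (b \<bullet> x) * (c \<bullet> x) * (d \<bullet> x))"
      unfolding sum_distrib_left by (intro sum.cong refl) (simp add: power4_eq_xxxx)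
    then have "1 * (\<Sum>x\<in>U. (a \<bullet> x) * (b \<bullet> x) * (c \<bullet> x) * (d \<bullet> x)) + d2 / d1 / t ^ 4 *
          (\<Sum>x\<in>V. t * (a \<bullet> x) * (t * (b \<bullet> x)) * (t * (c \<bullet> x)) * (t * (d \<bullet> x)))
        = (d1 * (\<Sum>x\<in>U. (a \<bullet> x) * (b \<bullet> x) * (c \<bullet> x) * (d \<bullet> x))
            + d2 * (\<Sum>x\<in>V. (a \<bullet> x) * (b \<bullet> x) * (c \<bullet> x) * (d \<bullet> x))) / d1"
      using pos t by (simp add: add_divide_distrib)
    also have "\<dots> = (1 * N * 1 ^ 4 + d2 / d1 / t ^ 4 * M * t ^ 4) / (CARD('n) * (CARD('n) + 2)) *
          ((a \<bullet> b) * (c \<bullet> d) + (a \<bullet> c) * (b \<bullet> d) + (a \<bullet> d) * (b \<bullet> c))"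
    proof -
      have "d2 / d1 / t ^ 4 * M * t ^ 4 = d2 * M / d1" using t by simp
      moreover have "(d1 * N + d2 * M) / Z * E / d1 = (1 * N * 1 ^ 4 + d2 * M / d1) / Z * E" for Z E
        using pos by (simp add: field_simps)
      ultimately show ?thesis unfolding M4 by simp
    qed
    finally show "1 * (\<Sum>x\<in>U. (a \<bullet> x) * (b \<bullet> x) * (c \<bullet> x) * (d \<bullet> x)) + d2 / d1 / t ^ 4 *
          (\<Sum>x\<in>V. t * (a \<bullet> x) * (t * (b \<bullet> x)) * (t * (c \<bullet> x)) * (t * (d \<bullet> x)))
        = (1 * N * 1 ^ 4 + d2 / d1 / t ^ 4 * M * t ^ 4) / (CARD('n) * (CARD('n) + 2)) *
          ((a \<bullet> b) * (c \<bullet> d) + (a \<bullet> c) * (b \<bullet> d) + (a \<bullet> d) * (b \<bullet> c))" .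
  qed
qed

text \<open>The isometry \<open>f\<close> leaves room for a choice of coordinates. As
  \<open>t \<noteq> 1\<close>, the norm of a point tells its layer, so one weight function serves
  both.\<close>

lemma rescaled_design_if_unmixed:
  fixes f :: "real^'n \<Rightarrow> real^'n"
  assumes \<sigma>: "\<sigma> = 0" and t: "t > 0" "t \<noteq> 1" and f: "orthogonal_transformation f"
    and Y: "f ` Y1 = U" "f ` Y2 = (*\<^sub>R) t ` V"
  shows "euclidean_design 4 (Y1 \<union> Y2) (\<lambda>x. if norm x = 1 then 1 else d2 / d1 / t ^ 4)"
proof -
  have inj: "inj f" using f orthogonal_transformation_inj by blast
  have nf: "norm (f x) = norm x" for x using f orthogonal_transformation_norm by blast
  have n1: "norm x = 1" if "x \<in> Y1" for x
    using that Y(1) unit(1)[of "f x"] nf[of x] by (metis image_eqI norm_eq_1)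
  have n2': "norm x = t" if "x \<in> Y2" for x
  proof -
    have "f x \<in> (*\<^sub>R) t ` V" using that Y(2) by blast
    then obtain v where v: "v \<in> V" "f x = t *\<^sub>R v" by blast
    then have "norm v = 1" using unit(2) by (simp add: norm_eq_1)
    then show ?thesis using nf[of x] v t by simp
  qed
  have fin': "finite Y1" "finite Y2"
    using Y fin inj by (metis finite_imageD inj_on_subset subset_UNIV finite_imageI)+
  have ne': "Y1 \<noteq> {}" "Y2 \<noteq> {}" using Y ne by auto
  have "design_moments Y1 1 1 Y2 t (d2 / d1 / t ^ 4)"
    by (rule design_moments_orthogonal_image[OF f]) (simp only: Y rescaled_moments_if_unmixed[OF \<sigma> t(1)])
  then show ?thesis
    using euclidean_design_4_iff[of Y1 Y2 1 t 1 "d2 / d1 / t ^ 4" "\<lambda>x. if norm x = 1 then 1 else d2 / d1 / t ^ 4"]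
      fin' ne' n1 n2' t pos by (auto simp: subset_iff)
qed

end

text \<open>The similarity is \<open>r1\<close> times \<open>f\<close> and the factor of the weights
  is \<open>1 / w1\<close>. The member of the family that is hit has \<open>t = r2 / r1\<close>,
  where the second weight simplifies to \<open>w2 / w1\<close>.\<close>

lemma similar_weighted_rescaled:
  fixes f :: "real^'n \<Rightarrow> real^'n"
  assumes r: "r1 > 0" "r2 > 0" "r1 \<noteq> r2" and w: "w1 > 0"
    and unit: "\<And>x. x \<in> U \<Longrightarrow> x \<bullet> x = 1" "\<And>x. x \<in> V \<Longrightarrow> x \<bullet> x = 1"
    and wx: "\<And>x. x \<in> U \<Longrightarrow> w (r1 *\<^sub>R x) = w1" "\<And>x. x \<in> V \<Longrightarrow> w (r2 *\<^sub>R x) = w2"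
    and f: "orthogonal_transformation f" and Y: "f ` Y1 = U" "f ` Y2 = (*\<^sub>R) (r2 / r1) ` V"
  shows "similar_weighted ((*\<^sub>R) r1 ` U \<union> (*\<^sub>R) r2 ` V) w (Y1 \<union> Y2)
    (\<lambda>x. if norm x = 1 then 1 else w2 * r2 ^ 4 / (w1 * r1 ^ 4) / (r2 / r1) ^ 4)"
proof -
  define \<rho> where "\<rho> x = r1 *\<^sub>R f x" for x
  have bf: "bij f" using f orthogonal_transformation_bij by blast
  have nf: "norm (f x) = norm x" for x using f orthogonal_transformation_norm by blast
  have lin: "linear f" using f orthogonal_transformation_linear by blast
  have "bij (\<lambda>x::real^'n. r1 *\<^sub>R x)"
    by (rule bij_betw_byWitness[where f'="\<lambda>x. x /\<^sub>R r1"]) (use r in auto)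
  then have b\<rho>: "bij \<rho>" unfolding \<rho>_def using bij_comp[OF bf] by (simp add: o_def)
  have sim: "similarity_fixing_0 \<rho>"
    unfolding similarity_fixing_0_def
  proof (intro conjI exI[of _ r1] allI)
    show "\<rho> 0 = 0" using linear_0[OF lin] by (simp add: \<rho>_def)
    fix x y
    have "f x - f y = f (x - y)" using linear_diff[OF lin] by simp
    then show "dist (\<rho> x) (\<rho> y) = r1 * dist x y"
      using r nf[of "x - y"] by (simp add: \<rho>_def dist_norm flip: scaleR_diff_right)
  qed (use b\<rho> r in auto)
  have im: "\<rho> ` Y1 = (*\<^sub>R) r1 ` U" "\<rho> ` Y2 = (*\<^sub>R) r2 ` V"
  proof -
    show "\<rho> ` Y1 = (*\<^sub>R) r1 ` U" unfolding Y(1)[symmetric] \<rho>_def by (simp add: image_image)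
    have "\<rho> ` Y2 = (*\<^sub>R) r1 ` (f ` Y2)" unfolding \<rho>_def by (simp add: image_image)
    then show "\<rho> ` Y2 = (*\<^sub>R) r2 ` V" unfolding Y(2) using r by (simp add: image_image)
  qed
  have "Y1 \<union> Y2 = \<rho> -` (\<rho> ` (Y1 \<union> Y2))" using b\<rho> by (simp add: bij_is_inj inj_vimage_image_eq)
  then have vim: "Y1 \<union> Y2 = \<rho> -` ((*\<^sub>R) r1 ` U \<union> (*\<^sub>R) r2 ` V)" by (simp only: image_Un im)
  have wt: "(if norm x = 1 then 1 else w2 * r2 ^ 4 / (w1 * r1 ^ 4) / (r2 / r1) ^ 4) = 1 / w1 * w (\<rho> x)"
    if "x \<in> Y1 \<union> Y2" for x
  proof (cases "x \<in> Y1")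
    case True
    then have "f x \<in> U" using Y by blast
    moreover from this have "norm (f x) = 1" using unit(1) by (simp only: norm_eq_1)
    then have "norm x = 1" by (simp only: nf)
    ultimately show ?thesis using wx(1) w by (simp add: \<rho>_def)
  next
    case False
    then have "f x \<in> (*\<^sub>R) (r2 / r1) ` V" using Y that by blast
    then obtain v where v: "v \<in> V" "f x = (r2 / r1) *\<^sub>R v" by blast
    have "norm v = 1" using unit(2)[OF v(1)] by (simp add: norm_eq_1)
    then have "norm x = r2 / r1" using nf[of x] v(2) r by simp
    moreover have "r2 / r1 \<noteq> 1" using r by simp
    moreover have "\<rho> x = r2 *\<^sub>R v" using v(2) r by (simp add: \<rho>_def)
    ultimately show ?thesis using wx(2)[OF v(1)] r w by (simp add: power_divide)
  qed
  show ?thesis unfolding similar_weighted_def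
    using sim vim wt w by (intro exI[of _ \<rho>] exI[of _ "1 / w1"]) auto
qed

lemma subset_doubleton_if_card_le_2:
  assumes "finite A" "card A \<le> 2"
  obtains a b where "A \<subseteq> {a, b}"
proof (cases "card A = 2")
  case True
  then show thesis using that by (metis card_2_iff order_refl)
next
  case False
  then have "card A \<le> Suc 0" using assms(2) by simp
  then have "\<forall>x\<in>A. \<forall>y\<in>A. x = y" using assms(1) by (simp add: card_le_Suc0_iff_eq)
  then have "\<exists>a. A \<subseteq> {a}" by (metis insertCI subsetI)
  then show thesis using that by blast
qed

section \<open>From cross values to the block form\<close>

context unit_design_pair
begin

text \<open>If \<open>a\<close> and \<open>b\<close> are the cross values, summing
  \<open>(x \<bullet> z - a) * (x \<bullet> z - b) = 0\<close> over \<open>V\<close> gives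
  \<open>a * b = - 1 / n\<close> by the first two moments; then
  \<open>\<sigma> = a + b\<close>.\<close>

lemma cross_values:
  assumes le: "card {x \<bullet> y | x y. x \<in> U \<and> y \<in> V} \<le> 2"
  shows "card {x \<bullet> y | x y. x \<in> U \<and> y \<in> V} = 2"
    and "\<exists>\<sigma>. \<forall>x\<in>U. \<forall>y\<in>V. Q2 x y = \<sigma> * (x \<bullet> y)"
proof -
  let ?A = "{x \<bullet> y | x y. x \<in> U \<and> y \<in> V}"
  have finA: "finite ?A"
  proof -
    have "?A = (\<lambda>(x, y). x \<bullet> y) ` (U \<times> V)" by force
    then show ?thesis using fin by simp
  qed
  obtain x y where xy: "x \<in> U" "y \<in> V" using ne by auto
  have sq: "(\<Sum>z\<in>V. (x \<bullet> z) * (x \<bullet> z)) = M / real CARD('n)" using V2[of x x] unit(1)[OF xy(1)] by simp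
  have nz: "M / real CARD('n) > 0" using M_pos by simp
  \<comment> \<open>A constant row would be zero by the first moment, against the positive second
    moment.\<close>
  have ex: "\<exists>z\<in>V. \<exists>z'\<in>V. x \<bullet> z \<noteq> x \<bullet> z'"
  proof (rule ccontr)
    assume "\<not> ?thesis"
    then have c: "x \<bullet> z = x \<bullet> y" if "z \<in> V" for z using that xy(2) by blast
    have "0 = (\<Sum>z\<in>V. x \<bullet> z)" by (simp add: V1)
    also have "\<dots> = (\<Sum>z\<in>V. x \<bullet> y)" by (intro sum.cong refl c)
    finally have "x \<bullet> y = 0" using M_pos by simp
    then have "(\<Sum>z\<in>V. (x \<bullet> z) * (x \<bullet> z)) = 0" using c by simp
    then show False using sq nz by simp
  qed
  then obtain z z' where z: "z \<in> V" "z' \<in> V" "x \<bullet> z \<noteq> x \<bullet> z'" by blast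
  define a where "a = x \<bullet> z"
  define b where "b = x \<bullet> z'"
  have sub: "{a, b} \<subseteq> ?A" using z xy by (auto simp: a_def b_def)
  have c2: "card {a, b} = 2" using z(3) by (simp add: a_def b_def)
  have A: "{a, b} = ?A" by (rule card_seteq[OF finA sub]) (use le c2 in simp)
  then show "card ?A = 2" using c2 by simp
  have val: "(x \<bullet> y - a) * (x \<bullet> y - b) = 0" if "x \<in> U" "y \<in> V" for x y
  proof -
    have "x \<bullet> y \<in> {a, b}" unfolding A using that by blast
    then show ?thesis by auto
  qed
  have "0 = (\<Sum>z\<in>V. (x \<bullet> z) * (x \<bullet> z) - (a + b) * (x \<bullet> z) + a * b)"
  proof (rule sum.neutral[symmetric], rule ballI)
    fix z assume "z \<in> V"
    then have "(x \<bullet> z - a) * (x \<bullet> z - b) = 0" using val xy by blast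
    then show "(x \<bullet> z) * (x \<bullet> z) - (a + b) * (x \<bullet> z) + a * b = 0" by algebra
  qed
  also have "\<dots> = M / real CARD('n) - (a + b) * 0 + M * (a * b)"
    by (simp only: sum.distrib sum_subtractf sum_distrib_left[symmetric] sq V1) simp
  finally have "M * (1 / real CARD('n) + a * b) = 0" by (simp add: algebra_simps)
  then have ab: "a * b = - (1 / real CARD('n))" using M_pos by simp
  show "\<exists>\<sigma>. \<forall>x\<in>U. \<forall>y\<in>V. Q2 x y = \<sigma> * (x \<bullet> y)"
  proof (intro exI[of _ "a + b"] ballI)
    fix x y assume "x \<in> U" "y \<in> V"
    then show "Q2 x y = (a + b) * (x \<bullet> y)"
      using val[of x y] ab by (simp add: power2_eq_square algebra_simps)
  qed
qed

lemma kernel_pair_exists: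
  assumes cross: "card {x \<bullet> y | x y. x \<in> U \<and> y \<in> V} \<le> 2"
    and within: "card {x \<bullet> y | x y. x \<in> U \<and> y \<in> U \<and> x \<noteq> y} \<le> 2"
      "card {x \<bullet> y | x y. x \<in> V \<and> y \<in> V \<and> x \<noteq> y} \<le> 2"
  shows "\<exists>\<sigma> s1 g1 s2 g2. kernel_pair U V c1 c2 d1 d2 \<sigma> s1 g1 s2 g2"
proof -
  have finZ: "finite {x \<bullet> y | x y. x \<in> Z \<and> y \<in> Z \<and> x \<noteq> y}" if "finite Z" for Z :: "(real^'n) set"
  proof (rule finite_subset)
    show "{x \<bullet> y | x y. x \<in> Z \<and> y \<in> Z \<and> x \<noteq> y} \<subseteq> (\<lambda>(x, y). x \<bullet> y) ` (Z \<times> Z)" by force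
  qed (use that in simp)
  obtain \<sigma> where \<sigma>: "\<forall>x\<in>U. \<forall>y\<in>V. Q2 x y = \<sigma> * (x \<bullet> y)"
    using cross_values(2)[OF cross] by blast
  obtain a b where "{x \<bullet> y | x y. x \<in> U \<and> y \<in> U \<and> x \<noteq> y} \<subseteq> {a, b}"
    using subset_doubleton_if_card_le_2[OF finZ[OF fin(1)] within(1)] .
  then have ab: "x \<bullet> y = a \<or> x \<bullet> y = b" if "x \<in> U" "y \<in> U" "x \<noteq> y" for x y using that by blast
  obtain a' b' where "{x \<bullet> y | x y. x \<in> V \<and> y \<in> V \<and> x \<noteq> y} \<subseteq> {a', b'}"
    using subset_doubleton_if_card_le_2[OF finZ[OF fin(2)] within(2)] .
  then have ab': "x \<bullet> y = a' \<or> x \<bullet> y = b'" if "x \<in> V" "y \<in> V" "x \<noteq> y" for x y using that by blast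
  obtain s1 g1 where 1: "\<forall>x\<in>U. \<forall>z\<in>U. Q2 x z
      = s1 * (x \<bullet> z) + g1 * ((if x = z then 1 else 0) - 1 / card U)" "g1 = 0 \<longleftrightarrow> card U = CARD('n) + 1"
    using layer_kernel[OF fin(1) ne(1) unit(1) U1 U2 ab] by blast
  obtain s2 g2 where 2: "\<forall>x\<in>V. \<forall>z\<in>V. Q2 x z
      = s2 * (x \<bullet> z) + g2 * ((if x = z then 1 else 0) - 1 / card V)" "g2 = 0 \<longleftrightarrow> card V = CARD('n) + 1"
    using layer_kernel[OF fin(2) ne(2) unit(2) V1 V2 ab'] by blast
  have "kernel_pair U V c1 c2 d1 d2 \<sigma> s1 g1 s2 g2"
    by unfold_locales (use \<sigma> 1 2 in simp_all)
  then show ?thesis by blast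
qed

end

lemma inner_values_scaled:
  fixes U V :: "(real^'n) set"
  assumes "r > 0" "s > 0"
  shows "inner_values r s ((*\<^sub>R) r ` U) ((*\<^sub>R) s ` V) = {x \<bullet> y | x y. x \<in> U \<and> y \<in> V \<and> r *\<^sub>R x \<noteq> s *\<^sub>R y}"
proof -
  have "(r *\<^sub>R x) \<bullet> (s *\<^sub>R y) / (r * s) = x \<bullet> y" for x y :: "real^'n" using assms by simp
  then show ?thesis unfolding inner_values_def by force
qed

lemma inner_values_scaled_same:
  fixes U :: "(real^'n) set"
  assumes "r > 0"
  shows "inner_values r r ((*\<^sub>R) r ` U) ((*\<^sub>R) r ` U) = {x \<bullet> y | x y. x \<in> U \<and> y \<in> U \<and> x \<noteq> y}"
  using assms by (simp add: inner_values_scaled)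

lemma inner_values_scaled_different:
  fixes U V :: "(real^'n) set"
  assumes "r > 0" "s > 0" "r \<noteq> s"
    and unit: "\<And>x. x \<in> U \<Longrightarrow> x \<bullet> x = 1" "\<And>x. x \<in> V \<Longrightarrow> x \<bullet> x = 1"
  shows "inner_values r s ((*\<^sub>R) r ` U) ((*\<^sub>R) s ` V) = {x \<bullet> y | x y. x \<in> U \<and> y \<in> V}"
proof -
  have "r *\<^sub>R x \<noteq> s *\<^sub>R y" if "x \<in> U" "y \<in> V" for x y
  proof
    assume "r *\<^sub>R x = s *\<^sub>R y"
    then have "norm (r *\<^sub>R x) = norm (s *\<^sub>R y)" by simp
    then show False using that unit assms by (simp add: norm_eq_sqrt_inner)
  qed
  then show ?thesis unfolding inner_values_scaled[OF assms(1,2)] by blast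
qed

section \<open>The two exceptional families\<close>

context kernel_pair
begin

interpretation S: kernel_pair V U c2 c1 d2 d1 \<sigma> s2 g2 s1 g1
  by (rule kernel_pair_swap) unfold_locales

lemma k_family_design_if_unmixed:
  fixes k :: nat
  assumes \<sigma>: "\<sigma> = 0" and cross2: "card {x \<bullet> y | x y. x \<in> U \<and> y \<in> V} = 2"
    and k: "k \<ge> 2" and n: "int CARD('n) = (2 * int k - 1)\<^sup>2 - 4"
    and cards: "int (card U) = 2 * (2 * int k + 1) * (int k - 1) ^ 3" "int (card V) = 2 * int k ^ 3 * (2 * int k - 3)"
    and s: "s1 = - 2 / (real k * (2 * real k - 3))" "s2 = - 2 / ((real k - 1) * (2 * real k + 1))"
    and d: "d2 / d1 = (2 * real k + 1)\<^sup>2 * (real k - 1) ^ 4 / ((2 * real k - 3)\<^sup>2 * real k ^ 4)"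
    and t: "t > 0" "t \<noteq> 1"
  shows "k_family_design k t U ((*\<^sub>R) t ` V) (\<lambda>x. if norm x = 1 then 1 else d2 / d1 / t ^ 4)"
  unfolding k_family_design_def
proof (intro conjI)
  have nU: "norm x = 1" if "x \<in> U" for x using unit(1)[OF that] by (simp add: norm_eq_1)
  have nV: "norm x = t" if "x \<in> (*\<^sub>R) t ` V" for x
  proof -
    obtain v where "v \<in> V" "x = t *\<^sub>R v" using \<open>x \<in> (*\<^sub>R) t ` V\<close> by blast
    then show ?thesis using unit(2)[of v] t by (simp add: norm_eq_1[symmetric])
  qed
  show "euclidean_design 4 (U \<union> (*\<^sub>R) t ` V) (\<lambda>x. if norm x = 1 then 1 else d2 / d1 / t ^ 4)"
    by (rule rescaled_design_if_unmixed[OF \<sigma> t, of "\<lambda>x. x"]) auto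
  show "U \<subseteq> sphere 0 1" "(*\<^sub>R) t ` V \<subseteq> sphere 0 t"
    by (rule subsetI, simp only: mem_sphere_0 nU nV)+
  show "int CARD('n) = (2 * int k - 1)\<^sup>2 - 4" by (rule n)
  show "int (card U) = 2 * (2 * int k + 1) * (int k - 1) ^ 3" by (rule cards)
  have "card ((*\<^sub>R) t ` V) = card V" using t by (intro card_image) (auto simp: inj_on_def)
  then show "int (card ((*\<^sub>R) t ` V)) = 2 * int k ^ 3 * (2 * int k - 3)" using cards(2) by simp
  show "inner_values 1 1 U U = {(real k - 2) / (real k * (2 * real k - 3)), - (1 / (2 * real k - 3))}"
    using inner_values_scaled_same[of 1 U] k_family_value_sets(1)[OF \<sigma> k n s] by simp
  show "inner_values t t ((*\<^sub>R) t ` V) ((*\<^sub>R) t ` V)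
      = {1 / (2 * real k + 1), - ((real k + 1) / ((real k - 1) * (2 * real k + 1)))}"
    using inner_values_scaled_same[OF t(1), of V] k_family_value_sets(2)[OF \<sigma> k n s] by simp
  have "inner_values 1 t ((*\<^sub>R) 1 ` U) ((*\<^sub>R) t ` V) = {x \<bullet> y | x y. x \<in> U \<and> y \<in> V}"
    by (rule inner_values_scaled_different) (use t unit in auto)
  then have iv: "inner_values 1 t U ((*\<^sub>R) t ` V) = {x \<bullet> y | x y. x \<in> U \<and> y \<in> V}" by simp
  have sub: "{x \<bullet> y | x y. x \<in> U \<and> y \<in> V} \<subseteq> {1 / sqrt (real CARD('n)), - (1 / sqrt (real CARD('n)))}"
  proof
    fix a assume "a \<in> {x \<bullet> y | x y. x \<in> U \<and> y \<in> V}"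
    then obtain x y where xy: "a = x \<bullet> y" "x \<in> U" "y \<in> V" by blast
    have "a\<^sup>2 = (1 / sqrt (real CARD('n)))\<^sup>2"
      using cross_sq_if_unmixed[OF \<sigma> xy(2,3)] by (simp add: xy(1) power_divide)
    then show "a \<in> {1 / sqrt (real CARD('n)), - (1 / sqrt (real CARD('n)))}"
      by (simp only: power2_eq_iff insert_iff empty_iff simp_thms)
  qed
  \<comment> \<open>Every cross value is a square root of \<open>1 / n\<close>; having two values
    forces both signs to occur.\<close>
  have "{x \<bullet> y | x y. x \<in> U \<and> y \<in> V} = {1 / sqrt (real CARD('n)), - (1 / sqrt (real CARD('n)))}"
    by (rule card_seteq[OF _ sub]) (use cross2 in \<open>auto intro: order_trans[OF card_insert_le_m1]\<close>)
  then show "inner_values 1 t U ((*\<^sub>R) t ` V) = {1 / sqrt (real CARD('n)), - (1 / sqrt (real CARD('n)))}" using iv by simp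
  show "\<forall>x\<in>U. (if norm x = 1 then 1 else d2 / d1 / t ^ 4) = 1" using nU by simp
  show "\<forall>x\<in>(*\<^sub>R) t ` V. (if norm x = 1 then 1 else d2 / d1 / t ^ 4)
      = (2 * real k + 1)\<^sup>2 * (real k - 1) ^ 4 / ((2 * real k - 3)\<^sup>2 * real k ^ 4) / t ^ 4"
    using nV t(2) d by simp
qed

text \<open>Here \<open>s1 = - 1\<close>, so distinct points have inner product \<open>0\<close> or
  \<open>- 1\<close>, the latter only for antipodes. A point without its antipode would be
  orthogonal to all others, against the vanishing first moment.\<close>

lemma square_layer:
  assumes \<sigma>: "\<sigma> = 0" and n: "CARD('n) = 2" and U4: "card U = 4"
  obtains u v where "u \<bullet> u = 1" "v \<bullet> v = 1" "u \<bullet> v = 0" "U = {u, - u, v, - v}"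
proof -
  have s: "s1 = - 1" using unmixed_layer(6)[OF \<sigma>] n U4 by simp
  have val: "x \<bullet> y = 0 \<or> x \<bullet> y = - 1" if "x \<in> U" "y \<in> U" "x \<noteq> y" for x y
  proof -
    have "(x \<bullet> y)\<^sup>2 + (x \<bullet> y) = 0" using layer_quadratic_if_unmixed[OF \<sigma> that] s by simp
    then have "(x \<bullet> y) * (x \<bullet> y + 1) = 0" by (simp add: power2_eq_square algebra_simps)
    then show ?thesis by (simp add: eq_neg_iff_add_eq_0)
  qed
  have anti: "y = - x" if "x \<in> U" "y \<in> U" "x \<bullet> y = - 1" for x y
    using unit_inner_eq_1D[of "- x" y] that unit(1) by simp
  have neg: "- x \<in> U" if x: "x \<in> U" for x
  proof (rule ccontr)
    assume no: "- x \<notin> U"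
    have "x \<bullet> z = (if z = x then 1 else 0)" if "z \<in> U" for z
      using val[OF x that] anti[OF x that] unit(1)[OF x] no that by auto
    then have "(\<Sum>z\<in>U. x \<bullet> z) = (\<Sum>z\<in>U. if z = x then 1 else 0)" by (intro sum.cong refl) auto
    then show False using U1[of x] x fin by simp
  qed
  obtain u where u: "u \<in> U" using ne by auto
  have "\<not> U \<subseteq> {u, - u}"
  proof
    assume "U \<subseteq> {u, - u}"
    then have "card U \<le> card {u, - u}" by (intro card_mono) auto
    also have "\<dots> \<le> 2" by (simp add: card_insert_if)
    finally show False using U4 by simp
  qed
  then obtain v where v: "v \<in> U" "v \<noteq> u" "v \<noteq> - u" by blast
  have uv: "u \<bullet> v = 0" using val[OF u v(1)] anti[OF u v(1)] v by auto
  have nz: "x \<noteq> - x" if "x \<in> U" for x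
  proof
    assume "x = - x"
    then have "x \<bullet> x = - (x \<bullet> x)" by (metis inner_minus_right)
    then show False using unit(1)[OF that] by simp
  qed
  have "- v \<noteq> u" "- v \<noteq> - u" using v by auto
  then have "card {u, - u, v, - v} = 4" using v nz[OF u] nz[OF v(1)] by auto
  moreover have "{u, - u, v, - v} \<subseteq> U" using u v neg by auto
  ultimately have "{u, - u, v, - v} = U" using U4 fin by (intro card_seteq) auto
  then show thesis by (intro that[of u v] unit(1) u v(1) uv) (rule sym)
qed

text \<open>\<open>V\<close> is the square \<open>U\<close> turned by 45 degrees. The isometry is
  chosen independently of \<open>t\<close>, so the same coordinates serve the whole family.\<close>

lemma two_squares_if_unmixed:
  assumes \<sigma>: "\<sigma> = 0" and n: "CARD('n) = 2" and U4: "card U = 4" and V4: "card V = 4"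
  obtains f :: "real^'n \<Rightarrow> real^'n" and Y1 Y2 where "orthogonal_transformation f" "f ` Y1 = U"
    "\<And>t. f ` Y2 t = (*\<^sub>R) t ` V" "d1 = d2"
    "\<And>t. t > 0 \<Longrightarrow> t \<noteq> 1 \<Longrightarrow> two_squares_design t Y1 (Y2 t) (\<lambda>x. if norm x = 1 then 1 else d2 / d1 / t ^ 4)"
proof -
  obtain u v where uv: "u \<bullet> u = 1" "v \<bullet> v = 1" "u \<bullet> v = 0" "U = {u, - u, v, - v}"
    using square_layer[OF \<sigma> n U4] .
  have vu: "v \<bullet> u = 0" using uv(3) by (simp add: inner_commute)
  \<comment> \<open>The bisectors of the square \<open>U\<close>: they will be the points of
    \<open>V\<close> and the images under \<open>f\<close> of the coordinate axes.\<close>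
  define p where "p = (1 / sqrt 2) *\<^sub>R (u + v)"
  define q where "q = (1 / sqrt 2) *\<^sub>R (u - v)"
  have pq: "p \<bullet> p = 1" "q \<bullet> q = 1" "p \<bullet> q = 0" "q \<bullet> p = 0"
    by (simp_all add: p_def q_def inner_add_left inner_add_right inner_diff_left inner_diff_right uv vu)
  have u_eq: "u = (1 / sqrt 2) *\<^sub>R (p + q)" and v_eq: "v = (1 / sqrt 2) *\<^sub>R (p - q)"
    by (simp_all add: p_def q_def scaleR_add_right[symmetric] scaleR_diff_right[symmetric])
  have V: "V = {p, - p, q, - q}"
  proof -
    have sub: "V \<subseteq> {p, - p, q, - q}"
    proof
      fix y assume y: "y \<in> V"
      define a where "a = u \<bullet> y"
      define b where "b = v \<bullet> y"
      have "a\<^sup>2 = 1 / 2" "b\<^sup>2 = 1 / 2"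
        using cross_sq_if_unmixed[OF \<sigma> _ y] uv(4) n by (auto simp: a_def b_def)
      moreover from this have "a\<^sup>2 = (1 / sqrt 2)\<^sup>2" "b\<^sup>2 = (1 / sqrt 2)\<^sup>2" by (simp_all add: power_divide)
      ultimately have ab: "a = 1 / sqrt 2 \<or> a = - (1 / sqrt 2)" "b = 1 / sqrt 2 \<or> b = - (1 / sqrt 2)"
        "a\<^sup>2 + b\<^sup>2 = 1" unfolding power2_eq_iff by simp_all
      have yu: "y \<bullet> u = a" "y \<bullet> v = b" "u \<bullet> y = a" "v \<bullet> y = b" by (simp_all add: a_def b_def inner_commute)
      \<comment> \<open>The squared distance from \<open>y\<close> to its projection on the span of
        \<open>u\<close> and \<open>v\<close>; it vanishes because both squared coordinates are
        \<open>1 / 2\<close>.\<close>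
      have "(y - (a *\<^sub>R u + b *\<^sub>R v)) \<bullet> (y - (a *\<^sub>R u + b *\<^sub>R v)) = 1 - (a\<^sup>2 + b\<^sup>2)"
        using unit(2)[OF y]
        by (simp add: inner_add_left inner_add_right inner_diff_left inner_diff_right uv(1-3) vu yu power2_eq_square)
      then have "y = a *\<^sub>R u + b *\<^sub>R v" using ab(3) by simp
      then show "y \<in> {p, - p, q, - q}" using ab(1,2)
        by (auto simp: p_def q_def scaleR_add_right scaleR_diff_right)
    qed
    have "card {p, - p, q, - q} \<le> 4" by (intro order_trans[OF card_insert_le_m1]) auto
    then show ?thesis using V4 by (intro card_seteq[OF _ sub]) auto
  qed
  obtain i j :: 'n where ij: "i \<noteq> j" "UNIV = {i, j}" using n by (metis card_2_iff)
  define f where "f x = (x $ i) *\<^sub>R p + (x $ j) *\<^sub>R q" for x :: "real^'n"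
  have f: "orthogonal_transformation f"
    unfolding orthogonal_transformation_def
  proof (intro conjI allI)
    show "linear f" by (rule linearI) (simp_all add: f_def algebra_simps)
    fix x y
    have "f x \<bullet> f y = x $ i * y $ i + x $ j * y $ j"
      by (simp add: f_def inner_add_left inner_add_right pq)
    then show "f x \<bullet> f y = x \<bullet> y" using ij(1) by (simp add: inner_vec_def ij(2))
  qed
  have fpv: "f (plane_vec i j a b) = a *\<^sub>R p + b *\<^sub>R q" for a b
    using ij(1) by (simp add: f_def plane_vec_def axis_def)
  have fneg: "f (- x) = - f x" for x by (simp add: f_def)
  define Y1 where "Y1 = {plane_vec i j (1 / sqrt 2) (1 / sqrt 2), - plane_vec i j (1 / sqrt 2) (1 / sqrt 2),
              plane_vec i j (1 / sqrt 2) (- (1 / sqrt 2)), - plane_vec i j (1 / sqrt 2) (- (1 / sqrt 2))}"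
  define Y2 where "Y2 t = {plane_vec i j t 0, plane_vec i j (- t) 0, plane_vec i j 0 t, plane_vec i j 0 (- t)}" for t
  have fY1: "f ` Y1 = U"
    unfolding Y1_def image_insert image_empty fneg fpv uv(4)
    using u_eq v_eq by (simp add: scaleR_add_right scaleR_diff_right)
  have fY2: "f ` Y2 t = (*\<^sub>R) t ` V" for t
    unfolding Y2_def image_insert image_empty fpv V by simp
  have dd: "d1 = d2"
  proof -
    have "g1 = g2" using unmixed_layer(4)[OF \<sigma>] S.unmixed_layer(4)[OF \<sigma>] n U4 V4 by simp
    then show ?thesis using weight_ratio_if_unmixed[OF \<sigma>] unmixed_layer(3)[OF \<sigma>] by simp
  qed
  have "two_squares_design t Y1 (Y2 t) (\<lambda>x. if norm x = 1 then 1 else d2 / d1 / t ^ 4)" if t: "t > 0" "t \<noteq> 1" for t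
    unfolding two_squares_design_def
  proof (intro conjI)
    show "euclidean_design 4 (Y1 \<union> Y2 t) (\<lambda>x. if norm x = 1 then 1 else d2 / d1 / t ^ 4)"
      by (rule rescaled_design_if_unmixed[OF \<sigma> t f fY1 fY2])
    have nf: "norm (f x) = norm x" for x using f orthogonal_transformation_norm by blast
    have "norm x = 1" if "x \<in> Y1" for x
    proof -
      have "f x \<in> U" using that fY1 by blast
      then have "norm (f x) = 1" using unit(1) by (simp only: norm_eq_1)
      then show ?thesis by (simp only: nf)
    qed
    then show "\<forall>x\<in>Y1. (if norm x = 1 then 1 else d2 / d1 / t ^ 4) = 1" by simp
    have "norm x = t" if "x \<in> Y2 t" for x
    proof -
      have "f x \<in> (*\<^sub>R) t ` V" using that fY2 by blast
      then obtain z where z: "z \<in> V" "f x = t *\<^sub>R z" by blast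
      have "norm z = 1" using unit(2)[OF z(1)] by (simp only: norm_eq_1)
      then have "norm (f x) = t" using z(2) t by simp
      then show ?thesis by (simp only: nf)
    qed
    then show "\<forall>x\<in>Y2 t. (if norm x = 1 then 1 else d2 / d1 / t ^ 4) = 1 / t ^ 4" using t(2) dd pos by simp
    show "\<exists>i j. i \<noteq> j \<and>
        Y1 = {plane_vec i j (1 / sqrt 2) (1 / sqrt 2), - plane_vec i j (1 / sqrt 2) (1 / sqrt 2),
              plane_vec i j (1 / sqrt 2) (- (1 / sqrt 2)), - plane_vec i j (1 / sqrt 2) (- (1 / sqrt 2))} \<and>
        Y2 t = {plane_vec i j t 0, plane_vec i j (- t) 0, plane_vec i j 0 t, plane_vec i j 0 (- t)}"
      using ij(1) Y1_def Y2_def by blast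
  qed (rule n)
  then show thesis using that f fY1 fY2 dd by blast
qed

end

text \<open>The family for all \<open>t\<close> is built from the normalised layers themselves; the
  given set is similar to its member with \<open>t = r2 / r1\<close>.\<close>

lemma similar_conclusion:
  fixes U V :: "(real^'n) set"
  assumes kp: "kernel_pair U V c1 c2 (w1 * r1 ^ 4) (w2 * r2 ^ 4) 0 s1 g1 s2 g2" and le: "card U \<le> card V"
    and cross2: "card {x \<bullet> y | x y. x \<in> U \<and> y \<in> V} = 2"
    and r: "r1 > 0" "r2 > 0" "r1 \<noteq> r2" and w: "w1 > 0"
    and wx: "\<And>x. x \<in> U \<Longrightarrow> w (r1 *\<^sub>R x) = w1" "\<And>x. x \<in> V \<Longrightarrow> w (r2 *\<^sub>R x) = w2"
  shows "(\<exists>X1' X2' w'.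
        (\<forall>t>0. t \<noteq> 1 \<longrightarrow> two_squares_design t X1' (X2' t) (w' t)) \<and>
        (\<exists>t>0. t \<noteq> 1 \<and> similar_weighted ((*\<^sub>R) r1 ` U \<union> (*\<^sub>R) r2 ` V) w (X1' \<union> X2' t) (w' t))) \<or>
     (\<exists>k\<ge>2. \<exists>X1' X2' w'.
        (\<forall>t>0. t \<noteq> 1 \<longrightarrow> k_family_design k t X1' (X2' t) (w' t)) \<and>
        (\<exists>t>0. t \<noteq> 1 \<and> similar_weighted ((*\<^sub>R) r1 ` U \<union> (*\<^sub>R) r2 ` V) w (X1' \<union> X2' t) (w' t)))"
proof -
  interpret kernel_pair U V c1 c2 "w1 * r1 ^ 4" "w2 * r2 ^ 4" 0 s1 g1 s2 g2 by fact
  let ?w = "\<lambda>t x. if norm (x::real^'n) = 1 then 1 else (w2 * r2 ^ 4) / (w1 * r1 ^ 4) / t ^ 4"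
  have t: "r2 / r1 > 0" "r2 / r1 \<noteq> 1" using r by auto
  have sim: "similar_weighted ((*\<^sub>R) r1 ` U \<union> (*\<^sub>R) r2 ` V) w (Y1 \<union> Y2) (?w (r2 / r1))"
    if "orthogonal_transformation f" "f ` Y1 = U" "f ` Y2 = (*\<^sub>R) (r2 / r1) ` V" for f :: "real^'n \<Rightarrow> real^'n" and Y1 Y2
    by (rule similar_weighted_rescaled[OF r w unit wx that])
  from parameters_if_unmixed[OF refl le]
  consider "CARD('n) = 2" "card U = 4" "card V = 4"
    | k :: nat where "k \<ge> 2" "int CARD('n) = (2 * int k - 1)\<^sup>2 - 4"
      "int (card U) = 2 * (2 * int k + 1) * (int k - 1) ^ 3" "int (card V) = 2 * int k ^ 3 * (2 * int k - 3)"
      "s1 = - 2 / (real k * (2 * real k - 3))" "s2 = - 2 / ((real k - 1) * (2 * real k + 1))"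
      "(w2 * r2 ^ 4) / (w1 * r1 ^ 4) = (2 * real k + 1)\<^sup>2 * (real k - 1) ^ 4 / ((2 * real k - 3)\<^sup>2 * real k ^ 4)"
    by blast
  then show ?thesis
  proof cases
    case 1
    obtain f :: "real^'n \<Rightarrow> real^'n" and Y1 Y2 where Y: "orthogonal_transformation f" "f ` Y1 = U"
      "\<And>t. f ` Y2 t = (*\<^sub>R) t ` V"
      "\<And>t. t > 0 \<Longrightarrow> t \<noteq> 1 \<Longrightarrow> two_squares_design t Y1 (Y2 t) (?w t)"
      using two_squares_if_unmixed[OF refl 1] by metis
    have "similar_weighted ((*\<^sub>R) r1 ` U \<union> (*\<^sub>R) r2 ` V) w (Y1 \<union> Y2 (r2 / r1)) (?w (r2 / r1))"
      by (rule sim[OF Y(1,2,3)])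
    then show ?thesis using Y(4) t by (intro disjI1 exI[of _ Y1] exI[of _ Y2] exI[of _ ?w]) blast
  next
    case 2
    have "similar_weighted ((*\<^sub>R) r1 ` U \<union> (*\<^sub>R) r2 ` V) w (U \<union> (*\<^sub>R) (r2 / r1) ` V) (?w (r2 / r1))"
      by (rule sim[where f="\<lambda>x. x"]) auto
    moreover have "k_family_design k t U ((*\<^sub>R) t ` V) (?w t)" if "t > 0" "t \<noteq> 1" for t
      by (rule k_family_design_if_unmixed[OF refl cross2 2 that])
    ultimately show ?thesis using t 2(1)
      by (intro disjI2 exI[of _ k] conjI exI[of _ U] exI[of _ "\<lambda>t. (*\<^sub>R) t ` V"] exI[of _ ?w]) blast+
  qed
qed

theorem theorem1p6:
  fixes X :: "nat \<Rightarrow> (real^'n) set" and r :: "nat \<Rightarrow> real" and w :: "real^'n \<Rightarrow> real"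
  assumes "CARD('n) \<ge> 2"
    and "euclidean_design 4 (X 1 \<union> X 2) w"
    and "r 1 \<ge> 0" and "r 2 \<ge> 0" and "r 1 \<noteq> r 2"
    and "\<And>l. l \<in> {1, 2} \<Longrightarrow> X l \<noteq> {} \<and> X l \<subseteq> sphere 0 (r l)"
    and "0 \<notin> X 1 \<union> X 2"
    and "\<And>l x y. l \<in> {1, 2} \<Longrightarrow> x \<in> X l \<Longrightarrow> y \<in> X l \<Longrightarrow> w x = w y"
    and "\<And>l m. l \<in> {1, 2} \<Longrightarrow> m \<in> {1, 2} \<Longrightarrow>
           card (inner_values (r l) (r m) (X l) (X m)) \<le> 2"
  shows "coherent_configuration (X 1 \<union> X 2) (layer_relations {1, 2} r X) \<and>
    card (inner_values (r 1) (r 2) (X 1) (X 2)) = 2 \<and>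
    (tight_euclidean_design 2 (X 1 \<union> X 2) w \<or>
     (\<exists>X\<^sub>1' X\<^sub>2' w'.
        (\<forall>r\<^sub>2>0. r\<^sub>2 \<noteq> 1 \<longrightarrow> two_squares_design r\<^sub>2 X\<^sub>1' (X\<^sub>2' r\<^sub>2) (w' r\<^sub>2)) \<and>
        (\<exists>r\<^sub>2>0. r\<^sub>2 \<noteq> 1 \<and> similar_weighted (X 1 \<union> X 2) w (X\<^sub>1' \<union> X\<^sub>2' r\<^sub>2) (w' r\<^sub>2))) \<or>
     (\<exists>k\<ge>2. \<exists>X\<^sub>1' X\<^sub>2' w'.
        (\<forall>r\<^sub>2>0. r\<^sub>2 \<noteq> 1 \<longrightarrow> k_family_design k r\<^sub>2 X\<^sub>1' (X\<^sub>2' r\<^sub>2) (w' r\<^sub>2)) \<and>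
        (\<exists>r\<^sub>2>0. r\<^sub>2 \<noteq> 1 \<and> similar_weighted (X 1 \<union> X 2) w (X\<^sub>1' \<union> X\<^sub>2' r\<^sub>2) (w' r\<^sub>2))))"
proof -
  have ed: "euclidean_design 4 (X 1 \<union> X 2) w" by fact
  have nrm: "norm x = r l" if "l \<in> {1, 2}" "x \<in> X l" for l x
    using assms(6)[OF that(1)] that(2) by (auto simp: subset_iff)
  \<comment> \<open>A layer of radius 0 would contain the origin.\<close>
  have rpos: "r l > 0" if l: "l \<in> {1, 2}" for l
  proof -
    obtain x where x: "x \<in> X l" using assms(6)[OF l] by auto
    then have "x \<noteq> 0" using l assms(7) by auto
    then show ?thesis using nrm[OF l x] by (metis zero_less_norm_iff)
  qed
  have r: "r 1 > 0" "r 2 > 0" using rpos by auto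
  define U where "U = (\<lambda>x. x /\<^sub>R r 1) ` X 1"
  define V where "V = (\<lambda>x. x /\<^sub>R r 2) ` X 2"
  have X: "X 1 = (*\<^sub>R) (r 1) ` U" "X 2 = (*\<^sub>R) (r 2) ` V"
    using r by (auto simp: U_def V_def image_image)
  have ws: "weighted_set (X 1 \<union> X 2) w" using ed by (simp add: euclidean_design_def)
  then have finX: "finite (X 1)" "finite (X 2)" and wp: "\<And>x. x \<in> X 1 \<union> X 2 \<Longrightarrow> w x > 0"
    by (auto simp: weighted_set_def)
  have neX: "X 1 \<noteq> {}" "X 2 \<noteq> {}" using assms(6) by auto
  have fin: "finite U" "finite V" and ne: "U \<noteq> {}" "V \<noteq> {}" using finX neX by (auto simp: U_def V_def)
  have unit: "x \<bullet> x = 1" if "x \<in> U \<or> x \<in> V" for x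
  proof -
    have "norm x = 1" using that nrm[of 1] nrm[of 2] r by (auto simp: U_def V_def)
    then show ?thesis by (simp only: norm_eq_1)
  qed
  then have unitU: "\<And>x. x \<in> U \<Longrightarrow> x \<bullet> x = 1" and unitV: "\<And>x. x \<in> V \<Longrightarrow> x \<bullet> x = 1" by auto
  obtain x1 x2 where x12: "x1 \<in> X 1" "x2 \<in> X 2" using neX by auto
  define w\<^sub>1 where "w\<^sub>1 = w x1"
  define w\<^sub>2 where "w\<^sub>2 = w x2"
  have wX: "\<And>x. x \<in> X 1 \<Longrightarrow> w x = w\<^sub>1" "\<And>x. x \<in> X 2 \<Longrightarrow> w x = w\<^sub>2"
    unfolding w\<^sub>1_def w\<^sub>2_def using x12 by (blast intro: assms(8)[of 1] assms(8)[of 2])+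
  have wpos: "w\<^sub>1 > 0" "w\<^sub>2 > 0" using wp x12 by (auto simp: w\<^sub>1_def w\<^sub>2_def)
  have sph: "X 1 \<subseteq> sphere 0 (r 1)" "X 2 \<subseteq> sphere 0 (r 2)" using assms(6) by auto
  have "design_moments (X 1) (r 1) w\<^sub>1 (X 2) (r 2) w\<^sub>2"
    using euclidean_design_4_iff[where w = w, OF finX neX sph r assms(5) wpos wX] ed by blast
  then have udp: "unit_design_pair U V (w\<^sub>1 * r 1 ^ 3) (w\<^sub>2 * r 2 ^ 3) (w\<^sub>1 * r 1 ^ 4) (w\<^sub>2 * r 2 ^ 4)"
    unfolding X
    by (rule design_moments_imp_unit_design_pair[OF _ r assms(5) wpos fin ne unitU unitV assms(1)])
  interpret unit_design_pair U V "w\<^sub>1 * r 1 ^ 3" "w\<^sub>2 * r 2 ^ 3" "w\<^sub>1 * r 1 ^ 4" "w\<^sub>2 * r 2 ^ 4"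
    by (rule udp)
  have iv: "inner_values (r 1) (r 1) (X 1) (X 1) = {x \<bullet> y | x y. x \<in> U \<and> y \<in> U \<and> x \<noteq> y}"
    "inner_values (r 2) (r 2) (X 2) (X 2) = {x \<bullet> y | x y. x \<in> V \<and> y \<in> V \<and> x \<noteq> y}"
    "inner_values (r 1) (r 2) (X 1) (X 2) = {x \<bullet> y | x y. x \<in> U \<and> y \<in> V}"
    unfolding X
    by (rule inner_values_scaled_same[OF r(1)], rule inner_values_scaled_same[OF r(2)],
        rule inner_values_scaled_different[OF r assms(5) unitU unitV])
  have le2: "card {x \<bullet> y | x y. x \<in> U \<and> y \<in> V} \<le> 2" using assms(9)[of 1 2] iv by simp
  have within: "card {x \<bullet> y | x y. x \<in> U \<and> y \<in> U \<and> x \<noteq> y} \<le> 2"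
    "card {x \<bullet> y | x y. x \<in> V \<and> y \<in> V \<and> x \<noteq> y} \<le> 2"
    using assms(9)[of 1 1] assms(9)[of 2 2] iv by simp_all
  have cross2: "card {x \<bullet> y | x y. x \<in> U \<and> y \<in> V} = 2" by (rule cross_values(1)[OF le2])
  have coh: "coherent_configuration (\<Union>(X ` {1, 2})) (layer_relations {1, 2} r X)"
  \<comment> \<open>\<open>\<kappa>\<close> is the second moment constant of a layer at its actual
    radius.\<close>
  proof (rule coherent_layer_relations[where \<kappa> = "\<lambda>l. (r l)\<^sup>2 * (if l = 1 then card U / CARD('n) else card V / CARD('n))"])
    have inj: "inj_on ((*\<^sub>R) (r 1)) U" "inj_on ((*\<^sub>R) (r 2)) V" using r by (auto simp: inj_on_def)
    fix l m :: nat and a b x :: "real^'n" assume l: "l \<in> {1, 2}"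
    show "finite (X l)" "X l \<noteq> {}" using finX neX l by auto
    show "r l > 0" using rpos l .
    show "x \<bullet> x = r l * r l" if "x \<in> X l"
      using nrm[OF l that] by (simp add: power2_norm_eq_inner[symmetric] power2_eq_square)
    have "(\<Sum>z\<in>X 1. a \<bullet> z) = r 1 * (\<Sum>z\<in>U. a \<bullet> z)" "(\<Sum>z\<in>X 2. a \<bullet> z) = r 2 * (\<Sum>z\<in>V. a \<bullet> z)"
      unfolding X sum.reindex[OF inj(1)] sum.reindex[OF inj(2)] o_def by (simp_all add: sum_distrib_left)
    then show "(\<Sum>z\<in>X l. a \<bullet> z) = 0" using l U1 V1 by auto
    have "(\<Sum>z\<in>X 1. (a \<bullet> z) * (b \<bullet> z)) = (r 1)\<^sup>2 * (\<Sum>z\<in>U. (a \<bullet> z) * (b \<bullet> z))"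
      "(\<Sum>z\<in>X 2. (a \<bullet> z) * (b \<bullet> z)) = (r 2)\<^sup>2 * (\<Sum>z\<in>V. (a \<bullet> z) * (b \<bullet> z))"
      unfolding X sum.reindex[OF inj(1)] sum.reindex[OF inj(2)] o_def
      by (simp_all add: sum_distrib_left power2_eq_square mult_ac)
    then show "(\<Sum>z\<in>X l. (a \<bullet> z) * (b \<bullet> z))
        = (r l)\<^sup>2 * (if l = 1 then card U / CARD('n) else card V / CARD('n)) * (a \<bullet> b)"
      using l U2 V2 by auto
    assume m: "m \<in> {1, 2}"
    show "l = m" if "x \<in> X l" "x \<in> X m"
      using nrm[OF l that(1)] nrm[OF m that(2)] l m assms(5) by auto
    show "card (inner_values (r l) (r m) (X l) (X m)) \<le> 2" using assms(9) l m .
  qed simp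
  obtain \<sigma> s1 g1 s2 g2 where
    kp: "kernel_pair U V (w\<^sub>1 * r 1 ^ 3) (w\<^sub>2 * r 2 ^ 3) (w\<^sub>1 * r 1 ^ 4) (w\<^sub>2 * r 2 ^ 4) \<sigma> s1 g1 s2 g2"
    using kernel_pair_exists[OF le2 within] by blast
  have wU: "\<And>x. x \<in> U \<Longrightarrow> w (r 1 *\<^sub>R x) = w\<^sub>1" "\<And>x. x \<in> V \<Longrightarrow> w (r 2 *\<^sub>R x) = w\<^sub>2"
    using wX X by auto
  have "tight_euclidean_design 2 (X 1 \<union> X 2) w" if \<sigma>: "\<sigma> \<noteq> 0"
  proof -
    have "N + M = (real CARD('n) + 1) * (real CARD('n) + 2) / 2"
      by (rule kernel_pair.card_sum_if_mixed[OF kp \<sigma>])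
    moreover have "real ((CARD('n) + 2) choose 2) = (real CARD('n) + 1) * (real CARD('n) + 2) / 2"
      by (simp add: choose_two real_of_nat_div algebra_simps)
    ultimately have "real (card U + card V) = real ((CARD('n) + 2) choose 2)" by simp
    then have UV: "card U + card V = (CARD('n) + 2) choose 2" by (simp only: of_nat_eq_iff)
    have "card (X 1) = card U" "card (X 2) = card V"
      using r unfolding X by (auto intro!: card_image simp: inj_on_def)
    moreover have "X 1 \<inter> X 2 = {}" using sph assms(5) by (metis disjoint_iff mem_sphere_0 subsetD)
    ultimately have cX: "card (X 1 \<union> X 2) = (CARD('n) + 2) choose 2"
      using UV card_Un_disjoint[OF finX] by simp
    have "norm ` X 1 = {r 1}" "norm ` X 2 = {r 2}" using neX sph by force+
    then have "support_spheres (X 1 \<union> X 2) = sphere 0 (r 1) \<union> sphere 0 (r 2)"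
      by (simp add: support_spheres_def image_Un Un_commute)
    then show ?thesis unfolding tight_euclidean_design_def
      using ed cX dim_poly_funs_on_two_spheres[OF r assms(5), where 'n='n] by simp
  qed
  moreover have "(\<exists>X\<^sub>1' X\<^sub>2' w'.
        (\<forall>r\<^sub>2>0. r\<^sub>2 \<noteq> 1 \<longrightarrow> two_squares_design r\<^sub>2 X\<^sub>1' (X\<^sub>2' r\<^sub>2) (w' r\<^sub>2)) \<and>
        (\<exists>r\<^sub>2>0. r\<^sub>2 \<noteq> 1 \<and> similar_weighted (X 1 \<union> X 2) w (X\<^sub>1' \<union> X\<^sub>2' r\<^sub>2) (w' r\<^sub>2))) \<or>
     (\<exists>k\<ge>2. \<exists>X\<^sub>1' X\<^sub>2' w'.
        (\<forall>r\<^sub>2>0. r\<^sub>2 \<noteq> 1 \<longrightarrow> k_family_design k r\<^sub>2 X\<^sub>1' (X\<^sub>2' r\<^sub>2) (w' r\<^sub>2)) \<and>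
        (\<exists>r\<^sub>2>0. r\<^sub>2 \<noteq> 1 \<and> similar_weighted (X 1 \<union> X 2) w (X\<^sub>1' \<union> X\<^sub>2' r\<^sub>2) (w' r\<^sub>2)))"
    if \<sigma>: "\<sigma> = 0"
  proof (cases "card U \<le> card V")
    case True
    show ?thesis unfolding X
      by (rule similar_conclusion[OF kp[unfolded \<sigma>] True cross2 r assms(5) wpos(1) wU])
  next
    \<comment> \<open>The smaller layer has to come first, so the layers exchange their roles;
      nothing is assumed about which radius is larger.\<close>
    case False
    have "card {x \<bullet> y | x y. x \<in> V \<and> y \<in> U} = 2"
    proof -
      have "{x \<bullet> y | x y. x \<in> V \<and> y \<in> U} = {x \<bullet> y | x y. x \<in> U \<and> y \<in> V}"
        using inner_commute by blast
      then show ?thesis using cross2 by simp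
    qed
    moreover have "card V \<le> card U" using False by simp
    ultimately show ?thesis unfolding X Un_commute[of "(*\<^sub>R) (r 1) ` U"]
      by (intro similar_conclusion[OF kernel_pair_swap[OF kp[unfolded \<sigma>]] _ _ r(2,1) assms(5)[symmetric] wpos(2) wU(2,1)])
  qed
  ultimately show ?thesis using coh cross2 iv(3) by (cases "\<sigma> = 0") simp_all
qed

end
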